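(* There exists a weakly minimal cubical 2-knot in $\mathbb{R}^4$ with area $130$ that is isotopic to the spun trefoil knot $\mathrm{Spin}(T_{2,3})$.
   Context: **Cubulation.** The canonical cubulation $\mathcal{C}$ of $\mathbb{R}^4$ is its decomposition into the hypercubes obtained from $[0,1]^4$ by translations by integer vectors. Its 2-skeleton $\mathcal{S}^2$ is the union of all unit squares that are 2-faces of these hypercubes. For an integer $m\ge 1$, $\mathcal{C}_m$ is the subcubulation obtained by subdividing each $k$-dimensional cell of $\mathcal{C}$ into $m^k$ congruent $k$-cells (of side $1/m$), and $\mathcal{S}^2_m$ is its 2-skeleton. **Cubical 2-knots and area.** A 2-knot is a subset of $\mathbb{R}^4$ that is an embedded 2-sphere. A cubical 2-knot is a 2-knot $K^2\subset\mathbb{R}^4$ that is contained in $\mathcal{S}^2$, so it is a union of finitely many unit squares of $\mathcal{C}$. Its area $\mathrm{Area}(K^2)$ is the number of these unit squares. **Isotopic.** Two 2-knots $K_1,K_2\subset\mathbb{R}^4$ are isotopic (equivalent) if there is a homeomorphism $h:\mathbb{R}^4\to\mathbb{R}^4$ with $h(K_1)=K_2$. **Spun trefoil.** Let $\mathbb{R}^3_+=\{(x_1,x_2,x_3,0): x_3\ge 0\}\subset\mathbb{R}^4$, with boundary plane $\mathbb{R}^2=\{(x_1,x_2,0,0)\}$. For $X\subset\mathbb{R}^3_+$ let $\mathrm{Spin}(X)=\{(x_1,x_2,x_3\cos 2\pi\theta,x_3\sin 2\pi\theta) : (x_1,x_2,x_3,0)\in X,\ 0\le\theta\le 1\}$.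 If $B\subset\mathbb{R}^3_+$ is a tame arc whose two distinct end-points lie in $\mathbb{R}^2$ and whose interior lies in $\mathbb{R}^3_+\setminus\mathbb{R}^2$, then $\mathrm{Spin}(B)$ is a 2-knot. The spun trefoil knot $\mathrm{Spin}(T_{2,3})$ is (the isotopy class of) $\mathrm{Spin}(B)$ for such an arc $B$ which, closed up by an arc in $\mathbb{R}^2$ joining its end-points, is a trefoil knot $T_{2,3}$. **Cubulated moves.** These are the following two moves, each allowed in both directions. - (M1) Subdivision: for an integer $m\ge1$, replace $\mathcal{C}$ by $\mathcal{C}_m$ and regard $K^2\subset\mathcal{S}^2$ as a subset of $\mathcal{S}^2_m$, each square of $K^2$ being subdivided into $m^2$ congruent squares. The set $K^2$ and its (Euclidean) area do not change. The inverse of an (M1)-move is available when, for some integer $k>1$, $K^2$ is contained in the 2-skeleton of the cubulation $H_k(\mathcal{C})$, where $H_k(x)=kx$. It replaces $K^2$ by the cubical 2-knot $\frac1k K^2\subset\mathcal{S}^2$. - (M2) Face boundary move: suppose $K^2$ is contained in $\mathcal{S}^2_m$ for some $m\geq 1$. Let $Q^4$ be a 4-cube of $\mathcal{C}_m$ such that $A^2=K^2\cap Q^4$ is a connected union of squares of $\mathcal{C}_m$, contained in the boundary $\partial F^3$ of a 3-dimensional face $F^3\subset Q^4$, and homeomorphic to a disk. Then $\partial A^2$ divides $\partial F^3$ into $A^2$ and a complementary cubical disk $B^2$. The move replaces $A^2$ by $B^2$ in $K^2$. If $A^2$ has $p$ squares then $B^2$ has $6-p$ squares. The cases are $p\in\{1,2,3\}$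 together with the inverse moves, so $p\in\{1,\dots,5\}$. **Weakly minimal.** A cubical 2-knot $K^2$ is weakly minimal if its area cannot be reduced by any single cubulated move. *)

theory Defs
  imports "HOL-Analysis.Analysis"
begin

subsection \<open>Cubulations and cubical 2-knots\<close>

text \<open>\<open>cubulation s\<close> is the canonical cubulation rescaled to side length \<open>s\<close>: the
  subcubulation into cells of side \<open>1 / m\<close> is \<open>cubulation (1 / m)\<close>, and the image of the
  canonical cubulation under \<open>x \<mapsto> k x\<close> is \<open>cubulation k\<close>.\<close>

definition cubulation :: "real \<Rightarrow> (real^4) set set" where
  "cubulation s = {cbox (s *\<^sub>R v) (s *\<^sub>R (v + 1)) | v :: real^4. \<forall>i. v $ i \<in> \<int>}"

definition cells :: "real \<Rightarrow> nat \<Rightarrow> (real^4) set set" where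
  "cells s k = {F. \<exists>Q \<in> cubulation s. F face_of Q \<and> aff_dim F = int k}"

definition skeleton2 :: "real \<Rightarrow> (real^4) set" where
  "skeleton2 s = \<Union> (cells s 2)"

definition two_knot :: "(real^4) set \<Rightarrow> bool" where
  "two_knot K \<longleftrightarrow> K homeomorphic sphere (0 :: real^3) 1"

definition cubical_two_knot :: "(real^4) set \<Rightarrow> bool" where
  "cubical_two_knot K \<longleftrightarrow> two_knot K \<and> K \<subseteq> skeleton2 1"

definition area :: "(real^4) set \<Rightarrow> nat" where
  "area K = card {S \<in> cells 1 2. S \<subseteq> K}"

text \<open>Euclidean area of a finite union of squares of side \<open>1 / m\<close>.\<close>

definition euclidean_area :: "nat \<Rightarrow> (real^4) set \<Rightarrow> real" where
  "euclidean_area m K = real (card {S \<in> cells (1 / real m) 2. S \<subseteq> K}) / (real m)\<^sup>2"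

definition isotopic :: "(real^4) set \<Rightarrow> (real^4) set \<Rightarrow> bool" where
  "isotopic K L \<longleftrightarrow> (\<exists>h h'. homeomorphism UNIV UNIV h h' \<and> h ` K = L)"

subsection \<open>Cubulated moves\<close>

text \<open>\<open>cubulated_move K m K'\<close>: a single move turns \<open>K\<close> into \<open>K'\<close>, the latter regarded as a
  subset of the 2-skeleton of the cubulation of side \<open>1 / m\<close>. The rule \<open>face_boundary\<close> does not
  bound the number \<open>p\<close> of squares of \<open>A\<close>. As \<open>A\<close> is a disk, \<open>p\<close> is any of \<open>1, \<dots>, 5\<close>, and
  the inverse of such a move is again an instance of the rule, with \<open>6 - p\<close> in place of \<open>p\<close>.
  The complementary disk is the closure of the complement of \<open>A\<close> in the boundary of \<open>F\<close>,
  so it contains the common boundary curve.\<close>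

inductive cubulated_move :: "(real^4) set \<Rightarrow> nat \<Rightarrow> (real^4) set \<Rightarrow> bool" where
  subdivision:
    "m \<ge> 1 \<Longrightarrow> K \<subseteq> skeleton2 1 \<Longrightarrow> cubulated_move K m K"
| inverse_subdivision:
    "k > 1 \<Longrightarrow> K \<subseteq> skeleton2 (real k) \<Longrightarrow> cubulated_move K 1 ((\<lambda>x. (1 / real k) *\<^sub>R x) ` K)"
| face_boundary:
    "\<lbrakk>m \<ge> 1; K \<subseteq> skeleton2 (1 / real m);
      Q \<in> cubulation (1 / real m); F face_of Q; aff_dim F = 3;
      A = K \<inter> Q; connected A; \<exists>\<S> \<subseteq> cells (1 / real m) 2. A = \<Union>\<S>;
      A \<subseteq> rel_frontier F; A homeomorphic cball (0 :: real^2) 1;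
      B = closure (rel_frontier F - A)\<rbrakk>
     \<Longrightarrow> cubulated_move K m ((K - A) \<union> B)"

definition weakly_minimal :: "(real^4) set \<Rightarrow> bool" where
  "weakly_minimal K \<longleftrightarrow> cubical_two_knot K \<and>
     (\<forall>m K'. cubulated_move K m K' \<longrightarrow> \<not> euclidean_area m K' < real (area K))"

subsection \<open>The spun trefoil\<close>

definition space3 :: "(real^4) set" where
  "space3 = {x. x $ 4 = 0}"

definition half_space3 :: "(real^4) set" where
  "half_space3 = {x. x $ 3 \<ge> 0 \<and> x $ 4 = 0}"

definition plane2 :: "(real^4) set" where
  "plane2 = {x. x $ 3 = 0 \<and> x $ 4 = 0}"

definition spin :: "(real^4) set \<Rightarrow> (real^4) set" where
  "spin X = {vector [x $ 1, x $ 2, x $ 3 * cos (2 * pi * \<theta>), x $ 3 * sin (2 * pi * \<theta>)] | x \<theta>.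
     x \<in> X \<and> 0 \<le> \<theta> \<and> \<theta> \<le> 1}"

text \<open>Tameness is relative to the half-space: some self-homeomorphism of the half-space makes the
  arc polygonal. Such a homeomorphism preserves the boundary plane and extends to 3-space, so this
  implies tameness in 3-space; it also rules out wildness of the arc relative to the plane at
  its end-points.\<close>

definition tame_in_half_space3 :: "(real^4) set \<Rightarrow> bool" where
  "tame_in_half_space3 B \<longleftrightarrow> (\<exists>h h' \<L>. homeomorphism half_space3 half_space3 h h' \<and>
     finite \<L> \<and> (\<forall>L \<in> \<L>. \<exists>a b. L = closed_segment a b) \<and> h ` B = \<Union>\<L>)"

definition spinnable_arc :: "(real \<Rightarrow> real^4) \<Rightarrow> bool" where
  "spinnable_arc g \<longleftrightarrow> arc g \<and> path_image g \<subseteq> half_space3 \<and> tame_in_half_space3 (path_image g) \<and>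
     pathstart g \<in> plane2 \<and> pathfinish g \<in> plane2 \<and>
     g ` {0<..<1} \<subseteq> half_space3 - plane2"

text \<open>The \<open>(2,3)\<close> curve on the torus with core radius 2 and tube radius 1.\<close>

definition standard_trefoil :: "(real^4) set" where
  "standard_trefoil =
     range (\<lambda>t. vector [(2 + cos (3 * t)) * cos (2 * t), (2 + cos (3 * t)) * sin (2 * t), sin (3 * t), 0])"

text \<open>As for 2-knots, equivalence is by arbitrary homeomorphisms, so both mirror images are
  included; their spins are mirror images in 4-space and hence equivalent.\<close>

definition trefoil_knot :: "(real^4) set \<Rightarrow> bool" where
  "trefoil_knot K \<longleftrightarrow> (\<exists>h h'. homeomorphism space3 space3 h h' \<and> h ` standard_trefoil = K)"

definition spun_trefoil :: "(real^4) set \<Rightarrow> bool" where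
  "spun_trefoil S \<longleftrightarrow> (\<exists>g c. spinnable_arc g \<and>
     arc c \<and> path_image c \<subseteq> plane2 \<and> pathstart c = pathstart g \<and> pathfinish c = pathfinish g \<and>
     trefoil_knot (path_image g \<union> path_image c) \<and>
     S = spin (path_image g))"

end

theory Submission
  imports Defs
begin

text \<open>The trefoil, opened into an arc \<open>B\<close> of the half-space and closed by an arc that runs
  in the boundary plane below the whole diagram, needs only two crossings in \<open>B\<close>. Put \<open>B\<close>
  on lattice lines in the plane, at radius \<open>1/2\<close> except for the two overpasses at radius
  \<open>3/2\<close>, and spin it about a unit square instead of a point: a point at radius \<open>r\<close>
  sweeps the boundary of a square of side \<open>2r\<close>. The result \<open>K\<close> is cubical with 130 squares, and
  rounding the squares to circles is a homeomorphism of 4-space onto the spin of \<open>B\<close>.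

  A face boundary move through \<open>p\<close> squares adds \<open>6 - 2p\<close> squares.
  In a proper subdivision two opposite squares of a small cube never both lie in \<open>K\<close>, so
  \<open>p \<le> 3\<close>; in the cubulation itself an enumeration shows that more than three squares of a
  3-cube in \<open>K\<close> form a band around the cube, which is not a disk.

  That \<open>B\<close> closes up to the trefoil is seen by tilting its vertical segments so that it winds
  monotonically twice around an axis. Such a closed 2-braid is moved to the standard trefoil by
  changing first heights and then radii: a map that is affine on every fibre can change one
  coordinate arbitrarily as long as the order at the double points of the projection is kept,
  its coefficients being supplied by Tietze's theorem.\<close>

section \<open>Closed 2-braids\<close>

text \<open>Half-integral radii around the centre (1/2, 1/2) are what makes the knot cubical: the
  square that replaces the circle of radius \<open>r\<close> has its sides on integral walls exactly
  when \<open>r\<close> is half of an odd integer. Two such radii suffice for the two crossings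
  inside \<open>B\<close>; the third crossing of the diagram involves the closing arc, which is
  never spun.

  Equivalence of knots is a homeomorphism of the whole space, so an identification of diagrams would
  still have to be extended off the curve. Changing one coordinate at a time avoids this, because
  each change is a formula on all fibres. It also weakens the comparison: only signs at coincidences
  of one coordinate have to agree, so the crossings of the polygon may lie over other directions
  than those of the standard trefoil.

  In the count of squares after a move the obstacle is that the move deletes the closed disk
  \<open>A\<close> together with its boundary curve. Squares of the knot that share points with
  \<open>A\<close> remain contained in the new set only if the complementary disk gives these points
  back; this depends on the knot being a surface.\<close>

lemma homeomorphism_bij:
  fixes f :: "'a::euclidean_space \<Rightarrow> 'a"
  assumes "continuous_on UNIV f" and "bij f"
  shows "homeomorphism UNIV UNIV f (inv f)"
proof -
  obtain g where g: "homeomorphism UNIV (f ` UNIV) f g"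
    using invariance_of_domain_homeomorphism[of UNIV f] assms by (auto simp: bij_def)
  have "g = inv f"
    using g assms(2) by (metis bij_def bij_inv_eq_iff ext homeomorphism_apply1 iso_tuple_UNIV_I)
  then show ?thesis using g assms(2) by (simp add: bij_is_surj)
qed

text \<open>On a compact set \<open>p\<close> is a closed map onto its image, so a function that is
  constant on the fibres of \<open>p\<close> descends continuously to that image. The image is
  closed, and Tietze extends the result to the whole space.\<close>

lemma continuous_factorization:
  fixes p :: "'a::metric_space \<Rightarrow> 'b::euclidean_space" and a :: "'a \<Rightarrow> real"
  assumes S: "compact S" and p: "continuous_on S p" and a: "continuous_on S a"
    and fac: "\<And>x y. x \<in> S \<Longrightarrow> y \<in> S \<Longrightarrow> p x = p y \<Longrightarrow> a x = a y"
  obtains \<alpha> where "continuous_on UNIV \<alpha>" and "\<And>x. x \<in> S \<Longrightarrow> \<alpha> (p x) = a x"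
proof -
  define g where "g y = a (SOME x. x \<in> S \<and> p x = y)" for y
  have g: "g (p x) = a x" if "x \<in> S" for x
  proof -
    have "(SOME x'. x' \<in> S \<and> p x' = p x) \<in> S \<and> p (SOME x'. x' \<in> S \<and> p x' = p x) = p x"
      by (rule someI[of _ x]) (use that in auto)
    then show ?thesis unfolding g_def using fac that by metis
  qed
  have cl: "closed (p ` S)"
    using S p compact_continuous_image compact_imp_closed by blast
  have "continuous_on (p ` S) g"
    unfolding continuous_on_closed_vimage[OF cl]
  proof (intro allI impI)
    fix T :: "real set" assume "closed T"
    have eq: "g -` T \<inter> p ` S = p ` (S \<inter> a -` T)"
      using g by auto
    have "compact (S \<inter> a -` T)"
      using continuous_closed_preimage[OF a compact_imp_closed[OF S] \<open>closed T\<close>] S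
      by (metis closed_Int_compact inf.idem inf_assoc inf_commute)
    then have "compact (p ` (S \<inter> a -` T))"
      using compact_continuous_image continuous_on_subset[OF p] by blast
    then show "closed (g -` T \<inter> p ` S)" unfolding eq by (rule compact_imp_closed)
  qed
  then obtain \<alpha> where "continuous_on UNIV \<alpha>" "\<And>y. y \<in> p ` S \<Longrightarrow> \<alpha> y = g y"
    using Tietze_unbounded[of "p ` S" g UNIV] cl by auto
  then show ?thesis using that g by force
qed

lemma sphere_complex_square_eq:
  fixes \<zeta> \<xi> :: complex
  assumes "\<zeta>\<^sup>2 = \<xi>\<^sup>2" shows "\<xi> = \<zeta> \<or> \<xi> = - \<zeta>"
  using assms power2_eq_iff by metis

text \<open>A closed 2-braid is encoded by a radius and a height on the circle that double covers the
  directions: the strands over the direction \<open>\<zeta>\<^sup>2\<close> are those of \<open>\<zeta>\<close> and \<open>- \<zeta>\<close>.\<close>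

definition braid_point :: "(complex \<Rightarrow> real) \<Rightarrow> (complex \<Rightarrow> real) \<Rightarrow> complex \<Rightarrow> complex \<times> real" where
  "braid_point \<rho> z \<zeta> = (of_real (\<rho> \<zeta>) * \<zeta>\<^sup>2, z \<zeta>)"

text \<open>The scaling factor is forced only over the double points \<open>p \<zeta> = p (- \<zeta>)\<close>, where the sign
  condition makes it positive; elsewhere it is extended, and the shift corrects the heights.\<close>

lemma affine_fibre_interpolation:
  fixes p :: "complex \<Rightarrow> 'b::euclidean_space" and z z' :: "complex \<Rightarrow> real"
  assumes p: "continuous_on (sphere 0 1) p" and z: "continuous_on (sphere 0 1) z"
    and z': "continuous_on (sphere 0 1) z'"
    and anti: "\<And>\<zeta> \<xi>. \<zeta> \<in> sphere 0 1 \<Longrightarrow> \<xi> \<in> sphere 0 1 \<Longrightarrow> p \<zeta> = p \<xi> \<Longrightarrow> \<xi> = \<zeta> \<or> \<xi> = - \<zeta>"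
    and sgn: "\<And>\<zeta>. \<zeta> \<in> sphere 0 1 \<Longrightarrow> p \<zeta> = p (- \<zeta>) \<Longrightarrow> (z \<zeta> - z (- \<zeta>)) * (z' \<zeta> - z' (- \<zeta>)) > 0"
  obtains \<alpha> \<beta> where "continuous_on UNIV \<alpha>" "continuous_on UNIV \<beta>"
    "\<And>\<zeta>. \<zeta> \<in> sphere 0 1 \<Longrightarrow> exp (\<alpha> (p \<zeta>)) * z \<zeta> + \<beta> (p \<zeta>) = z' \<zeta>"
proof -
  define E where "E = {\<zeta> \<in> sphere 0 1. p \<zeta> - p (- \<zeta>) = 0}"
  have neg: "continuous_on (sphere 0 1) (\<lambda>\<zeta>. f (- \<zeta>))" if "continuous_on (sphere 0 1) f"
    for f :: "complex \<Rightarrow> 'c::topological_space"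
    by (rule continuous_on_compose2[OF that]) (auto intro!: continuous_intros)
  have E1: "E \<subseteq> sphere 0 1" by (auto simp: E_def)
  have "E = sphere 0 1 \<inter> (\<lambda>\<zeta>. p \<zeta> - p (- \<zeta>)) -` {0}" by (auto simp: E_def)
  then have "closed E"
    using continuous_closed_preimage[of "sphere 0 1" "\<lambda>\<zeta>. p \<zeta> - p (- \<zeta>)" "{0}"] p neg[OF p]
    by (simp add: continuous_on_diff)
  then have E: "compact E" using E1 compact_sphere
    by (metis closed_Int_compact inf.absorb_iff1)
  define a where "a \<zeta> = ln ((z' \<zeta> - z' (- \<zeta>)) / (z \<zeta> - z (- \<zeta>)))" for \<zeta>
  have pos: "(z' \<zeta> - z' (- \<zeta>)) / (z \<zeta> - z (- \<zeta>)) > 0" if "\<zeta> \<in> E" for \<zeta>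
    using sgn[of \<zeta>] that by (auto simp: E_def zero_less_mult_iff zero_less_divide_iff)
  have ca: "continuous_on E a"
    unfolding a_def
    by (intro continuous_intros continuous_on_subset[OF neg[OF z] E1] continuous_on_subset[OF z E1]
        continuous_on_subset[OF neg[OF z'] E1] continuous_on_subset[OF z' E1])
      (use pos in force)+
  \<comment> \<open>Swapping the two strands changes the sign of numerator and denominator alike, so
    \<open>a\<close> depends only on the double point and not on the strand through it.\<close>
  have am: "a (- \<zeta>) = a \<zeta>" for \<zeta>
    unfolding a_def by (metis (no_types, opaque_lifting) add.inverse_inverse minus_diff_eq minus_divide_divide)
  obtain \<alpha> where \<alpha>: "continuous_on UNIV \<alpha>" "\<And>\<zeta>. \<zeta> \<in> E \<Longrightarrow> \<alpha> (p \<zeta>) = a \<zeta>"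
    using continuous_factorization[OF E continuous_on_subset[OF p E1] ca] anti am E1
    by (metis subset_iff)
  define b where "b \<zeta> = z' \<zeta> - exp (\<alpha> (p \<zeta>)) * z \<zeta>" for \<zeta>
  have cb: "continuous_on (sphere 0 1) b"
    unfolding b_def
    by (intro continuous_intros z z' continuous_on_compose2[OF \<alpha>(1) p]) auto
  \<comment> \<open>Over a double point the slope is the quotient of the two height differences, so
    both strands ask for the same shift.\<close>
  have bm: "b \<zeta> = b \<xi>" if "\<zeta> \<in> sphere 0 1" "\<xi> \<in> sphere 0 1" "p \<zeta> = p \<xi>" for \<zeta> \<xi>
  proof (cases "\<xi> = \<zeta>")
    case False
    then have \<xi>: "\<xi> = - \<zeta>" using anti that by blast
    then have "\<zeta> \<in> E" using that by (simp add: E_def)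
    then have "exp (\<alpha> (p \<zeta>)) = (z' \<zeta> - z' (- \<zeta>)) / (z \<zeta> - z (- \<zeta>))" and "z \<zeta> - z (- \<zeta>) \<noteq> 0"
      using \<alpha>(2) pos sgn[of \<zeta>] by (auto simp: a_def E_def)
    then have "exp (\<alpha> (p \<zeta>)) * (z \<zeta> - z (- \<zeta>)) = z' \<zeta> - z' (- \<zeta>)" by simp
    then show ?thesis unfolding b_def using that \<xi> by (simp add: algebra_simps)
  qed simp
  obtain \<beta> where "continuous_on UNIV \<beta>" "\<And>\<zeta>. \<zeta> \<in> sphere 0 1 \<Longrightarrow> \<beta> (p \<zeta>) = b \<zeta>"
    using continuous_factorization[OF compact_sphere p cb] bm by metis
  with \<alpha>(1) show ?thesis by (intro that[of \<alpha> \<beta>]) (auto simp: b_def)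
qed

text \<open>Every vertical line is mapped to itself by an increasing affine map whose slope and
  shift depend on the foot point. This is a bijection of the space for any choice of the extended
  coefficients, since the slope is an exponential.\<close>

lemma braid_change_height:
  assumes \<rho>: "continuous_on (sphere 0 1) \<rho>" and pos: "\<And>\<zeta>. \<zeta> \<in> sphere 0 1 \<Longrightarrow> \<rho> \<zeta> > 0"
    and z: "continuous_on (sphere 0 1) z" and z': "continuous_on (sphere 0 1) z'"
    and sgn: "\<And>\<zeta>. \<zeta> \<in> sphere 0 1 \<Longrightarrow> \<rho> \<zeta> = \<rho> (- \<zeta>) \<Longrightarrow> (z \<zeta> - z (- \<zeta>)) * (z' \<zeta> - z' (- \<zeta>)) > 0"
  obtains f g where "homeomorphism UNIV UNIV f g"
    "\<And>\<zeta>. \<zeta> \<in> sphere 0 1 \<Longrightarrow> f (braid_point \<rho> z \<zeta>) = braid_point \<rho> z' \<zeta>"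
proof -
  define p where "p \<zeta> = of_real (\<rho> \<zeta>) * \<zeta>\<^sup>2" for \<zeta> :: complex
  have p: "continuous_on (sphere 0 1) p"
    unfolding p_def by (intro continuous_intros \<rho>)
  have np: "norm (p \<zeta>) = \<rho> \<zeta>" if "\<zeta> \<in> sphere 0 1" for \<zeta>
    using that pos[OF that] by (simp add: p_def norm_mult norm_power)
  have anti: "(\<xi> = \<zeta> \<or> \<xi> = - \<zeta>) \<and> \<rho> \<zeta> = \<rho> \<xi>"
    if "\<zeta> \<in> sphere 0 1" "\<xi> \<in> sphere 0 1" "p \<zeta> = p \<xi>" for \<zeta> \<xi>
  proof -
    have "\<rho> \<zeta> = \<rho> \<xi>" using np that by metis
    moreover have "\<zeta>\<^sup>2 = \<xi>\<^sup>2"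
      using that(3) calculation pos[OF that(2)] by (simp add: p_def)
    ultimately show ?thesis using sphere_complex_square_eq by auto
  qed
  obtain \<alpha> \<beta> where \<alpha>: "continuous_on UNIV \<alpha>" and \<beta>: "continuous_on UNIV \<beta>"
    and eq: "\<And>\<zeta>. \<zeta> \<in> sphere 0 1 \<Longrightarrow> exp (\<alpha> (p \<zeta>)) * z \<zeta> + \<beta> (p \<zeta>) = z' \<zeta>"
    using affine_fibre_interpolation[OF p z z'] anti sgn
    by (smt (verit) mem_sphere_0 norm_minus_cancel)
  define f where "f x = (fst x, exp (\<alpha> (fst x)) * snd x + \<beta> (fst x))" for x :: "complex \<times> real"
  have "continuous_on UNIV f"
    unfolding f_def
    by (intro continuous_intros continuous_on_compose2[OF \<alpha>] continuous_on_compose2[OF \<beta>]) auto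
  moreover have "bij f"
    by (rule o_bij[of "\<lambda>x. (fst x, (snd x - \<beta> (fst x)) / exp (\<alpha> (fst x)))"]) (auto simp: f_def fun_eq_iff)
  ultimately have "homeomorphism UNIV UNIV f (inv f)" by (rule homeomorphism_bij)
  moreover have "f (braid_point \<rho> z \<zeta>) = braid_point \<rho> z' \<zeta>" if "\<zeta> \<in> sphere 0 1" for \<zeta>
    using eq[OF that] by (simp add: f_def braid_point_def p_def)
  ultimately show ?thesis using that by blast
qed

text \<open>The delicate place is the axis, where the direction \<open>sgn (fst x)\<close> jumps.
  Near a point of the axis the coefficients are bounded, so for \<open>norm (fst x) < 1\<close> the
  modulus of the value is at most a constant times a fixed positive power of
  \<open>norm (fst x)\<close>, which tends to 0.\<close>

lemma continuous_radial_power: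
  fixes \<alpha> \<beta> :: "complex \<times> real \<Rightarrow> real"
  assumes \<alpha>: "continuous_on UNIV \<alpha>" and \<beta>: "continuous_on UNIV \<beta>"
  shows "continuous_on UNIV (\<lambda>x. of_real (exp (\<beta> (sgn (fst x), snd x)) *
    norm (fst x) powr exp (\<alpha> (sgn (fst x), snd x))) * sgn (fst x))"
    (is "continuous_on UNIV ?f")
proof -
  have "isCont ?f x" for x
  proof (cases "fst x = 0")
    case False
    have ne: "open {x :: complex \<times> real. fst x \<noteq> 0}"
      by (intro open_Collect_neq continuous_intros)
    have s: "continuous_on {x :: complex \<times> real. fst x \<noteq> 0} (\<lambda>x. (sgn (fst x), snd x))"
      by (intro continuous_intros) auto
    have "continuous_on {x :: complex \<times> real. fst x \<noteq> 0} ?f"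
      by (intro continuous_intros continuous_on_compose2[OF \<alpha> s] continuous_on_compose2[OF \<beta> s]
          continuous_on_powr') auto
    then show ?thesis using ne False unfolding continuous_on_eq_continuous_at[OF ne] by blast
  next
    case True
    define t where "t = snd x"
    \<comment> \<open>A full disk instead of the circle of directions: since
      \<open>sgn 0 = 0\<close>, neighbouring points on the axis have first component 0.\<close>
    define C where "C = cball (0::complex) 1 \<times> cball t 1"
    have C: "compact C" unfolding C_def by (intro compact_Times compact_cball)
    have "compact (\<alpha> ` C)" "compact (\<beta> ` C)"
      using C compact_continuous_image continuous_on_subset[OF \<alpha>] continuous_on_subset[OF \<beta>] by auto
    then obtain A B where A: "\<And>q. q \<in> C \<Longrightarrow> \<bar>\<alpha> q\<bar> \<le> A" and B: "\<And>q. q \<in> C \<Longrightarrow> \<bar>\<beta> q\<bar> \<le> B"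
      using compact_imp_bounded bounded_iff by (metis imageI real_norm_def)
    have ev: "\<forall>\<^sub>F y in at x. norm (?f y) \<le> exp B * norm (fst y) powr exp (- A)"
    proof -
      have "\<forall>\<^sub>F y in at x. dist y x < 1" by (simp add: eventually_at_ball eventually_at, metis zero_less_one)
      then show ?thesis
      proof eventually_elim
        case (elim y)
        have d: "dist (fst y) (fst x) < 1" "dist (snd y) (snd x) < 1"
          using elim dist_fst_le[of y x] dist_snd_le[of y x] by auto
        then have n: "norm (fst y) < 1" using True by simp
        have q: "(sgn (fst y), snd y) \<in> C"
          using d by (simp add: C_def t_def norm_sgn dist_commute)
        have "norm (fst y) powr exp (\<alpha> (sgn (fst y), snd y)) \<le> norm (fst y) powr exp (- A)"
          using A[OF q] n by (intro powr_mono') auto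
        moreover have "exp (\<beta> (sgn (fst y), snd y)) \<le> exp B" using B[OF q] by simp
        ultimately have "exp (\<beta> (sgn (fst y), snd y)) * norm (fst y) powr exp (\<alpha> (sgn (fst y), snd y))
            \<le> exp B * norm (fst y) powr exp (- A)"
          by (intro mult_mono) auto
        then show ?case by (auto simp: norm_mult norm_sgn)
      qed
    qed
    have "continuous_on UNIV (\<lambda>y. exp B * norm (fst y) powr exp (- A))"
      for x :: "complex \<times> real"
      by (intro continuous_intros continuous_on_powr') auto
    then have "isCont (\<lambda>y::complex \<times> real. exp B * norm (fst y) powr exp (- A)) x"
      using continuous_on_eq_continuous_at by blast
    then have "((\<lambda>y::complex \<times> real. exp B * norm (fst y) powr exp (- A)) \<longlongrightarrow> 0) (at x)"
      using True by (simp add: isCont_def)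
    then have "(?f \<longlongrightarrow> 0) (at x)" by (rule Lim_null_comparison[OF ev])
    then show ?thesis using True by (simp add: isCont_def)
  qed
  then show ?thesis by (simp add: continuous_at_imp_continuous_on)
qed

text \<open>In the logarithm of the radius, the open rays from the axis become lines, and an affine
  map with slope \<open>exp \<alpha>\<close> and shift \<open>\<beta>\<close> becomes the power law
  \<open>exp \<beta> * r powr exp \<alpha>\<close>. The interpolation used for heights thus applies
  with direction and height as the base, and the axis is fixed pointwise.\<close>

lemma braid_change_radius:
  assumes \<rho>: "continuous_on (sphere 0 1) \<rho>" and pos: "\<And>\<zeta>. \<zeta> \<in> sphere 0 1 \<Longrightarrow> \<rho> \<zeta> > 0"
    and \<rho>': "continuous_on (sphere 0 1) \<rho>'" and pos': "\<And>\<zeta>. \<zeta> \<in> sphere 0 1 \<Longrightarrow> \<rho>' \<zeta> > 0"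
    and z: "continuous_on (sphere 0 1) z"
    and sgn: "\<And>\<zeta>. \<zeta> \<in> sphere 0 1 \<Longrightarrow> z \<zeta> = z (- \<zeta>) \<Longrightarrow> (\<rho> \<zeta> - \<rho> (- \<zeta>)) * (\<rho>' \<zeta> - \<rho>' (- \<zeta>)) > 0"
  obtains f g where "homeomorphism UNIV UNIV f g"
    "\<And>\<zeta>. \<zeta> \<in> sphere 0 1 \<Longrightarrow> f (braid_point \<rho> z \<zeta>) = braid_point \<rho>' z \<zeta>"
proof -
  define p where "p \<zeta> = (\<zeta>\<^sup>2, z \<zeta>)" for \<zeta> :: complex
  have p: "continuous_on (sphere 0 1) p"
    unfolding p_def by (intro continuous_intros z)
  have l: "continuous_on (sphere 0 1) (\<lambda>\<zeta>. ln (\<rho> \<zeta>))" "continuous_on (sphere 0 1) (\<lambda>\<zeta>. ln (\<rho>' \<zeta>))"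
    using pos pos' by (auto intro!: continuous_intros \<rho> \<rho>' simp: less_imp_neq[symmetric])
  have sgn': "(ln (\<rho> \<zeta>) - ln (\<rho> (- \<zeta>))) * (ln (\<rho>' \<zeta>) - ln (\<rho>' (- \<zeta>))) > 0"
    if "\<zeta> \<in> sphere 0 1" "p \<zeta> = p (- \<zeta>)" for \<zeta>
    using sgn[of \<zeta>] pos[of \<zeta>] pos[of "- \<zeta>"] pos'[of \<zeta>] pos'[of "- \<zeta>"] that
    by (simp add: p_def zero_less_mult_iff)
  obtain \<alpha> \<beta> where \<alpha>: "continuous_on UNIV \<alpha>" and \<beta>: "continuous_on UNIV \<beta>"
    and eq: "\<And>\<zeta>. \<zeta> \<in> sphere 0 1 \<Longrightarrow> exp (\<alpha> (p \<zeta>)) * ln (\<rho> \<zeta>) + \<beta> (p \<zeta>) = ln (\<rho>' \<zeta>)"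
  proof (rule affine_fibre_interpolation[OF p l])
    show "\<xi> = \<zeta> \<or> \<xi> = - \<zeta>" if "p \<zeta> = p \<xi>" for \<zeta> \<xi>
      using that sphere_complex_square_eq[of \<zeta> \<xi>] by (simp add: p_def)
  qed (use sgn' in auto)
  define q where "q x = (sgn (fst x), snd x)" for x :: "complex \<times> real"
  define R where "R x = exp (\<beta> (q x)) * norm (fst x) powr exp (\<alpha> (q x))" for x
  define R' where "R' x = (norm (fst x) / exp (\<beta> (q x))) powr (1 / exp (\<alpha> (q x)))" for x
  define f where "f x = (of_real (R x) * sgn (fst x), snd x)" for x :: "complex \<times> real"
  define g where "g x = (of_real (R' x) * sgn (fst x), snd x)" for x :: "complex \<times> real"
  have polar: "q (of_real r * sgn (fst x), snd x) = q x" "norm (of_real r * sgn (fst x)) = r"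
    if "r > 0" "fst x \<noteq> 0" for r and x :: "complex \<times> real"
    using that by (simp_all add: q_def sgn_mult sgn_of_real norm_mult norm_sgn)
  have Rpos: "R x > 0" "R' x > 0" if "fst x \<noteq> 0" for x
    using that by (simp_all add: R_def R'_def)
  have qfg: "q (f x) = q x" "q (g x) = q x" "norm (fst (f x)) = R x" "norm (fst (g x)) = R' x"
    if "fst x \<noteq> 0" for x
    using polar[OF Rpos(1)] polar[OF Rpos(2)] that by (simp_all add: f_def g_def)
  have R'f: "R' (f x) = norm (fst x)" if "fst x \<noteq> 0" for x
    unfolding R'_def[of "f x"] qfg[OF that] using that by (simp add: R_def powr_powr)
  have Rg: "R (g x) = norm (fst x)" if "fst x \<noteq> 0" for x
    unfolding R_def[of "g x"] qfg[OF that] using that by (simp add: R'_def powr_powr)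
  have sf: "sgn (fst (f x)) = sgn (fst x)" "sgn (fst (g x)) = sgn (fst x)" if "fst x \<noteq> 0" for x
    using qfg[OF that] by (simp_all add: q_def)
  have "continuous_on UNIV f"
    unfolding f_def R_def q_def
    by (rule continuous_on_Pair[OF continuous_radial_power[OF \<alpha> \<beta>] continuous_on_snd[OF continuous_on_id]])
  moreover have "bij f"
  proof (rule o_bij[of g])
    have "g (f x) = x" "f (g x) = x" for x
    proof -
      have "fst (g (f x)) = fst x"
      proof (cases "fst x = 0")
        case False
        then have "fst (g (f x)) = of_real (norm (fst x)) * sgn (fst x)"
          by (simp add: g_def[of "f x"] R'f sf)
        then show ?thesis by (simp add: sgn_eq)
      qed (simp add: f_def g_def)
      moreover have "fst (f (g x)) = fst x"
      proof (cases "fst x = 0")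
        case False
        then have "fst (f (g x)) = of_real (norm (fst x)) * sgn (fst x)"
          by (simp add: f_def[of "g x"] Rg sf)
        then show ?thesis by (simp add: sgn_eq)
      qed (simp add: f_def g_def)
      moreover have "snd (g (f x)) = snd x" "snd (f (g x)) = snd x" by (simp_all add: f_def g_def)
      ultimately show "g (f x) = x" "f (g x) = x" by (simp_all add: prod_eq_iff)
    qed
    then show "g \<circ> f = id" "f \<circ> g = id" by (simp_all add: fun_eq_iff)
  qed
  ultimately have "homeomorphism UNIV UNIV f (inv f)" by (rule homeomorphism_bij)
  moreover have "f (braid_point \<rho> z \<zeta>) = braid_point \<rho>' z \<zeta>" if "\<zeta> \<in> sphere 0 1" for \<zeta>
  proof -
    have n: "norm \<zeta> = 1" "\<zeta> \<noteq> 0" using that by auto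
    then have s: "sgn (of_real (\<rho> \<zeta>) * \<zeta>\<^sup>2) = \<zeta>\<^sup>2"
      using pos[OF that] by (simp add: sgn_mult sgn_of_real) (simp add: sgn_eq norm_power)
    then have q: "q (braid_point \<rho> z \<zeta>) = p \<zeta>" by (simp add: q_def p_def braid_point_def)
    have "norm (fst (braid_point \<rho> z \<zeta>)) = \<rho> \<zeta>"
      using n pos[OF that] by (simp add: braid_point_def norm_mult norm_power)
    moreover have "exp (\<beta> (p \<zeta>)) * \<rho> \<zeta> powr exp (\<alpha> (p \<zeta>)) = \<rho>' \<zeta>"
    proof -
      have "exp (\<beta> (p \<zeta>)) * \<rho> \<zeta> powr exp (\<alpha> (p \<zeta>)) = exp (ln (\<rho>' \<zeta>))"
        unfolding eq[OF that, symmetric] exp_add using pos[OF that] by (simp add: powr_def)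
      then show ?thesis using pos'[OF that] by simp
    qed
    ultimately have "R (braid_point \<rho> z \<zeta>) = \<rho>' \<zeta>" by (simp add: R_def q)
    moreover have "sgn (fst (braid_point \<rho> z \<zeta>)) = \<zeta>\<^sup>2" using s by (simp add: braid_point_def)
    moreover have "snd (braid_point \<rho> z \<zeta>) = z \<zeta>" by (simp add: braid_point_def)
    ultimately show ?thesis by (simp add: f_def) (simp add: braid_point_def)
  qed
  ultimately show ?thesis using that by blast
qed

abbreviation trefoil_radius :: "complex \<Rightarrow> real" where
  "trefoil_radius \<zeta> \<equiv> 2 + Re (\<zeta> ^ 3)"

abbreviation trefoil_height :: "complex \<Rightarrow> real" where
  "trefoil_height \<zeta> \<equiv> Im (\<zeta> ^ 3)"

text \<open>The intermediate braid has the radii \<open>\<rho>\<close> and still the heights of the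
  standard trefoil. Passing to it involves only the strands of the trefoil that agree in direction
  and height, \<open>Im (\<zeta> ^ 3) = 0\<close>; leaving it involves only the strands that agree
  in direction and in \<open>\<rho>\<close>. The crossings of the standard diagram,
  \<open>Re (\<zeta> ^ 3) = 0\<close>, therefore do not enter.\<close>

lemma trefoil_braid:
  assumes \<rho>: "continuous_on (sphere 0 1) \<rho>" and pos: "\<And>\<zeta>. \<zeta> \<in> sphere 0 1 \<Longrightarrow> \<rho> \<zeta> > 0"
    and z: "continuous_on (sphere 0 1) z"
    and radii: "\<And>\<zeta>. \<zeta> \<in> sphere 0 1 \<Longrightarrow> Im (\<zeta> ^ 3) = 0 \<Longrightarrow> Re (\<zeta> ^ 3) * (\<rho> \<zeta> - \<rho> (- \<zeta>)) > 0"
    and heights: "\<And>\<zeta>. \<zeta> \<in> sphere 0 1 \<Longrightarrow> \<rho> \<zeta> = \<rho> (- \<zeta>) \<Longrightarrow> Im (\<zeta> ^ 3) * (z \<zeta> - z (- \<zeta>)) > 0"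
  obtains f g where "homeomorphism UNIV UNIV f g"
    "f ` braid_point trefoil_radius trefoil_height ` sphere 0 1 = braid_point \<rho> z ` sphere 0 1"
proof -
  have p0: "trefoil_radius \<zeta> > 0" if "\<zeta> \<in> sphere 0 1" for \<zeta>
    using that abs_Re_le_cmod[of "\<zeta> ^ 3"] by (simp add: norm_power)
  have c: "continuous_on (sphere 0 1) trefoil_radius" "continuous_on (sphere 0 1) trefoil_height"
    by (intro continuous_intros)+
  have cube: "(- \<zeta>) ^ 3 = - (\<zeta> ^ 3)" for \<zeta> :: complex
    by (simp add: power3_eq_cube)
  have r: "(trefoil_radius \<zeta> - trefoil_radius (- \<zeta>)) * (\<rho> \<zeta> - \<rho> (- \<zeta>)) > 0"
    if "\<zeta> \<in> sphere 0 1" "trefoil_height \<zeta> = trefoil_height (- \<zeta>)" for \<zeta>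
  proof -
    have "Im (\<zeta> ^ 3) = 0" using that(2) unfolding cube by simp
    then have "2 * (Re (\<zeta> ^ 3) * (\<rho> \<zeta> - \<rho> (- \<zeta>))) > 0" using radii[OF that(1)] by simp
    moreover have "trefoil_radius \<zeta> - trefoil_radius (- \<zeta>) = 2 * Re (\<zeta> ^ 3)" unfolding cube by simp
    ultimately show ?thesis by (simp only: mult.assoc)
  qed
  have h: "(trefoil_height \<zeta> - trefoil_height (- \<zeta>)) * (z \<zeta> - z (- \<zeta>)) > 0"
    if "\<zeta> \<in> sphere 0 1" "\<rho> \<zeta> = \<rho> (- \<zeta>)" for \<zeta>
  proof -
    have "2 * (Im (\<zeta> ^ 3) * (z \<zeta> - z (- \<zeta>))) > 0" using heights[OF that] by simp
    moreover have "trefoil_height \<zeta> - trefoil_height (- \<zeta>) = 2 * Im (\<zeta> ^ 3)" unfolding cube by simp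
    ultimately show ?thesis by (simp only: mult.assoc)
  qed
  obtain f1 g1 where 1: "homeomorphism UNIV UNIV f1 g1"
    "\<And>\<zeta>. \<zeta> \<in> sphere 0 1 \<Longrightarrow> f1 (braid_point trefoil_radius trefoil_height \<zeta>) = braid_point \<rho> trefoil_height \<zeta>"
    by (rule braid_change_radius[OF c(1) p0 \<rho> pos c(2) r]) (blast intro: that)+
  obtain f2 g2 where 2: "homeomorphism UNIV UNIV f2 g2"
    "\<And>\<zeta>. \<zeta> \<in> sphere 0 1 \<Longrightarrow> f2 (braid_point \<rho> trefoil_height \<zeta>) = braid_point \<rho> z \<zeta>"
    by (rule braid_change_height[OF \<rho> pos c(2) z h]) (blast intro: that)+
  have "homeomorphism UNIV UNIV (f2 \<circ> f1) (g1 \<circ> g2)"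
    using homeomorphism_compose[OF 1(1) 2(1)] .
  moreover have "(f2 \<circ> f1) ` braid_point trefoil_radius trefoil_height ` sphere 0 1 = braid_point \<rho> z ` sphere 0 1"
    using 1(2) 2(2) unfolding image_image by (intro image_cong) auto
  ultimately show ?thesis using that by blast
qed

section \<open>Closed braids as knots in \<open>space3\<close>\<close>

definition embed3 :: "complex \<times> real \<Rightarrow> real^4" where
  "embed3 x = vector [Re (fst x), Im (fst x), snd x, 0]"

lemma vector_4_nth [simp]:
  "(vector [a, b, c, d] :: 'a::zero^4) $ 1 = a"
  "(vector [a, b, c, d] :: 'a::zero^4) $ 2 = b"
  "(vector [a, b, c, d] :: 'a::zero^4) $ 3 = c"
  "(vector [a, b, c, d] :: 'a::zero^4) $ 4 = d"
  unfolding vector_def by auto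

lemma continuous_on_vector_4 [continuous_intros]:
  fixes a b c d :: "'a::topological_space \<Rightarrow> real"
  assumes "continuous_on S a" "continuous_on S b" "continuous_on S c" "continuous_on S d"
  shows "continuous_on S (\<lambda>x. vector [a x, b x, c x, d x] :: real^4)"
proof -
  have eq: "(\<lambda>x. vector [a x, b x, c x, d x] :: real^4) =
    (\<lambda>x. \<chi> i. if i = 1 then a x else if i = 2 then b x else if i = 3 then c x else d x)"
    by (auto simp: vec_eq_iff forall_4)
  have "continuous_on S (\<lambda>x. if i = 1 then a x else if i = 2 then b x else if i = 3 then c x else d x)"
    for i :: 4
    using exhaust_4[of i] assms by auto
  then show ?thesis unfolding eq by (intro continuous_on_vec_lambda)
qed

lemma homeomorphism_embed3:
  "homeomorphism UNIV space3 embed3 (\<lambda>x. (Complex (x $ 1) (x $ 2), x $ 3))"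
  by (rule homeomorphismI)
    (auto simp: embed3_def space3_def vec_eq_iff forall_4 intro!: continuous_intros)

text \<open>Put \<open>\<zeta> = cis t\<close>: the square of \<open>\<zeta>\<close> is the
  direction around the core, run through twice, and \<open>\<zeta> ^ 3\<close> is the position on
  the circle around the tube, run through three times.\<close>

lemma standard_trefoil_eq:
  "standard_trefoil = embed3 ` braid_point trefoil_radius trefoil_height ` sphere 0 1"
proof -
  have "sphere 0 1 = range cis"
    by (auto simp: image_iff) (metis cis_Arg norm_eq_zero sgn_eq div_by_1 of_real_1 zero_neq_one)
  then show ?thesis
    unfolding standard_trefoil_def image_image
    by (simp add: image_image embed3_def braid_point_def Complex.DeMoivre)
qed

lemma trefoil_knot_embed3:
  assumes "homeomorphism UNIV UNIV f g"
    and "f ` braid_point trefoil_radius trefoil_height ` sphere 0 1 = X"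
  shows "trefoil_knot (embed3 ` X)"
proof -
  let ?p = "\<lambda>x :: real^4. (Complex (x $ 1) (x $ 2), x $ 3)"
  have e: "homeomorphism space3 UNIV ?p embed3"
    using homeomorphism_embed3 homeomorphism_symD by blast
  have h: "homeomorphism space3 space3 (embed3 \<circ> (f \<circ> ?p)) ((embed3 \<circ> g) \<circ> ?p)"
    using homeomorphism_compose[OF homeomorphism_compose[OF e assms(1)] homeomorphism_embed3] .
  have "?p ` standard_trefoil = braid_point trefoil_radius trefoil_height ` sphere 0 1"
    unfolding standard_trefoil_eq image_image using homeomorphism_apply1[OF homeomorphism_embed3]
    by simp
  then have "(embed3 \<circ> (f \<circ> ?p)) ` standard_trefoil = embed3 ` X"
    using assms(2) by (simp only: image_comp[symmetric])
  then show ?thesis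
    unfolding trefoil_knot_def using h by blast
qed

lemma bij_real_of_expanding:
  fixes F :: "real \<Rightarrow> real"
  assumes c: "c > 0" and cont: "continuous_on UNIV F"
    and exp: "\<And>x y. x \<le> y \<Longrightarrow> F y - F x \<ge> c * (y - x)"
  shows "bij F"
proof (rule bijI)
  show "inj F"
  proof (rule linorder_injI)
    fix x y :: real assume "x < y"
    then have "c * (y - x) > 0" using c by simp
    then show "F x \<noteq> F y" using exp[of x y] \<open>x < y\<close> by auto
  qed
  show "surj F"
  proof -
    have "\<exists>x. F x = v" for v
    proof -
    let ?r = "\<bar>v - F 0\<bar> / c"
    have r: "?r \<ge> 0" "c * ?r = \<bar>v - F 0\<bar>" using c by auto
    have "F (- ?r) \<le> v" using exp[of "- ?r" 0] r by auto
    moreover have "v \<le> F ?r" using exp[of 0 ?r] r by auto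
    moreover have "continuous_on {- ?r..?r} F" using cont continuous_on_subset by blast
    ultimately show "\<exists>x. F x = v" using IVT'[of F "- ?r" v ?r] r by auto
    qed
    then show ?thesis by (metis surjI)
  qed
qed

text \<open>The principal root settles the first quadrant and conjugation the fourth. Closed
  quadrants matter for the direction -1, where the two turns of the polygon join: its roots
  \<open>\<i>\<close> and \<open>- \<i>\<close> both lie on the boundary, and each is wanted
  once.\<close>

lemma sqrt_in_quadrant:
  fixes u :: complex
  assumes "norm u = 1"
  shows "Im u \<ge> 0 \<Longrightarrow> \<exists>\<zeta>. norm \<zeta> = 1 \<and> \<zeta>\<^sup>2 = u \<and> Re \<zeta> \<ge> 0 \<and> Im \<zeta> \<ge> 0"
    and "Im u \<le> 0 \<Longrightarrow> \<exists>\<zeta>. norm \<zeta> = 1 \<and> \<zeta>\<^sup>2 = u \<and> Re \<zeta> \<ge> 0 \<and> Im \<zeta> \<le> 0"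
proof -
  have *: "\<exists>\<zeta>. norm \<zeta> = 1 \<and> \<zeta>\<^sup>2 = v \<and> Re \<zeta> \<ge> 0 \<and> Im \<zeta> \<ge> 0" if "norm v = 1" "Im v \<ge> 0" for v
  proof (intro exI conjI)
    show sq: "(csqrt v)\<^sup>2 = v" by simp
    have "(norm (csqrt v))\<^sup>2 = 1" unfolding norm_power[symmetric] sq by (rule that(1))
    then show "norm (csqrt v) = 1" using norm_ge_zero[of "csqrt v"] unfolding power2_eq_1_iff by linarith
    show "Re (csqrt v) \<ge> 0" using complex_Re_le_cmod[of "- v"] by simp
    show "Im (csqrt v) \<ge> 0" using that(2) complex_Re_le_cmod[of v] by (simp add: sgn_if)
  qed
  show "Im u \<ge> 0 \<Longrightarrow> \<exists>\<zeta>. norm \<zeta> = 1 \<and> \<zeta>\<^sup>2 = u \<and> Re \<zeta> \<ge> 0 \<and> Im \<zeta> \<ge> 0"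
    using * assms by blast
  assume "Im u \<le> 0"
  then obtain \<zeta> where \<zeta>: "norm \<zeta> = 1" "\<zeta>\<^sup>2 = cnj u" "Re \<zeta> \<ge> 0" "Im \<zeta> \<ge> 0"
    using *[of "cnj u"] assms by auto
  then have "(cnj \<zeta>)\<^sup>2 = u" by (metis complex_cnj_cnj complex_cnj_power)
  then show "\<exists>\<zeta>. norm \<zeta> = 1 \<and> \<zeta>\<^sup>2 = u \<and> Re \<zeta> \<ge> 0 \<and> Im \<zeta> \<le> 0"
    using \<zeta> by (intro exI[of _ "cnj \<zeta>"]) auto
qed

section \<open>The trefoil polygon\<close>

text \<open>In the coordinates used below, the polygon projects to the boundary of the rectangle
  \<open>[-1, 2] \<times> [-1, 3]\<close> (first turn around the origin), followed by the boundary of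
  \<open>[-2, 1] \<times> [-3, 1]\<close> without the corner below and to the left of \<open>(-1, -1)\<close> (second turn).
  These are the unit levels of the following two functions.\<close>

definition turn1_gauge :: "real \<Rightarrow> real \<Rightarrow> real" where
  "turn1_gauge X Y = max (max (- X) (- Y)) (max (X / 2) (Y / 3))"

definition turn2_gauge :: "real \<Rightarrow> real \<Rightarrow> real" where
  "turn2_gauge X Y = max (max X Y) (max (max (- X / 2) (- Y / 3)) (min (- X) (- Y)))"

text \<open>The ramp inverts the tilted descent at the lattice point (1, 0), which runs from X =
  -1/4 at height 3/2 to X = 0 at height 1/2. The clamps supply the constant heights before and after
  it.\<close>

definition turn1_height :: "real \<Rightarrow> real" where
  "turn1_height X = max (1 / 2) (min (3 / 2) (1 / 2 - 4 * X))"

text \<open>On the edge X = 1 the first ramp is \<open>2 * Y + 13 / 2\<close>, the tilted ascent at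
  the lattice point (2, -1), and \<open>3 * (1 - Y)\<close> is the descent at (2, 1). On the edges X
  = -1 and Y = -3 the first ramp is at most 1/2, so the same formula gives the constant height
  there.\<close>

definition turn2_lower_height :: "real \<Rightarrow> real \<Rightarrow> real" where
  "turn2_lower_height X Y = min (3 / 2) (min (max (1 / 2) (2 * X + 2 * Y + 9 / 2)) (3 * (1 - Y)))"

text \<open>Along Y = -1 the expression is \<open>6 * (X + 2)\<close>, the tilted ascent at the
  starting point (-1, 0) of the arc. The coefficient 9 keeps it at most 0 on the edges X = -2 and Y
  = 1, which carry the closing arc; at the corner (1, 1) it is exactly 0.\<close>

definition turn2_upper_height :: "real \<Rightarrow> real \<Rightarrow> real" where
  "turn2_upper_height X Y = min (3 / 2) (max 0 (6 * (X + 2) - 9 * (Y + 1)))"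

text \<open>A change of coordinates that puts the point \<open>(-1, -1)\<close>, where the two turns join, on the
  negative real axis, so that the turns correspond to the two branches of the square root.\<close>

definition diag_point :: "real \<Rightarrow> real \<Rightarrow> complex" where
  "diag_point X Y = Complex (X + Y) (Y - X)"

definition coord_X :: "complex \<Rightarrow> real" where "coord_X w = (Re w - Im w) / 2"
definition coord_Y :: "complex \<Rightarrow> real" where "coord_Y w = (Re w + Im w) / 2"

lemma coord_diag_point [simp]: "coord_X (diag_point X Y) = X" "coord_Y (diag_point X Y) = Y"
  by (simp_all add: coord_X_def coord_Y_def diag_point_def)

lemma diag_point_coord: "diag_point (coord_X w) (coord_Y w) = w"
  by (simp add: coord_X_def coord_Y_def diag_point_def complex_eq_iff field_simps)

lemma coord_one [simp]: "coord_X 1 = 1 / 2" "coord_Y 1 = 1 / 2" "coord_X (- 1) = - 1 / 2" "coord_Y (- 1) = - 1 / 2"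
  by (simp_all add: coord_X_def coord_Y_def)

lemma coord_of_real_mult: "coord_X (of_real r * w) = r * coord_X w" "coord_Y (of_real r * w) = r * coord_Y w"
  by (simp_all add: coord_X_def coord_Y_def field_simps)

lemma continuous_on_coord [continuous_intros]:
  "continuous_on S f \<Longrightarrow> continuous_on S (\<lambda>x. coord_X (f x))"
  "continuous_on S f \<Longrightarrow> continuous_on S (\<lambda>x. coord_Y (f x))"
  unfolding coord_X_def coord_Y_def by (intro continuous_intros; simp)+

lemma gauge_pos:
  assumes "X \<noteq> 0 \<or> Y \<noteq> 0"
  shows "turn1_gauge X Y > 0" "turn2_gauge X Y > 0"
  using assms by (auto simp: turn1_gauge_def turn2_gauge_def max_def min_def)

lemma gauge_scale:
  assumes "r > 0"
  shows "turn1_gauge (r * X) (r * Y) = r * turn1_gauge X Y" "turn2_gauge (r * X) (r * Y) = r * turn2_gauge X Y"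
proof -
  have m: "r * max a b = max (r * a) (r * b)" "r * min a b = min (r * a) (r * b)" for a b :: real
    using assms by (simp_all add: max_def min_def)
  show "turn1_gauge (r * X) (r * Y) = r * turn1_gauge X Y" "turn2_gauge (r * X) (r * Y) = r * turn2_gauge X Y"
    unfolding turn1_gauge_def turn2_gauge_def m by simp_all
qed

text \<open>The roots with \<open>Re \<zeta> \<ge> 0\<close> describe the first turn, their
  negatives the second. Both gauges are homogeneous, so dividing the direction by its gauge lands on
  the unit level, that is, on the polygon. At \<open>Re \<zeta> = 0\<close> the turns join and the
  gauges agree.\<close>

definition polygon_gauge :: "complex \<Rightarrow> real" where
  "polygon_gauge \<zeta> = (if Re \<zeta> \<ge> 0 then turn1_gauge (coord_X (\<zeta>\<^sup>2)) (coord_Y (\<zeta>\<^sup>2))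
     else turn2_gauge (coord_X (\<zeta>\<^sup>2)) (coord_Y (\<zeta>\<^sup>2)))"

definition polygon_radius :: "complex \<Rightarrow> real" where
  "polygon_radius \<zeta> = 1 / polygon_gauge \<zeta>"

definition polygon_X :: "complex \<Rightarrow> real" where
  "polygon_X \<zeta> = coord_X (\<zeta>\<^sup>2) / polygon_gauge \<zeta>"

definition polygon_Y :: "complex \<Rightarrow> real" where
  "polygon_Y \<zeta> = coord_Y (\<zeta>\<^sup>2) / polygon_gauge \<zeta>"

text \<open>The four quadrants are the halves of the two turns on either side of the diagonal X = Y.
  Running from \<open>- \<i>\<close> through \<open>1\<close>, \<open>\<i>\<close> and
  \<open>- 1\<close> back to \<open>- \<i>\<close> traverses the closed curve once.\<close>

definition polygon_height :: "complex \<Rightarrow> real" where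
  "polygon_height \<zeta> =
    (if Re \<zeta> \<ge> 0 then (if Im \<zeta> \<ge> 0 then 1 / 2 else turn1_height (polygon_X \<zeta>))
     else (if Im \<zeta> \<ge> 0 then turn2_lower_height (polygon_X \<zeta>) (polygon_Y \<zeta>)
       else turn2_upper_height (polygon_X \<zeta>) (polygon_Y \<zeta>)))"

lemma coord_nonzero: "\<zeta> \<noteq> 0 \<Longrightarrow> coord_X (\<zeta>\<^sup>2) \<noteq> 0 \<or> coord_Y (\<zeta>\<^sup>2) \<noteq> 0"
  using diag_point_coord[of "\<zeta>\<^sup>2"] by (auto simp: diag_point_def Complex_eq)

lemma polygon_gauge_pos: "\<zeta> \<noteq> 0 \<Longrightarrow> polygon_gauge \<zeta> > 0"
  using gauge_pos[OF coord_nonzero] by (simp add: polygon_gauge_def)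

lemma polygon_diag_point: "of_real (polygon_radius \<zeta>) * \<zeta>\<^sup>2 = diag_point (polygon_X \<zeta>) (polygon_Y \<zeta>)"
proof -
  have "polygon_X \<zeta> = polygon_radius \<zeta> * coord_X (\<zeta>\<^sup>2)" "polygon_Y \<zeta> = polygon_radius \<zeta> * coord_Y (\<zeta>\<^sup>2)"
    by (simp_all add: polygon_radius_def polygon_X_def polygon_Y_def)
  then show ?thesis
    using diag_point_coord[of "of_real (polygon_radius \<zeta>) * \<zeta>\<^sup>2"] by (simp only: coord_of_real_mult)
qed

lemma coord_square:
  "coord_X (\<zeta>\<^sup>2) = ((Re \<zeta>)\<^sup>2 - (Im \<zeta>)\<^sup>2 - 2 * Re \<zeta> * Im \<zeta>) / 2"
  "coord_Y (\<zeta>\<^sup>2) = ((Re \<zeta>)\<^sup>2 - (Im \<zeta>)\<^sup>2 + 2 * Re \<zeta> * Im \<zeta>) / 2"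
  by (simp_all add: coord_X_def coord_Y_def power2_eq_square)

lemma on_axis:
  assumes "norm (\<zeta>::complex) = 1"
  shows "Im \<zeta> = 0 \<Longrightarrow> \<zeta> = 1 \<or> \<zeta> = - 1" and "Re \<zeta> = 0 \<Longrightarrow> \<zeta> = \<i> \<or> \<zeta> = - \<i>"
proof -
  have "(Re \<zeta>)\<^sup>2 + (Im \<zeta>)\<^sup>2 = 1" using assms cmod_power2[of \<zeta>] by simp
  then show "Im \<zeta> = 0 \<Longrightarrow> \<zeta> = 1 \<or> \<zeta> = - 1" "Re \<zeta> = 0 \<Longrightarrow> \<zeta> = \<i> \<or> \<zeta> = - \<i>"
    by (auto simp: complex_eq_iff power2_eq_1_iff)
qed

lemma polygon_axis_values [simp]:
  "polygon_X 1 = 2" "polygon_Y 1 = 2" "polygon_X (- 1) = 1" "polygon_Y (- 1) = 1"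
  "polygon_X \<i> = - 1" "polygon_Y \<i> = - 1" "polygon_X (- \<i>) = - 1" "polygon_Y (- \<i>) = - 1"
  by (simp_all add: polygon_X_def polygon_Y_def polygon_gauge_def turn1_gauge_def turn2_gauge_def
      coord_square)

lemma continuous_on_polygon_gauge: "continuous_on (sphere 0 1) polygon_gauge"
proof -
  have s: "sphere 0 1 = (sphere 0 1 \<inter> {\<zeta>. Re \<zeta> \<ge> 0}) \<union> (sphere 0 1 \<inter> {\<zeta>. Re \<zeta> \<le> 0})" by auto
  show ?thesis
    unfolding polygon_gauge_def
  proof (subst s, rule continuous_on_cases)
    show "\<forall>\<zeta>. \<zeta> \<in> sphere 0 1 \<inter> {\<zeta>. 0 \<le> Re \<zeta>} \<and> \<not> 0 \<le> Re \<zeta> \<or> \<zeta> \<in> sphere 0 1 \<inter> {\<zeta>. Re \<zeta> \<le> 0} \<and> 0 \<le> Re \<zeta> \<longrightarrow>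
      turn1_gauge (coord_X (\<zeta>\<^sup>2)) (coord_Y (\<zeta>\<^sup>2)) = turn2_gauge (coord_X (\<zeta>\<^sup>2)) (coord_Y (\<zeta>\<^sup>2))"
    proof (intro allI impI)
      fix \<zeta> assume "\<zeta> \<in> sphere 0 1 \<inter> {\<zeta>. 0 \<le> Re \<zeta>} \<and> \<not> 0 \<le> Re \<zeta> \<or> \<zeta> \<in> sphere 0 1 \<inter> {\<zeta>. Re \<zeta> \<le> 0} \<and> 0 \<le> Re \<zeta>"
      then have "norm \<zeta> = 1" "Re \<zeta> = 0" by auto
      then have "\<zeta> = \<i> \<or> \<zeta> = - \<i>" by (rule on_axis(2))
      then show "turn1_gauge (coord_X (\<zeta>\<^sup>2)) (coord_Y (\<zeta>\<^sup>2)) = turn2_gauge (coord_X (\<zeta>\<^sup>2)) (coord_Y (\<zeta>\<^sup>2))"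
        by (auto simp: turn1_gauge_def turn2_gauge_def)
    qed
    show "continuous_on (sphere 0 1 \<inter> {\<zeta>. 0 \<le> Re \<zeta>}) (\<lambda>\<zeta>. turn1_gauge (coord_X (\<zeta>\<^sup>2)) (coord_Y (\<zeta>\<^sup>2)))"
      unfolding turn1_gauge_def by (intro continuous_intros) auto
    show "continuous_on (sphere 0 1 \<inter> {\<zeta>. Re \<zeta> \<le> 0}) (\<lambda>\<zeta>. turn2_gauge (coord_X (\<zeta>\<^sup>2)) (coord_Y (\<zeta>\<^sup>2)))"
      unfolding turn2_gauge_def by (intro continuous_intros) auto
  qed (intro closed_Int closed_sphere closed_halfspace_Re_ge closed_halfspace_Re_le)+
qed

lemma continuous_on_polygon_X: "continuous_on (sphere 0 1) polygon_X"
  and continuous_on_polygon_Y: "continuous_on (sphere 0 1) polygon_Y"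
  and continuous_on_polygon_radius: "continuous_on (sphere 0 1) polygon_radius"
proof -
  have ne: "\<forall>\<zeta>\<in>sphere 0 1. polygon_gauge \<zeta> \<noteq> 0"
  proof
    fix \<zeta> :: complex assume "\<zeta> \<in> sphere 0 1"
    then have "\<zeta> \<noteq> 0" by auto
    then show "polygon_gauge \<zeta> \<noteq> 0" using polygon_gauge_pos[of \<zeta>] by simp
  qed
  show "continuous_on (sphere 0 1) polygon_X" "continuous_on (sphere 0 1) polygon_Y"
    "continuous_on (sphere 0 1) polygon_radius"
    unfolding polygon_X_def polygon_Y_def polygon_radius_def
    by (intro continuous_intros continuous_on_polygon_gauge ne)+
qed

text \<open>The formulas meet at \<open>1\<close>, \<open>\<i>\<close>, \<open>- 1\<close> and
  \<open>- \<i>\<close>, where the common heights are 1/2, 1/2, 0 and 3/2.\<close>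

lemma continuous_on_polygon_height: "continuous_on (sphere 0 1) polygon_height"
proof -
  let ?R = "sphere 0 1 \<inter> {\<zeta>. Re \<zeta> \<ge> 0}" and ?L = "sphere 0 1 \<inter> {\<zeta>. Re \<zeta> \<le> 0}"
  have s: "sphere 0 1 = ?R \<union> ?L" by auto
  have r: "?R = (?R \<inter> {\<zeta>. Im \<zeta> \<ge> 0}) \<union> (?R \<inter> {\<zeta>. Im \<zeta> \<le> 0})" by auto
  have l: "?L = (?L \<inter> {\<zeta>. Im \<zeta> \<ge> 0}) \<union> (?L \<inter> {\<zeta>. Im \<zeta> \<le> 0})" by auto
  have c: "continuous_on T polygon_X" "continuous_on T polygon_Y" if "T \<subseteq> sphere 0 1" for T
    using continuous_on_polygon_X continuous_on_polygon_Y continuous_on_subset that by blast+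
  have cl: "closed ?R" "closed ?L"
    by (intro closed_Int closed_sphere closed_halfspace_Re_ge closed_halfspace_Re_le)+
  have cq: "closed (?R \<inter> {\<zeta>. Im \<zeta> \<ge> 0})" "closed (?R \<inter> {\<zeta>. Im \<zeta> \<le> 0})"
    "closed (?L \<inter> {\<zeta>. Im \<zeta> \<ge> 0})" "closed (?L \<inter> {\<zeta>. Im \<zeta> \<le> 0})"
    by (intro closed_Int cl closed_halfspace_Im_ge closed_halfspace_Im_le)+
  have R: "continuous_on ?R (\<lambda>\<zeta>. if Im \<zeta> \<ge> 0 then 1 / 2 else turn1_height (polygon_X \<zeta>))"
  proof (subst r, rule continuous_on_cases[OF cq(1,2)])
    show "continuous_on (?R \<inter> {\<zeta>. Im \<zeta> \<le> 0}) (\<lambda>\<zeta>. turn1_height (polygon_X \<zeta>))"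
      unfolding turn1_height_def by (intro continuous_intros c) auto
  qed (auto dest: on_axis(1) simp: turn1_height_def)
  have L: "continuous_on ?L (\<lambda>\<zeta>. if Im \<zeta> \<ge> 0 then turn2_lower_height (polygon_X \<zeta>) (polygon_Y \<zeta>)
       else turn2_upper_height (polygon_X \<zeta>) (polygon_Y \<zeta>))"
  proof (subst l, rule continuous_on_cases[OF cq(3,4)])
    show "continuous_on (?L \<inter> {\<zeta>. Im \<zeta> \<ge> 0}) (\<lambda>\<zeta>. turn2_lower_height (polygon_X \<zeta>) (polygon_Y \<zeta>))"
      unfolding turn2_lower_height_def by (intro continuous_intros c) auto
    show "continuous_on (?L \<inter> {\<zeta>. Im \<zeta> \<le> 0}) (\<lambda>\<zeta>. turn2_upper_height (polygon_X \<zeta>) (polygon_Y \<zeta>))"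
      unfolding turn2_upper_height_def by (intro continuous_intros c) auto
  qed (auto dest: on_axis(1) simp: turn2_lower_height_def turn2_upper_height_def)
  show ?thesis
    unfolding polygon_height_def
    by (subst s, rule continuous_on_cases[OF cl R L])
      (auto dest: on_axis(2) simp: turn1_height_def turn2_lower_height_def turn2_upper_height_def)
qed

text \<open>Only sixth roots of unity have to be inspected. At \<open>1\<close> the direction is
  that of (1, 1), where the first turn is farther out than the second. At the two other roots with
  positive real part the direction satisfies X + Y < 0 and X * Y < 0; there the first gauge is the
  larger one, so the first turn runs inside the second, and \<open>\<zeta> ^ 3 = - 1\<close> has the
  matching sign.\<close>

lemma polygon_radii:
  assumes "\<zeta> \<in> sphere 0 1" and "Im (\<zeta> ^ 3) = 0"
  shows "Re (\<zeta> ^ 3) * (polygon_radius \<zeta> - polygon_radius (- \<zeta>)) > 0"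
proof -
  have right: "Re (\<zeta> ^ 3) * (polygon_radius \<zeta> - polygon_radius (- \<zeta>)) > 0"
    if n: "norm \<zeta> = 1" and i: "Im (\<zeta> ^ 3) = 0" and pos: "Re \<zeta> > 0" for \<zeta>
  proof -
    define a b where "a = Re \<zeta>" and "b = Im \<zeta>"
    have ab: "a\<^sup>2 + b\<^sup>2 = 1" using n cmod_power2[of \<zeta>] by (simp add: a_def b_def)
    have im: "Im (\<zeta> ^ 3) = b * (3 * a\<^sup>2 - b\<^sup>2)" and re: "Re (\<zeta> ^ 3) = a * (a\<^sup>2 - 3 * b\<^sup>2)"
      by (simp_all add: a_def b_def power3_eq_cube power2_eq_square algebra_simps)
    have nz: "\<zeta> \<noteq> 0" using n by auto
    show ?thesis
    proof (cases "b = 0")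
      case True
      then have "\<zeta> = 1" using on_axis(1)[OF n] pos by (auto simp: b_def)
      then show ?thesis
        by (simp add: polygon_radius_def polygon_gauge_def turn1_gauge_def turn2_gauge_def coord_square)
    next
      case False
      then have b2: "b\<^sup>2 = 3 * a\<^sup>2" using i im by simp
      define X Y where "X = coord_X (\<zeta>\<^sup>2)" and "Y = coord_Y (\<zeta>\<^sup>2)"
      have a2: "a\<^sup>2 > 0" using pos by (simp add: a_def)
      have X: "X = - a\<^sup>2 - a * b" "Y = - a\<^sup>2 + a * b"
        using b2 by (simp_all add: X_def Y_def coord_square a_def b_def)
      have s: "X + Y < 0" using X a2 by simp
      have "X * Y = a\<^sup>2 * a\<^sup>2 - a\<^sup>2 * b\<^sup>2" unfolding X by (simp add: algebra_simps power2_eq_square)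
      also have "\<dots> = - 2 * (a\<^sup>2 * a\<^sup>2)" unfolding b2 by simp
      also have "\<dots> < 0" using a2 by simp
      finally have "X * Y < 0" .
      then have "turn2_gauge X Y < turn1_gauge X Y"
        using s by (auto simp: turn1_gauge_def turn2_gauge_def mult_less_0_iff max_def min_def)
      then have g: "polygon_gauge (- \<zeta>) < polygon_gauge \<zeta>"
        using pos by (simp add: polygon_gauge_def X_def Y_def)
      then have "polygon_radius \<zeta> < polygon_radius (- \<zeta>)"
        unfolding polygon_radius_def using polygon_gauge_pos[of "- \<zeta>"] nz
        by (intro divide_strict_left_mono) auto
      moreover have "Re (\<zeta> ^ 3) < 0"
        unfolding re b2 using pos a2 by (simp add: a_def mult_pos_neg)
      ultimately show ?thesis by (simp add: mult_neg_neg)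
    qed
  qed
  have cube: "(- \<zeta>) ^ 3 = - (\<zeta> ^ 3)" by (simp add: power3_eq_cube)
  have n: "norm \<zeta> = 1" using assms(1) by simp
  consider "Re \<zeta> > 0" | "Re \<zeta> < 0" | "Re \<zeta> = 0" by linarith
  then show ?thesis
  proof cases
    case 1 then show ?thesis using right n assms(2) by blast
  next
    case 2
    have "Re ((- \<zeta>) ^ 3) * (polygon_radius (- \<zeta>) - polygon_radius (- (- \<zeta>))) > 0"
      using 2 n assms(2) by (intro right) (simp_all add: cube)
    then show ?thesis unfolding cube by (simp add: algebra_simps)
  next
    case 3
    then show ?thesis using on_axis(2)[OF n] assms(2) by (auto simp: power3_eq_cube)
  qed
qed

text \<open>Apart from the ray on which the turns join, the two rectangles can cross only on the
  antidiagonal, at (1, -1) and (-1, 1). These are the three crossings of the trefoil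
  diagram.\<close>

lemma gauge_coincidence:
  assumes "turn1_gauge X Y = turn2_gauge X Y" "X \<noteq> 0 \<or> Y \<noteq> 0"
  shows "X = Y \<and> X < 0 \<or> Y = - X"
  using assms by (auto simp: turn1_gauge_def turn2_gauge_def max_def min_def split: if_splits)

text \<open>At (-1, 1) the first turn has height 1/2 and passes over the closing arc at height 0. At
  (1, -1) it passes at height 1/2 below the second overpass. At the joint, where
  \<open>Re \<zeta> = 0\<close>, the first overpass at height 3/2 meets the strand at height 1/2.
  The sign of \<open>Im (\<zeta> ^ 3)\<close> fits in each case.\<close>

lemma polygon_heights:
  assumes "\<zeta> \<in> sphere 0 1" and "polygon_radius \<zeta> = polygon_radius (- \<zeta>)"
  shows "Im (\<zeta> ^ 3) * (polygon_height \<zeta> - polygon_height (- \<zeta>)) > 0"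
proof -
  have right: "Im (\<zeta> ^ 3) * (polygon_height \<zeta> - polygon_height (- \<zeta>)) > 0"
    if n: "norm \<zeta> = 1" and i: "polygon_radius \<zeta> = polygon_radius (- \<zeta>)" and pos: "Re \<zeta> > 0" for \<zeta>
  proof -
    define a b where "a = Re \<zeta>" and "b = Im \<zeta>"
    define X Y where "X = coord_X (\<zeta>\<^sup>2)" and "Y = coord_Y (\<zeta>\<^sup>2)"
    have nz: "\<zeta> \<noteq> 0" using n by auto
    have im: "Im (\<zeta> ^ 3) = b * (3 * a\<^sup>2 - b\<^sup>2)"
      by (simp add: a_def b_def power3_eq_cube power2_eq_square algebra_simps)
    have XY: "X = (a\<^sup>2 - b\<^sup>2 - 2 * (a * b)) / 2" "Y = (a\<^sup>2 - b\<^sup>2 + 2 * (a * b)) / 2"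
      by (simp_all add: X_def Y_def coord_square a_def b_def)
    have g: "polygon_gauge \<zeta> = turn1_gauge X Y" "polygon_gauge (- \<zeta>) = turn2_gauge X Y"
      using pos by (simp_all add: polygon_gauge_def X_def Y_def)
    have eq: "turn1_gauge X Y = turn2_gauge X Y" using i g by (simp add: polygon_radius_def)
    have pXY: "polygon_X \<zeta> = X / turn1_gauge X Y" "polygon_X (- \<zeta>) = X / turn1_gauge X Y"
      "polygon_Y (- \<zeta>) = Y / turn1_gauge X Y"
      using g eq by (simp_all add: polygon_X_def polygon_Y_def X_def Y_def)
    have a: "a > 0" using pos by (simp add: a_def)
    have "\<not> (X = Y \<and> X < 0)"
    proof
      assume h: "X = Y \<and> X < 0"
      then have "X = Y" by simp
      then have "a * b = 0" unfolding XY by simp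
      then have "b = 0" using a by simp
      then show False using h XY by (simp add: zero_le_power2 not_less)
    qed
    then have Y: "Y = - X" using gauge_coincidence[OF eq] coord_nonzero[OF nz] by (auto simp: X_def Y_def)
    then have "a\<^sup>2 = b\<^sup>2" unfolding XY by (simp add: field_simps)
    then have "b = a \<or> b = - a" by (metis power2_eq_iff)
    then show ?thesis
    proof
      assume b: "b = a"
      then have X: "X < 0" using XY a by simp
      then have "turn1_gauge X Y = - X" unfolding Y by (simp add: turn1_gauge_def)
      then have "polygon_X (- \<zeta>) = - 1" "polygon_Y (- \<zeta>) = 1" using pXY X Y by auto
      then have "polygon_height \<zeta> - polygon_height (- \<zeta>) = 1 / 2"
        using a b by (simp add: polygon_height_def a_def b_def turn2_upper_height_def)
      moreover have "Im (\<zeta> ^ 3) > 0" unfolding im b using a by simp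
      ultimately show ?thesis by simp
    next
      assume b: "b = - a"
      then have X: "X > 0" using XY a by simp
      then have "turn1_gauge X Y = X" unfolding Y by (simp add: turn1_gauge_def)
      then have "polygon_X \<zeta> = 1" "polygon_X (- \<zeta>) = 1" "polygon_Y (- \<zeta>) = - 1" using pXY X Y by auto
      then have "polygon_height \<zeta> - polygon_height (- \<zeta>) = - 1"
        using a b by (simp add: polygon_height_def a_def b_def turn1_height_def turn2_lower_height_def)
      moreover have "Im (\<zeta> ^ 3) < 0" unfolding im b using a by simp
      ultimately show ?thesis by simp
    qed
  qed
  have cube: "(- \<zeta>) ^ 3 = - (\<zeta> ^ 3)" by (simp add: power3_eq_cube)
  have n: "norm \<zeta> = 1" using assms(1) by simp
  consider "Re \<zeta> > 0" | "Re \<zeta> < 0" | "Re \<zeta> = 0" by linarith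
  then show ?thesis
  proof cases
    case 1 then show ?thesis using right n assms(2) by blast
  next
    case 2
    have "Im ((- \<zeta>) ^ 3) * (polygon_height (- \<zeta>) - polygon_height (- (- \<zeta>))) > 0"
      using 2 n assms(2) by (intro right) simp_all
    then show ?thesis unfolding cube by (simp add: algebra_simps)
  next
    case 3
    then show ?thesis using on_axis(2)[OF n]
      by (auto simp: power3_eq_cube polygon_height_def turn1_height_def)
  qed
qed

text \<open>The arc \<open>B\<close> and the arc closing it, in the coordinates \<open>(x, y, r)\<close> with \<open>r\<close> the distance
  from the boundary plane.\<close>

definition strand :: "real \<Rightarrow> real \<Rightarrow> real \<Rightarrow> bool" where
  "strand x y r \<longleftrightarrow>
    x = - 1 \<and> y = 0 \<and> 0 \<le> r \<and> r \<le> 3 / 2 \<or>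
    - 1 \<le> x \<and> x \<le> 1 \<and> y = 0 \<and> r = 3 / 2 \<or>
    x = 1 \<and> y = 0 \<and> 1 / 2 \<le> r \<and> r \<le> 3 / 2 \<or>
    1 \<le> x \<and> x \<le> 3 \<and> y = 0 \<and> r = 1 / 2 \<or>
    x = 3 \<and> 0 \<le> y \<and> y \<le> 2 \<and> r = 1 / 2 \<or>
    0 \<le> x \<and> x \<le> 3 \<and> y = 2 \<and> r = 1 / 2 \<or>
    x = 0 \<and> - 1 \<le> y \<and> y \<le> 2 \<and> r = 1 / 2 \<or>
    0 \<le> x \<and> x \<le> 2 \<and> y = - 1 \<and> r = 1 / 2 \<or>
    x = 2 \<and> y = - 1 \<and> 1 / 2 \<le> r \<and> r \<le> 3 / 2 \<or>
    x = 2 \<and> - 1 \<le> y \<and> y \<le> 1 \<and> r = 3 / 2 \<or>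
    x = 2 \<and> y = 1 \<and> 0 \<le> r \<and> r \<le> 3 / 2"

definition closing_strand :: "real \<Rightarrow> real \<Rightarrow> real \<Rightarrow> bool" where
  "closing_strand x y r \<longleftrightarrow>
    - 1 \<le> x \<and> x \<le> 2 \<and> y = 1 \<and> r = 0 \<or> x = - 1 \<and> 0 \<le> y \<and> y \<le> 1 \<and> r = 0"

definition tilted_polygon :: "real \<Rightarrow> real \<Rightarrow> real \<Rightarrow> bool" where
  "tilted_polygon X Y t \<longleftrightarrow>
    Y = - 1 \<and> - 2 \<le> X \<and> X \<le> - 7 / 4 \<and> t = 6 * (X + 2) \<or>
    Y = - 1 \<and> - 7 / 4 \<le> X \<and> X \<le> - 1 / 4 \<and> t = 3 / 2 \<or>
    Y = - 1 \<and> - 1 / 4 \<le> X \<and> X \<le> 0 \<and> t = 1 / 2 - 4 * X \<or>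
    Y = - 1 \<and> 0 \<le> X \<and> X \<le> 2 \<and> t = 1 / 2 \<or>
    X = 2 \<and> - 1 \<le> Y \<and> Y \<le> 3 \<and> t = 1 / 2 \<or>
    Y = 3 \<and> - 1 \<le> X \<and> X \<le> 2 \<and> t = 1 / 2 \<or>
    X = - 1 \<and> - 3 \<le> Y \<and> Y \<le> 3 \<and> t = 1 / 2 \<or>
    Y = - 3 \<and> - 1 \<le> X \<and> X \<le> 1 \<and> t = 1 / 2 \<or>
    X = 1 \<and> - 3 \<le> Y \<and> Y \<le> - 5 / 2 \<and> t = 2 * Y + 13 / 2 \<or>
    X = 1 \<and> - 5 / 2 \<le> Y \<and> Y \<le> 1 / 2 \<and> t = 3 / 2 \<or>
    X = 1 \<and> 1 / 2 \<le> Y \<and> Y \<le> 1 \<and> t = 3 * (1 - Y) \<or>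
    Y = 1 \<and> - 2 \<le> X \<and> X \<le> 1 \<and> t = 0 \<or>
    X = - 2 \<and> - 1 \<le> Y \<and> Y \<le> 1 \<and> t = 0"

section \<open>Tilting the lattice curve into monotone position\<close>

definition level :: "real \<Rightarrow> real" where
  "level t = max 0 (min t (3 / 2))"

text \<open>With increasing height the corners of the polygon carrying vertical segments are pushed
  along the horizontal edges, in the directions that make the angle increase along the curve.\<close>

definition tilt_x :: "real \<Rightarrow> real \<Rightarrow> real" where
  "tilt_x t x = x - 1 + (level t / 6 * max 0 (- x) - max 0 (level t - 1 / 2) / 4 * max 0 (1 - \<bar>x - 1\<bar>))"

definition tilt_y :: "real \<Rightarrow> real \<Rightarrow> real" where
  "tilt_y t y = 2 * y - 1 + (max 0 (level t - 1 / 2) / 2 * max 0 (- y) - level t / 3 * max 0 (1 - \<bar>y - 1\<bar>))"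

lemma bij_tilt: "bij (tilt_x t)" "bij (tilt_y t)"
proof -
  define b where "b = max 0 (level t - 1 / 2)"
  \<comment> \<open>The clamp in \<open>level\<close> bounds the coefficients for all real heights,
    so the tilt is bijective on the whole space and not only near the curve.\<close>
  have level: "0 \<le> level t" "level t \<le> 3 / 2" "0 \<le> b" "b \<le> 1"
    by (auto simp: level_def b_def)
  \<comment> \<open>The ramp \<open>max 0 (- x)\<close> and the hat around 1 are both Lipschitz with
    constant 1. The perturbation thus lowers the slope by at most \<open>p + q\<close>, which is at
    most half of the unperturbed slopes 1 and 2.\<close>
  have perturb: "p * max 0 (- y) - q * max 0 (1 - \<bar>y - 1\<bar>) - (p * max 0 (- x) - q * max 0 (1 - \<bar>x - 1\<bar>)) \<ge> - (p + q) * (y - x)"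
    if "0 \<le> p" "0 \<le> q" "x \<le> y" for p q x y :: real
  proof -
    have "p * (max 0 (- y) - max 0 (- x)) \<ge> p * - (y - x)"
      using that by (intro mult_left_mono) auto
    moreover have "q * (max 0 (1 - \<bar>x - 1\<bar>) - max 0 (1 - \<bar>y - 1\<bar>)) \<ge> q * - (y - x)"
      using that by (intro mult_left_mono) auto
    ultimately show ?thesis by (simp add: algebra_simps)
  qed
  have bound: "- (p + q) * (y - x) \<ge> - c * (y - x)" if "p + q \<le> c" "x \<le> y" for p q c x y :: real
    using that by (intro mult_right_mono) auto
  have combine: "- (1 / 2) * (y - x) \<le> v - u \<Longrightarrow> (y - 1 + v) - (x - 1 + u) \<ge> 1 / 2 * (y - x)"
    "- 1 * (y - x) \<le> v - u \<Longrightarrow> (2 * y - 1 + v) - (2 * x - 1 + u) \<ge> 1 * (y - x)" for x y u v :: real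
    by (simp_all add: field_simps)
  have coeffs: "0 \<le> level t / 6" "0 \<le> b / 4" "level t / 6 + b / 4 \<le> 1 / 2"
    "0 \<le> b / 2" "0 \<le> level t / 3" "b / 2 + level t / 3 \<le> 1"
    using level by auto
  show "bij (tilt_x t)"
  proof (rule bij_real_of_expanding)
    show "tilt_x t y - tilt_x t x \<ge> 1 / 2 * (y - x)" if "x \<le> y" for x y
      unfolding tilt_x_def b_def[symmetric]
      by (rule combine(1)[OF order_trans[OF bound[OF coeffs(3) that] perturb[OF coeffs(1,2) that]]])
  qed (auto simp: tilt_x_def[abs_def] intro!: continuous_intros)
  show "bij (tilt_y t)"
  proof (rule bij_real_of_expanding)
    show "tilt_y t y - tilt_y t x \<ge> 1 * (y - x)" if "x \<le> y" for x y
      unfolding tilt_y_def b_def[symmetric]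
      by (rule combine(2)[OF order_trans[OF bound[OF coeffs(6) that] perturb[OF coeffs(4,5) that]]])
  qed (auto simp: tilt_y_def[abs_def] intro!: continuous_intros)
qed

definition tilt :: "complex \<times> real \<Rightarrow> complex \<times> real" where
  "tilt p = (diag_point (tilt_x (snd p) (Re (fst p))) (tilt_y (snd p) (Im (fst p))), snd p)"

lemma homeomorphism_tilt: "homeomorphism UNIV UNIV tilt (inv tilt)"
proof (rule homeomorphism_bij)
  show "continuous_on UNIV tilt"
    unfolding tilt_def diag_point_def Complex_eq tilt_x_def tilt_y_def level_def by (intro continuous_intros) auto
  show "bij tilt"
  proof (rule o_bij)
    let ?g = "\<lambda>p. (Complex (inv (tilt_x (snd p)) (coord_X (fst p))) (inv (tilt_y (snd p)) (coord_Y (fst p))), snd p)"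
    have inv: "inv (tilt_x t) (tilt_x t x) = x" "inv (tilt_y t) (tilt_y t x) = x"
      "tilt_x t (inv (tilt_x t) x) = x" "tilt_y t (inv (tilt_y t) x) = x" for t x
      using bij_tilt[of t] by (simp_all add: bij_is_inj bij_is_surj surj_f_inv_f)
    show "?g \<circ> tilt = id" by (simp add: fun_eq_iff tilt_def inv)
    show "tilt \<circ> ?g = id" by (simp add: fun_eq_iff tilt_def inv diag_point_coord)
  qed
qed

text \<open>The term that attains the maximum in a gauge names the edge, and the diagonal X = Y cuts
  each turn into two halves on which a single height formula holds.\<close>

lemma tilted_polygon_gauge:
  "tilted_polygon X Y t \<longleftrightarrow>
    turn1_gauge X Y = 1 \<and> (X \<le> Y \<and> t = 1 / 2 \<or> Y \<le> X \<and> t = turn1_height X) \<or>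
    turn2_gauge X Y = 1 \<and> (X \<le> Y \<and> t = turn2_upper_height X Y \<or> Y \<le> X \<and> t = turn2_lower_height X Y)"
  (is "_ \<longleftrightarrow> ?R")
proof
  assume "tilted_polygon X Y t"
  then show ?R
    unfolding tilted_polygon_def
    apply (elim disjE conjE)
    by (simp_all add: turn1_gauge_def turn2_gauge_def turn1_height_def turn2_upper_height_def
       turn2_lower_height_def max_def min_def)
next
  have upper1: "X = - 1 \<and> Y \<le> 3 \<or> Y = 3 \<and> - 1 \<le> X \<and> X \<le> 2 \<or> X = 2 \<and> Y \<le> 3"
    if "turn1_gauge X Y = 1" "X \<le> Y"
    using that by (auto simp: turn1_gauge_def max_def split: if_splits)
  have lower1: "Y = - 1 \<and> X \<le> 2 \<or> X = 2 \<and> - 1 \<le> Y"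
    if "turn1_gauge X Y = 1" "Y \<le> X"
    using that by (auto simp: turn1_gauge_def max_def split: if_splits)
  have lower2: "X = - 1 \<and> Y \<ge> - 3 \<or> Y = - 3 \<and> - 1 \<le> X \<and> X \<le> 1 \<or> X = 1 \<and> Y \<ge> - 3"
    if "turn2_gauge X Y = 1" "Y \<le> X"
    using that by (auto simp: turn2_gauge_def max_def min_def split: if_splits)
  have upper2: "Y = 1 \<and> X \<ge> - 2 \<or> X = - 2 \<and> - 1 \<le> Y \<and> Y \<le> 1 \<or> Y = - 1 \<and> X \<ge> - 2"
    if "turn2_gauge X Y = 1" "X \<le> Y"
    using that by (auto simp: turn2_gauge_def max_def min_def split: if_splits)
  note heights = turn1_height_def turn2_upper_height_def turn2_lower_height_def
  assume ?R
  then consider "turn1_gauge X Y = 1" "X \<le> Y" "t = 1 / 2"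
    | "turn1_gauge X Y = 1" "Y \<le> X" "t = turn1_height X"
    | "turn2_gauge X Y = 1" "X \<le> Y" "t = turn2_upper_height X Y"
    | "turn2_gauge X Y = 1" "Y \<le> X" "t = turn2_lower_height X Y"
    by blast
  then show "tilted_polygon X Y t"
  proof cases
    case 1
    have "X \<le> Y" "t = 1 / 2" using 1(2,3) by simp_all
    with upper1[OF 1(1,2)] show ?thesis
      unfolding tilted_polygon_def heights max_def min_def by (smt (verit))
  next
    case 2
    have t: "X \<le> - 1 / 4 \<Longrightarrow> t = 3 / 2"
      "- 1 / 4 \<le> X \<Longrightarrow> X \<le> 0 \<Longrightarrow> t = 1 / 2 - 4 * X"
      "0 \<le> X \<Longrightarrow> t = 1 / 2"
      using 2(3) by (auto simp: heights max_def min_def)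
    from lower1[OF 2(1,2)] show ?thesis
    proof (elim disjE conjE)
      assume a: "Y = - 1" "X \<le> 2"
      consider "X \<le> - 1 / 4" | "- 1 / 4 \<le> X" "X \<le> 0" | "0 \<le> X" using a by linarith
      then show ?thesis using a t 2(2) by cases (simp_all add: tilted_polygon_def)
    next
      assume a: "X = 2" "- 1 \<le> Y"
      consider "X = 2" using a by linarith
      then show ?thesis using a t 2(2) by cases (simp_all add: tilted_polygon_def)
    qed
  next
    case 3
    have t: "Y = 1 \<Longrightarrow> X \<le> 1 \<Longrightarrow> t = 0"
      "X = - 2 \<Longrightarrow> - 1 \<le> Y \<Longrightarrow> t = 0"
      "Y = - 1 \<Longrightarrow> - 2 \<le> X \<Longrightarrow> X \<le> - 7 / 4 \<Longrightarrow> t = 6 * (X + 2)"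
      "Y = - 1 \<Longrightarrow> - 7 / 4 \<le> X \<Longrightarrow> t = 3 / 2"
      using 3(3) by (auto simp: heights max_def min_def)
    from upper2[OF 3(1,2)] show ?thesis
    proof (elim disjE conjE)
      assume a: "Y = 1" "X \<ge> - 2"
      consider "Y = 1" using a by linarith
      then show ?thesis using a t 3(2) by cases (simp_all add: tilted_polygon_def)
    next
      assume a: "X = - 2" "- 1 \<le> Y" "Y \<le> 1"
      consider "- 1 \<le> Y" using a by linarith
      then show ?thesis using a t 3(2) by cases (simp_all add: tilted_polygon_def)
    next
      assume a: "Y = - 1" "X \<ge> - 2"
      consider "X \<le> - 7 / 4" | "- 7 / 4 \<le> X" using a by linarith
      then show ?thesis using a t 3(2) by cases (simp_all add: tilted_polygon_def)
    qed
  next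
    case 4
    have t: "X = - 1 \<Longrightarrow> Y \<le> - 1 \<Longrightarrow> t = 1 / 2"
      "Y = - 3 \<Longrightarrow> X \<le> 1 \<Longrightarrow> t = 1 / 2"
      "X = 1 \<Longrightarrow> - 3 \<le> Y \<Longrightarrow> Y \<le> - 5 / 2 \<Longrightarrow> t = 2 * Y + 13 / 2"
      "X = 1 \<Longrightarrow> - 5 / 2 \<le> Y \<Longrightarrow> Y \<le> 1 / 2 \<Longrightarrow> t = 3 / 2"
      "X = 1 \<Longrightarrow> 1 / 2 \<le> Y \<Longrightarrow> Y \<le> 1 \<Longrightarrow> t = 3 * (1 - Y)"
      using 4(3) by (auto simp: heights max_def min_def)
    from lower2[OF 4(1,2)] show ?thesis
    proof (elim disjE conjE)
      assume a: "X = - 1" "Y \<ge> - 3"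
      consider "X = - 1" using a by linarith
      then show ?thesis using a t 4(2) by cases (simp_all add: tilted_polygon_def)
    next
      assume a: "Y = - 3" "- 1 \<le> X" "X \<le> 1"
      consider "Y = - 3" using a by linarith
      then show ?thesis using a t 4(2) by cases (simp_all add: tilted_polygon_def)
    next
      assume a: "X = 1" "Y \<ge> - 3"
      consider "Y \<le> - 5 / 2" | "- 5 / 2 \<le> Y" "Y \<le> 1 / 2" | "1 / 2 \<le> Y" using a by linarith
      then show ?thesis using a t 4(2) by cases (simp_all add: tilted_polygon_def)
    qed
  qed
qed

lemma tilt_values:
  shows "0 \<le> x \<Longrightarrow> tilt_x (1 / 2) x = x - 1"
    "- 1 \<le> x \<Longrightarrow> x \<le> 1 \<Longrightarrow> tilt_x (3 / 2) x = 3 / 4 * x - 1"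
    "y \<le> 0 \<Longrightarrow> tilt_y (1 / 2) y = 2 * y - 1"
      "0 \<le> y \<Longrightarrow> y \<le> 1 \<Longrightarrow> tilt_y (1 / 2) y = 11 / 6 * y - 1"
      "1 \<le> y \<Longrightarrow> y \<le> 2 \<Longrightarrow> tilt_y (1 / 2) y = 13 / 6 * y - 4 / 3"
    "- 1 \<le> y \<Longrightarrow> y \<le> 1 \<Longrightarrow> tilt_y (3 / 2) y = 3 / 2 * y - 1"
    "tilt_x 0 x = x - 1" "tilt_y 0 y = 2 * y - 1"
    "tilt_x t 0 = - 1" "tilt_x t 2 = 1" "tilt_x t 3 = 2" "tilt_y t 0 = - 1" "tilt_y t 2 = 3"
    "0 \<le> t \<Longrightarrow> t \<le> 3 / 2 \<Longrightarrow> tilt_x t (- 1) = t / 6 - 2"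
      "0 \<le> t \<Longrightarrow> t \<le> 3 / 2 \<Longrightarrow> tilt_y t 1 = 1 - t / 3"
    "1 / 2 \<le> t \<Longrightarrow> t \<le> 3 / 2 \<Longrightarrow> tilt_x t 1 = 1 / 8 - t / 4"
      "1 / 2 \<le> t \<Longrightarrow> t \<le> 3 / 2 \<Longrightarrow> tilt_y t (- 1) = t / 2 - 13 / 4"
  by (simp_all add: tilt_x_def tilt_y_def level_def max_def min_def abs_if field_simps)

lemma tilt_strand:
  assumes "strand x y t \<or> closing_strand x y t"
  shows "tilted_polygon (tilt_x t x) (tilt_y t y) t"
proof -
  note eval = tilted_polygon_def tilt_values
  from assms show ?thesis
    unfolding strand_def closing_strand_def
  proof (elim disjE conjE)
    assume "x = 3" "0 \<le> y" "y \<le> 2" "t = 1 / 2"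
    then show ?thesis by - (hypsubst, cases "y \<le> 1"; simp add: eval)
  next
    assume a: "x = 0" "- 1 \<le> y" "y \<le> 2" "t = 1 / 2"
    consider "y \<le> 0" | "0 \<le> y" "y \<le> 1" | "1 \<le> y" by linarith
    then show ?thesis unfolding a(1,4) by cases (use a in \<open>simp_all add: eval\<close>)
  qed (hypsubst, simp add: eval)+
qed

lemma tilt_strand_surj:
  assumes "tilted_polygon X Y t"
  shows "\<exists>x y. (strand x y t \<or> closing_strand x y t) \<and> tilt_x t x = X \<and> tilt_y t y = Y"
proof -
  \<comment> \<open>The inverse of \<open>tilt_y (1 / 2)\<close> on its affine pieces: the slopes 2,
    11/6 and 13/6 change at y = 0 and y = 1, whose images are -1 and 5/6.\<close>
  define y0 where "y0 Y = (if Y \<le> - 1 then (Y + 1) / 2 else if Y \<le> 5 / 6 then (Y + 1) * 6 / 11 else (Y + 4 / 3) * 6 / 13)"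
    for Y :: real
  have low_y: "tilt_y (1 / 2) (y0 Y) = Y" if "Y \<le> 3" for Y
    using that by (simp add: y0_def tilt_values) (simp add: field_simps)
  have y0: "- 1 \<le> y0 Y" "y0 Y \<le> 2" "Y \<ge> - 1 \<Longrightarrow> y0 Y \<ge> 0" if "- 3 \<le> Y" "Y \<le> 3" for Y
    using that by (auto simp: y0_def)
  from assms show ?thesis
    unfolding tilted_polygon_def
  proof (elim disjE conjE)
    assume "Y = - 1" "- 2 \<le> X" "X \<le> - 7 / 4" "t = 6 * (X + 2)"
    then show ?thesis by - (hypsubst, rule exI[of _ "- 1"], rule exI[of _ 0], simp add: strand_def tilt_values add_divide_distrib diff_divide_distrib)
  next
    assume "Y = - 1" "- 7 / 4 \<le> X" "X \<le> - 1 / 4" "t = 3 / 2"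
    then show ?thesis by - (hypsubst, rule exI[of _ "4 / 3 * (X + 1)"], rule exI[of _ 0], simp add: strand_def tilt_values add_divide_distrib diff_divide_distrib)
  next
    assume "Y = - 1" "- 1 / 4 \<le> X" "X \<le> 0" "t = 1 / 2 - 4 * X"
    then show ?thesis by - (hypsubst, rule exI[of _ 1], rule exI[of _ 0], simp add: strand_def tilt_values add_divide_distrib diff_divide_distrib)
  next
    assume "Y = - 1" "0 \<le> X" "X \<le> 2" "t = 1 / 2"
    then show ?thesis by - (hypsubst, rule exI[of _ "X + 1"], rule exI[of _ 0], simp add: strand_def tilt_values add_divide_distrib diff_divide_distrib)
  next
    assume "X = 2" "- 1 \<le> Y" "Y \<le> 3" "t = 1 / 2"
    then show ?thesis using y0[of Y] by - (hypsubst, rule exI[of _ 3], rule exI[of _ "y0 Y"], simp add: strand_def tilt_values low_y add_divide_distrib diff_divide_distrib)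
  next
    assume "Y = 3" "- 1 \<le> X" "X \<le> 2" "t = 1 / 2"
    then show ?thesis by - (hypsubst, rule exI[of _ "X + 1"], rule exI[of _ 2], simp add: strand_def tilt_values add_divide_distrib diff_divide_distrib)
  next
    assume "X = - 1" "- 3 \<le> Y" "Y \<le> 3" "t = 1 / 2"
    then show ?thesis using y0[of Y] by - (hypsubst, rule exI[of _ 0], rule exI[of _ "y0 Y"], simp add: strand_def tilt_values low_y add_divide_distrib diff_divide_distrib)
  next
    assume "Y = - 3" "- 1 \<le> X" "X \<le> 1" "t = 1 / 2"
    then show ?thesis by - (hypsubst, rule exI[of _ "X + 1"], rule exI[of _ "- 1"], simp add: strand_def tilt_values add_divide_distrib diff_divide_distrib)
  next
    assume "X = 1" "- 3 \<le> Y" "Y \<le> - 5 / 2" "t = 2 * Y + 13 / 2"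
    then show ?thesis by - (hypsubst, rule exI[of _ 2], rule exI[of _ "- 1"], simp add: strand_def tilt_values add_divide_distrib diff_divide_distrib)
  next
    assume "X = 1" "- 5 / 2 \<le> Y" "Y \<le> 1 / 2" "t = 3 / 2"
    then show ?thesis by - (hypsubst, rule exI[of _ 2], rule exI[of _ "2 / 3 * (Y + 1)"], simp add: strand_def tilt_values add_divide_distrib diff_divide_distrib)
  next
    assume "X = 1" "1 / 2 \<le> Y" "Y \<le> 1" "t = 3 * (1 - Y)"
    then show ?thesis by - (hypsubst, rule exI[of _ 2], rule exI[of _ 1], simp add: strand_def tilt_values add_divide_distrib diff_divide_distrib)
  next
    assume "Y = 1" "- 2 \<le> X" "X \<le> 1" "t = 0"
    then show ?thesis by - (hypsubst, rule exI[of _ "X + 1"], rule exI[of _ 1], simp add: closing_strand_def tilt_values add_divide_distrib diff_divide_distrib)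
  next
    assume "X = - 2" "- 1 \<le> Y" "Y \<le> 1" "t = 0"
    then show ?thesis by - (hypsubst, rule exI[of _ "- 1"], rule exI[of _ "(Y + 1) / 2"], simp add: closing_strand_def tilt_values add_divide_distrib diff_divide_distrib)
  qed
qed

section \<open>The polygon as the image of the double covering circle\<close>

lemma polygon_root:
  assumes "norm \<zeta> = 1" "\<zeta>\<^sup>2 = sgn (diag_point X Y)"
    and "Re \<zeta> \<ge> 0 \<and> turn1_gauge X Y = 1 \<or> Re \<zeta> < 0 \<and> turn2_gauge X Y = 1"
  shows "polygon_X \<zeta> = X" "polygon_Y \<zeta> = Y"
proof -
  define r where "r = 1 / norm (diag_point X Y)"
  have "diag_point X Y \<noteq> 0" using assms(1,2) by auto
  then have r: "r > 0" by (simp add: r_def)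
  have "\<zeta>\<^sup>2 = of_real r * diag_point X Y" unfolding assms(2) r_def by (simp add: sgn_eq)
  then have c: "coord_X (\<zeta>\<^sup>2) = r * X" "coord_Y (\<zeta>\<^sup>2) = r * Y" by (simp_all only: coord_of_real_mult coord_diag_point)
  then have "polygon_gauge \<zeta> = r" using assms(3) r by (auto simp: polygon_gauge_def gauge_scale)
  then show "polygon_X \<zeta> = X" "polygon_Y \<zeta> = Y" using r c by (simp_all add: polygon_X_def polygon_Y_def)
qed

text \<open>A point of the polygon has a direction with two square roots. Its turn decides between
  the roots with positive and negative real part, and the side of the diagonal decides the sign of
  the imaginary part. Over the direction -1 the real part is 0 and both turns are treated as the
  first one, which is correct because gauges and heights agree there.\<close>

lemma polygon_braid:
  "braid_point polygon_radius polygon_height ` sphere 0 1 =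
    {(diag_point X Y, t) | X Y t. tilted_polygon X Y t}" (is "?A = ?B")
proof
  show "?A \<subseteq> ?B"
  proof
    fix p assume "p \<in> ?A"
    then obtain \<zeta> where n: "norm \<zeta> = 1" and p: "p = braid_point polygon_radius polygon_height \<zeta>" by auto
    define X Y where "X = polygon_X \<zeta>" and "Y = polygon_Y \<zeta>"
    define r where "r = polygon_radius \<zeta>"
    have g: "polygon_gauge \<zeta> > 0" using n by (intro polygon_gauge_pos) auto
    then have r: "r > 0" "r * polygon_gauge \<zeta> = 1" by (simp_all add: r_def polygon_radius_def)
    have XY: "X = r * coord_X (\<zeta>\<^sup>2)" "Y = r * coord_Y (\<zeta>\<^sup>2)"
      by (simp_all add: X_def Y_def r_def polygon_X_def polygon_Y_def polygon_radius_def)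
    have "coord_Y (\<zeta>\<^sup>2) - coord_X (\<zeta>\<^sup>2) = 2 * Re \<zeta> * Im \<zeta>"
      by (simp add: coord_X_def coord_Y_def power2_eq_square field_simps)
    then have diff: "Y - X = (2 * r) * (Re \<zeta> * Im \<zeta>)" by (simp add: XY right_diff_distrib[symmetric])
    have s: "X \<le> Y" if "Re \<zeta> * Im \<zeta> \<ge> 0"
    proof -
      have "0 \<le> (2 * r) * (Re \<zeta> * Im \<zeta>)" using r(1) that by (intro mult_nonneg_nonneg[OF _ that]) auto
      then show ?thesis unfolding diff[symmetric] by simp
    qed
    have s': "Y \<le> X" if "Re \<zeta> * Im \<zeta> \<le> 0"
    proof -
      have "(2 * r) * (Re \<zeta> * Im \<zeta>) \<le> 0" using r(1) that by (intro mult_nonneg_nonpos[OF _ that]) auto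
      then show ?thesis unfolding diff[symmetric] by simp
    qed
    have "tilted_polygon X Y (polygon_height \<zeta>)"
    proof (cases "Re \<zeta> \<ge> 0")
      case True
      then have "turn1_gauge X Y = 1" using r by (simp add: XY gauge_scale polygon_gauge_def)
      then show ?thesis
        using True s s' unfolding tilted_polygon_gauge
        by (simp add: polygon_height_def X_def[symmetric] mult_nonneg_nonpos)
    next
      case False
      then have "turn2_gauge X Y = 1" using r by (simp add: XY gauge_scale polygon_gauge_def)
      then show ?thesis
        using False s s' unfolding tilted_polygon_gauge
        by (simp add: polygon_height_def X_def[symmetric] Y_def[symmetric] mult_nonpos_nonneg mult_nonpos_nonpos)
    qed
    then show "p \<in> ?B" using p polygon_diag_point[of \<zeta>] by (auto simp: braid_point_def X_def Y_def)
  qed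
  show "?B \<subseteq> ?A"
  proof
    fix p assume "p \<in> ?B"
    then obtain X Y t where p: "p = (diag_point X Y, t)" and t: "tilted_polygon X Y t" by auto
    have ne: "diag_point X Y \<noteq> 0"
    proof
      assume "diag_point X Y = 0"
      then have "X = 0" "Y = 0" using coord_diag_point[of X Y] by (simp_all add: coord_X_def coord_Y_def)
      then show False using t by (simp add: tilted_polygon_def)
    qed
    define u where "u = sgn (diag_point X Y)"
    have u: "norm u = 1" using ne by (simp add: u_def norm_sgn)
    have im: "Im u = (Y - X) / norm (diag_point X Y)" by (simp add: u_def sgn_eq diag_point_def)
    have imu: "X \<le> Y \<Longrightarrow> Im u \<ge> 0" "Y \<le> X \<Longrightarrow> Im u \<le> 0"
      unfolding im by (simp_all add: divide_nonpos_nonneg)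
    have same_gauge: "turn1_gauge X Y = turn2_gauge X Y" if "u = - 1"
    proof -
      define n where "n = norm (diag_point X Y)"
      have n: "n > 0" using ne by (simp add: n_def)
      have "diag_point X Y = of_real n * u" using ne by (simp add: u_def sgn_eq n_def)
      then have "X + Y = - n" "Y = X"
        unfolding that by (simp_all add: diag_point_def complex_eq_iff)
      then have "X = Y" "X < 0" using n by auto
      then show ?thesis by (simp add: turn1_gauge_def turn2_gauge_def)
    qed
    have "\<exists>\<zeta>. norm \<zeta> = 1 \<and> polygon_X \<zeta> = X \<and> polygon_Y \<zeta> = Y \<and> polygon_height \<zeta> = t"
    proof -
      from t consider "turn1_gauge X Y = 1" "X \<le> Y" "t = 1 / 2"
        | "turn1_gauge X Y = 1" "Y \<le> X" "t = turn1_height X"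
        | "turn2_gauge X Y = 1" "X \<le> Y" "t = turn2_upper_height X Y"
        | "turn2_gauge X Y = 1" "Y \<le> X" "t = turn2_lower_height X Y"
        unfolding tilted_polygon_gauge by blast
      then show ?thesis
      proof cases
        case 1
        then obtain \<zeta> where z: "norm \<zeta> = 1" "\<zeta>\<^sup>2 = u" "Re \<zeta> \<ge> 0" "Im \<zeta> \<ge> 0"
          using sqrt_in_quadrant(1)[OF u] imu by blast
        then show ?thesis using polygon_root[of \<zeta> X Y] 1 by (auto simp: u_def polygon_height_def)
      next
        case 2
        then obtain \<zeta> where z: "norm \<zeta> = 1" "\<zeta>\<^sup>2 = u" "Re \<zeta> \<ge> 0" "Im \<zeta> \<le> 0"
          using sqrt_in_quadrant(2)[OF u] imu by blast
        then have XY: "polygon_X \<zeta> = X" "polygon_Y \<zeta> = Y" using polygon_root[of \<zeta> X Y] 2 by (auto simp: u_def)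
        have "polygon_height \<zeta> = turn1_height X"
        proof (cases "Im \<zeta> = 0")
          case True
          then have "\<zeta> = 1" using on_axis(1)[OF z(1)] z(3) by auto
          then show ?thesis using XY by (auto simp: polygon_height_def turn1_height_def)
        qed (use z XY in \<open>auto simp: polygon_height_def\<close>)
        then show ?thesis using z XY 2 by blast
      next
        case 3
        then obtain \<xi> where x: "norm \<xi> = 1" "\<xi>\<^sup>2 = u" "Re \<xi> \<ge> 0" "Im \<xi> \<ge> 0"
          using sqrt_in_quadrant(1)[OF u] imu by blast
        define \<zeta> where "\<zeta> = - \<xi>"
        have z: "norm \<zeta> = 1" "\<zeta>\<^sup>2 = u" "Re \<zeta> \<le> 0" "Im \<zeta> \<le> 0" using x by (simp_all add: \<zeta>_def)
        show ?thesis
        proof (cases "Re \<zeta> = 0")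
          case True
          then have i: "\<zeta> = - \<i>" using on_axis(2)[OF z(1)] z(4) by auto
          then have "turn1_gauge X Y = 1" using same_gauge z(2) 3 by simp
          then have XY: "polygon_X \<zeta> = X" "polygon_Y \<zeta> = Y" using polygon_root[of \<zeta> X Y] z True by (auto simp: u_def)
          then have "X = - 1" "Y = - 1" unfolding i by auto
          then have "polygon_height \<zeta> = t"
            using 3 by (simp add: i polygon_height_def turn1_height_def turn2_upper_height_def)
          then show ?thesis using z XY by blast
        next
          case False
          then have XY: "polygon_X \<zeta> = X" "polygon_Y \<zeta> = Y" using polygon_root[of \<zeta> X Y] z 3 by (auto simp: u_def)
          have "polygon_height \<zeta> = t"
          proof (cases "Im \<zeta> = 0")
            case True
            then have m: "\<zeta> = - 1" using on_axis(1)[OF z(1)] z(3) by auto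
            then have "X = 1" "Y = 1" using XY by auto
            then show ?thesis using 3 by (simp add: m polygon_height_def turn2_lower_height_def turn2_upper_height_def)
          qed (use z XY False 3 in \<open>auto simp: polygon_height_def\<close>)
          then show ?thesis using z XY by blast
        qed
      next
        case 4
        then obtain \<xi> where x: "norm \<xi> = 1" "\<xi>\<^sup>2 = u" "Re \<xi> \<ge> 0" "Im \<xi> \<le> 0"
          using sqrt_in_quadrant(2)[OF u] imu by blast
        define \<zeta> where "\<zeta> = - \<xi>"
        have z: "norm \<zeta> = 1" "\<zeta>\<^sup>2 = u" "Re \<zeta> \<le> 0" "Im \<zeta> \<ge> 0" using x by (simp_all add: \<zeta>_def)
        show ?thesis
        proof (cases "Re \<zeta> = 0")
          case True
          then have i: "\<zeta> = \<i>" using on_axis(2)[OF z(1)] z(4) by auto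
          then have "turn1_gauge X Y = 1" using same_gauge z(2) 4 by simp
          then have XY: "polygon_X \<zeta> = X" "polygon_Y \<zeta> = Y" using polygon_root[of \<zeta> X Y] z True by (auto simp: u_def)
          then have "X = - 1" "Y = - 1" unfolding i by auto
          then have "polygon_height \<zeta> = t"
            using 4 by (simp add: i polygon_height_def turn2_lower_height_def)
          then show ?thesis using z XY by blast
        next
          case False
          then have XY: "polygon_X \<zeta> = X" "polygon_Y \<zeta> = Y" using polygon_root[of \<zeta> X Y] z 4 by (auto simp: u_def)
          then show ?thesis using z False 4 by (auto simp: polygon_height_def intro!: exI[of _ \<zeta>])
        qed
      qed
    qed
    then show "p \<in> ?A" using p polygon_diag_point by (force simp: braid_point_def)
  qed
qed


definition closed_strand :: "(complex \<times> real) set" where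
  "closed_strand = {(Complex x y, r) | x y r. strand x y r \<or> closing_strand x y r}"

lemma tilt_closed_strand: "tilt ` closed_strand = {(diag_point X Y, t) | X Y t. tilted_polygon X Y t}"
proof
  show "tilt ` closed_strand \<subseteq> {(diag_point X Y, t) | X Y t. tilted_polygon X Y t}"
    using tilt_strand by (fastforce simp: closed_strand_def tilt_def)
  show "{(diag_point X Y, t) | X Y t. tilted_polygon X Y t} \<subseteq> tilt ` closed_strand"
  proof
    fix p assume "p \<in> {(diag_point X Y, t) | X Y t. tilted_polygon X Y t}"
    then obtain X Y t where p: "p = (diag_point X Y, t)" "tilted_polygon X Y t" by auto
    then obtain x y where "strand x y t \<or> closing_strand x y t" "tilt_x t x = X" "tilt_y t y = Y"
      using tilt_strand_surj by blast
    then show "p \<in> tilt ` closed_strand"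
      using p by (intro image_eqI[of _ _ "(Complex x y, t)"]) (auto simp: closed_strand_def tilt_def)
  qed
qed

lemma trefoil_knot_closed_strand: "trefoil_knot (embed3 ` closed_strand)"
proof -
  have pos: "polygon_radius \<zeta> > 0" if "\<zeta> \<in> sphere 0 1" for \<zeta>
  proof -
    have "\<zeta> \<noteq> 0" using that by auto
    then show ?thesis using polygon_gauge_pos[of \<zeta>] by (simp add: polygon_radius_def)
  qed
  obtain f g where fg: "homeomorphism UNIV UNIV f g"
    and f: "f ` braid_point trefoil_radius trefoil_height ` sphere 0 1 = braid_point polygon_radius polygon_height ` sphere 0 1"
    by (rule trefoil_braid[OF continuous_on_polygon_radius pos continuous_on_polygon_height polygon_radii polygon_heights])
  have h: "homeomorphism UNIV UNIV (inv tilt \<circ> f) (g \<circ> tilt)"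
    using homeomorphism_compose[OF fg] homeomorphism_tilt homeomorphism_symD by blast
  have "(inv tilt \<circ> f) ` braid_point trefoil_radius trefoil_height ` sphere 0 1 = inv tilt ` tilt ` closed_strand"
    unfolding image_comp[symmetric] f polygon_braid tilt_closed_strand ..
  also have "\<dots> = closed_strand"
    using homeomorphism_apply1[OF homeomorphism_tilt] by (simp add: image_image)
  finally show ?thesis using trefoil_knot_embed3[OF h] by blast
qed

section \<open>Cells of the cubulations\<close>

text \<open>A box with lower corner \<open>s * v\<close> that extends only in the directions of
  \<open>J\<close>. For \<open>s > 0\<close> every cell of every dimension has exactly one such
  code, which turns inclusion and incidence into integer arithmetic.\<close>

definition cell :: "real \<Rightarrow> (4 \<Rightarrow> int) \<Rightarrow> 4 set \<Rightarrow> (real^4) set" where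
  "cell s v J = {x. \<forall>i. s * real_of_int (v i) \<le> x $ i \<and> x $ i \<le> s * real_of_int (v i + of_bool (i \<in> J))}"

lemma in_cell:
  "x \<in> cell s v J \<longleftrightarrow>
    (\<forall>i. s * real_of_int (v i) \<le> x $ i \<and> x $ i \<le> s * real_of_int (v i + of_bool (i \<in> J)))"
  by (simp add: cell_def)

lemma cell_eq_cbox:
  "cell s v J = cbox (\<chi> i. s * real_of_int (v i)) (\<chi> i. s * real_of_int (v i + of_bool (i \<in> J)))"
  by (auto simp: in_cell mem_box_cart)

lemma cubulation_eq: "cubulation s = {cell s v UNIV | v. True}"
proof -
  have eq: "cell s v UNIV = cbox (s *\<^sub>R w) (s *\<^sub>R (w + 1))" if "w = (\<chi> i. real_of_int (v i))" for v w
    using that by (auto simp: in_cell mem_box_cart)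
  show ?thesis
  proof (intro equalityI subsetI)
    fix Q assume "Q \<in> cubulation s"
    then obtain w :: "real^4" where w: "Q = cbox (s *\<^sub>R w) (s *\<^sub>R (w + 1))" "\<forall>i. w $ i \<in> \<int>"
      by (auto simp: cubulation_def)
    define v where "v i = \<lfloor>w $ i\<rfloor>" for i
    have "w = (\<chi> i. real_of_int (v i))" using w(2) by (simp add: vec_eq_iff v_def)
    then show "Q \<in> {cell s v UNIV | v. True}" using eq w(1) by blast
  next
    fix Q assume "Q \<in> {cell s v UNIV | v. True}"
    then obtain v where "Q = cell s v UNIV" by blast
    then show "Q \<in> cubulation s"
      unfolding cubulation_def using eq[OF refl, of v] by (auto intro!: exI[of _ "\<chi> i. real_of_int (v i)"])
  qed
qed

lemma convex_cell: "convex (cell s v J)"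
  by (simp add: cell_eq_cbox)

lemma bounded_cell: "bounded (cell s v J)"
  by (simp add: cell_eq_cbox)

lemma cell_subset_iff:
  assumes s: "s > 0"
  shows "cell s w I \<subseteq> cell s v J \<longleftrightarrow>
    (\<forall>i. v i \<le> w i \<and> w i + of_bool (i \<in> I) \<le> v i + of_bool (i \<in> J))"
proof
  have m: "s * real_of_int a \<le> s * real_of_int b \<longleftrightarrow> a \<le> b" for a b
    using s by simp
  assume sub: "cell s w I \<subseteq> cell s v J"
  have "(\<chi> i. s * real_of_int (w i)) \<in> cell s w I" "(\<chi> i. s * real_of_int (w i + of_bool (i \<in> I))) \<in> cell s w I"
    unfolding in_cell m vec_lambda_beta by simp_all
  then have "(\<chi> i. s * real_of_int (w i)) \<in> cell s v J" "(\<chi> i. s * real_of_int (w i + of_bool (i \<in> I))) \<in> cell s v J"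
    using sub by auto
  then show "\<forall>i. v i \<le> w i \<and> w i + of_bool (i \<in> I) \<le> v i + of_bool (i \<in> J)"
    unfolding in_cell m vec_lambda_beta by blast
next
  assume a: "\<forall>i. v i \<le> w i \<and> w i + of_bool (i \<in> I) \<le> v i + of_bool (i \<in> J)"
  have "s * real_of_int (v i) \<le> s * real_of_int (w i)"
    "s * real_of_int (w i + of_bool (i \<in> I)) \<le> s * real_of_int (v i + of_bool (i \<in> J))" for i
    using a s by (auto simp del: of_int_add)
  then show "cell s w I \<subseteq> cell s v J"
    unfolding in_cell subset_iff by (meson order_trans)
qed

lemma cell_inject:
  assumes "s > 0" and eq: "cell s v J = cell s w I"
  shows "v = w \<and> J = I"
proof -
  have a: "\<forall>i. v i \<le> w i \<and> w i + of_bool (i \<in> I) \<le> v i + of_bool (i \<in> J)"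
    "\<forall>i. w i \<le> v i \<and> v i + of_bool (i \<in> J) \<le> w i + of_bool (i \<in> I)"
    using cell_subset_iff[OF assms(1)] eq by blast+
  then have vw: "v = w" by (auto intro!: ext antisym)
  have "(i \<in> I) = (i \<in> J)" for i using a[THEN spec, of i] vw by (cases "i \<in> I"; cases "i \<in> J") auto
  then show ?thesis using vw by blast
qed

text \<open>A coordinate that is fixed on the smaller cell but free on the larger one has an extreme
  value there. A proper convex combination attains an extreme value only if both end points
  do.\<close>

lemma cell_face:
  assumes s: "s > 0" and face: "\<forall>i. v i \<le> w i \<and> w i + of_bool (i \<in> I) \<le> v i + of_bool (i \<in> J)"
  shows "cell s w I face_of cell s v J"
  unfolding face_of_def
proof (intro conjI ballI impI)
  show "cell s w I \<subseteq> cell s v J" using cell_subset_iff[OF s] face by blast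
  show "convex (cell s w I)" by (rule convex_cell)
  fix a b x assume a: "a \<in> cell s v J" and b: "b \<in> cell s v J" and x: "x \<in> cell s w I" and seg: "x \<in> open_segment a b"
  obtain u where u: "0 < u" "u < 1" "x = (1 - u) *\<^sub>R a + u *\<^sub>R b"
    using seg by (auto simp: in_segment)
  have "s * real_of_int (w i) \<le> a $ i \<and> a $ i \<le> s * real_of_int (w i + of_bool (i \<in> I)) \<and>
    s * real_of_int (w i) \<le> b $ i \<and> b $ i \<le> s * real_of_int (w i + of_bool (i \<in> I))" for i
  proof -
    have ab: "s * real_of_int (v i) \<le> a $ i" "a $ i \<le> s * real_of_int (v i + of_bool (i \<in> J))"
      "s * real_of_int (v i) \<le> b $ i" "b $ i \<le> s * real_of_int (v i + of_bool (i \<in> J))"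
      using a b by (auto simp: in_cell)
    have xi: "x $ i = (1 - u) * a $ i + u * b $ i" by (simp add: u(3))
    have f: "v i \<le> w i" "w i + of_bool (i \<in> I) \<le> v i + of_bool (i \<in> J)" using face by auto
    consider "w i = v i" "(i \<in> I) = (i \<in> J)" | "w i = v i" "i \<notin> I" | "w i = v i + 1" "i \<notin> I" "i \<in> J"
      using f by (cases "i \<in> I"; cases "i \<in> J") (auto, linarith)
    then show ?thesis
    proof cases
      case 1
      then show ?thesis using ab by simp
    next
      case 2
      then have "x $ i = s * real_of_int (v i)" using x by (auto simp: in_cell intro!: antisym dest!: spec[of _ i])
      then have "(1 - u) * (a $ i - s * real_of_int (v i)) + u * (b $ i - s * real_of_int (v i)) = 0"
        using xi by (simp add: algebra_simps)
      moreover have "(1 - u) * (a $ i - s * real_of_int (v i)) \<ge> 0" "u * (b $ i - s * real_of_int (v i)) \<ge> 0"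
        using u ab by simp_all
      ultimately have "(1 - u) * (a $ i - s * real_of_int (v i)) = 0" "u * (b $ i - s * real_of_int (v i)) = 0"
        by linarith+
      then show ?thesis using u 2 by simp
    next
      case 3
      let ?r = "s * real_of_int (v i + 1)"
      have "x $ i = ?r" using x 3 by (auto simp: in_cell intro!: antisym dest!: spec[of _ i])
      then have "(1 - u) * (?r - a $ i) + u * (?r - b $ i) = 0"
        using xi by (simp add: algebra_simps)
      moreover have "(1 - u) * (?r - a $ i) \<ge> 0" "u * (?r - b $ i) \<ge> 0"
        using u ab 3 by simp_all
      ultimately have "(1 - u) * (?r - a $ i) = 0" "u * (?r - b $ i) = 0"
        by linarith+
      then show ?thesis using u 3 by simp
    qed
  qed
  then show "a \<in> cell s w I" "b \<in> cell s w I" by (simp_all add: in_cell)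
qed

text \<open>The face keeps exactly the coordinates in which a point \<open>p\<close> of its relative interior is
  strictly between the bounds.\<close>

lemma face_of_cell:
  assumes s: "s > 0" and face: "F face_of cell s v J" and ne: "F \<noteq> {}"
  obtains w I where "F = cell s w I"
    and "\<forall>i. v i \<le> w i \<and> w i + of_bool (i \<in> I) \<le> v i + of_bool (i \<in> J)"
proof -
  have conv: "convex F" and sub: "F \<subseteq> cell s v J"
    using face face_of_imp_convex face_of_imp_subset convex_cell by blast+
  obtain p where p: "p \<in> rel_interior F"
    using rel_interior_eq_empty[OF conv] ne by blast
  then have pF: "p \<in> F" using rel_interior_subset by blast
  define lo hi where "lo i = s * real_of_int (v i)" and "hi i = s * real_of_int (v i + of_bool (i \<in> J))" for i
  have C: "x \<in> cell s v J \<longleftrightarrow> (\<forall>i. lo i \<le> x $ i \<and> x $ i \<le> hi i)" for x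
    by (simp add: in_cell lo_def hi_def)
  have pC: "lo i \<le> p $ i" "p $ i \<le> hi i" for i using pF sub C by blast+
  define I where "I = {i. lo i < p $ i \<and> p $ i < hi i}"
  define w where "w i = (if i \<in> I \<or> p $ i = lo i then v i else v i + 1)" for i
  have IJ: "i \<in> J" if "i \<in> I" for i using that by (cases "i \<in> J") (auto simp: I_def lo_def hi_def)
  have up: "i \<in> J \<and> p $ i = hi i" if "i \<notin> I" "p $ i \<noteq> lo i" for i
    using that pC[of i] by (auto simp: I_def lo_def hi_def)
  have wI: "\<forall>i. v i \<le> w i \<and> w i + of_bool (i \<in> I) \<le> v i + of_bool (i \<in> J)"
    using IJ up by (auto simp: w_def)
  have pw: "p $ i = s * real_of_int (w i)" if "i \<notin> I" for i
    using up[OF that] that by (auto simp: w_def lo_def hi_def)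
  have "F = cell s w I"
  proof
    show "F \<subseteq> cell s w I"
    proof
      fix x assume x: "x \<in> F"
      \<comment> \<open>The segment from \<open>x\<close> to the relatively interior point
        \<open>p\<close> can be prolonged beyond \<open>p\<close> within \<open>F\<close>. In a
        coordinate where \<open>p\<close> attains a bound, the prolonged point would violate this
        bound unless \<open>x\<close> agrees with \<open>p\<close>.\<close>
      then obtain e where e: "e > 1" "(1 - e) *\<^sub>R x + e *\<^sub>R p \<in> F"
        using convex_rel_interior_if[OF conv p] hull_inc[of x F affine] by force
      have y: "lo i \<le> (1 - e) * x $ i + e * p $ i" "(1 - e) * x $ i + e * p $ i \<le> hi i" for i
        using e(2) sub C by fastforce+
      have xC: "lo i \<le> x $ i" "x $ i \<le> hi i" for i using x sub C by blast+
      have "x $ i = p $ i" if "i \<notin> I" for i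
      proof (cases "p $ i = lo i")
        case True
        have "(1 - e) * (x $ i - p $ i) \<ge> 0" using y(1)[of i] True by (simp add: algebra_simps)
        then have "x $ i \<le> p $ i" using e(1) by (simp add: zero_le_mult_iff)
        then show ?thesis using xC(1)[of i] True by simp
      next
        case False
        then have hi: "p $ i = hi i" using up that by blast
        have "(1 - e) * (x $ i - p $ i) \<le> 0" using y(2)[of i] hi by (simp add: algebra_simps)
        then have "x $ i \<ge> p $ i" using e(1) by (simp add: mult_le_0_iff)
        then show ?thesis using xC(2)[of i] hi by simp
      qed
      then have "s * real_of_int (w i) \<le> x $ i \<and> x $ i \<le> s * real_of_int (w i + of_bool (i \<in> I))" for i
        using pw[of i] xC[of i] IJ[of i] by (cases "i \<in> I") (auto simp: w_def lo_def hi_def)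
      then show "x \<in> cell s w I" by (simp add: in_cell)
    qed
    show "cell s w I \<subseteq> F"
    proof
      fix x assume x: "x \<in> cell s w I"
      have xC: "x \<in> cell s v J" using x wI cell_subset_iff[OF s] by blast
      have xp: "x $ i = p $ i" if "i \<notin> I" for i
        using x that pw[OF that] by (auto simp: in_cell intro!: antisym dest!: spec[of _ i])
      \<comment> \<open>Conversely, a small step past \<open>p\<close>, away from \<open>x\<close>,
        stays in the large cell: the coordinates outside \<open>I\<close> do not change and those in
        \<open>I\<close> have room on both sides. Then \<open>p\<close> is inside a segment that
        ends at \<open>x\<close>, and the face property yields \<open>x\<close>.\<close>
      have "\<forall>\<^sub>F e in at_right 0. p + e *\<^sub>R (p - x) \<in> cell s v J"
      proof -
        have "\<forall>\<^sub>F e in at_right (0::real). lo i \<le> p $ i + e * (p $ i - x $ i) \<and> p $ i + e * (p $ i - x $ i) \<le> hi i" for i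
        proof (cases "i \<in> I")
          case True
          have lim: "((\<lambda>e. p $ i + e * (p $ i - x $ i)) \<longlongrightarrow> p $ i + 0 * (p $ i - x $ i)) (at_right 0)"
            by (intro tendsto_intros)
          have "\<forall>\<^sub>F e in at_right (0::real). lo i < p $ i + e * (p $ i - x $ i)"
            "\<forall>\<^sub>F e in at_right (0::real). p $ i + e * (p $ i - x $ i) < hi i"
            using order_tendstoD[OF lim] True by (auto simp: I_def)
          then show ?thesis by eventually_elim auto
        next
          case False
          then show ?thesis using xp pC by simp
        qed
        then have "\<forall>\<^sub>F e in at_right (0::real). \<forall>i. lo i \<le> p $ i + e * (p $ i - x $ i) \<and> p $ i + e * (p $ i - x $ i) \<le> hi i"
          by (rule eventually_all_finite)
        then show ?thesis by eventually_elim (simp add: C)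
      qed
      moreover have "\<forall>\<^sub>F e in at_right 0. (0::real) < e" by (rule eventually_at_right_less)
      ultimately have "\<forall>\<^sub>F e in at_right (0::real). 0 < e \<and> p + e *\<^sub>R (p - x) \<in> cell s v J"
        by eventually_elim simp
      then obtain e :: real where e: "0 < e" "p + e *\<^sub>R (p - x) \<in> cell s v J"
        using eventually_happens trivial_limit_at_right_real by blast
      show "x \<in> F"
      proof (cases "x = p")
        case False
        have eq: "p = (1 - 1 / (1 + e)) *\<^sub>R x + (1 / (1 + e)) *\<^sub>R (p + e *\<^sub>R (p - x))"
        proof -
          have "p $ i = (1 - 1 / (1 + e)) * x $ i + (1 / (1 + e)) * (p $ i + e * (p $ i - x $ i))" for i
          proof -
            define q where "q = 1 / (1 + e)"
            have q: "q * (1 + e) = 1" using e(1) by (simp add: q_def)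
            have "(1 - q) * x $ i + q * (p $ i + e * (p $ i - x $ i)) = x $ i - q * (1 + e) * x $ i + q * (1 + e) * p $ i"
              by (simp add: algebra_simps)
            then have "(1 - q) * x $ i + q * (p $ i + e * (p $ i - x $ i)) = p $ i" unfolding q by simp
            then show ?thesis unfolding q_def by simp
          qed
          then show ?thesis by (simp add: vec_eq_iff)
        qed
        have "x \<noteq> p + e *\<^sub>R (p - x)"
        proof
          assume "x = p + e *\<^sub>R (p - x)"
          then have "(1 + e) *\<^sub>R (p - x) = 0" by (simp add: algebra_simps)
          then show False using e(1) False by simp
        qed
        then have "p \<in> open_segment x (p + e *\<^sub>R (p - x))"
          unfolding in_segment using eq e(1) by (intro conjI exI[of _ "1 / (1 + e)"]) auto
        then show ?thesis using face_ofD[OF face _ xC e(2) pF] by blast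
      qed (use pF in simp)
    qed
  qed
  then show ?thesis using that wI by blast
qed

lemma aff_dim_cell:
  assumes s: "s > 0" shows "aff_dim (cell s v J) = int (card J)"
proof -
  define a where "a = (\<chi> i. s * real_of_int (v i))"
  define T where "T = (\<lambda>x. x - a) ` cell s v J"
  define B where "B = (\<lambda>i. axis i 1 :: real^4) ` J"
  have "a \<in> cell s v J" using s by (simp add: in_cell a_def)
  then have "aff_dim (cell s v J) = int (dim T)"
    unfolding T_def by (intro aff_dim_eq_dim_subtract hull_inc)
  moreover have "span T = span B"
    unfolding span_eq
  proof
    show "T \<subseteq> span B"
    proof
      fix y assume "y \<in> T"
      then obtain x where x: "x \<in> cell s v J" "y = x - a" by (auto simp: T_def)
      have "y $ i = 0" if "i \<notin> J" for i
        using x that by (auto simp: in_cell a_def intro!: antisym dest!: spec[of _ i])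
      then have "y = (\<Sum>i\<in>J. (y $ i) *\<^sub>R axis i 1)"
        by (auto simp: vec_eq_iff axis_def if_distrib[of "\<lambda>z. _ * z"] sum.delta' cong: if_cong)
      also have "\<dots> \<in> span B" by (intro span_sum span_scale span_base) (simp add: B_def)
      finally show "y \<in> span B" .
    qed
    show "B \<subseteq> span T"
    proof
      fix b assume "b \<in> B"
      then obtain i where i: "i \<in> J" "b = axis i 1" by (auto simp: B_def)
      have "a + s *\<^sub>R b \<in> cell s v J"
        using i s by (auto simp: in_cell a_def axis_def algebra_simps)
      then have "s *\<^sub>R b \<in> T" unfolding T_def by force
      then have "(1 / s) *\<^sub>R (s *\<^sub>R b) \<in> span T" by (intro span_scale span_base)
      then show "b \<in> span T" using s by simp
    qed
  qed
  moreover have "independent B"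
    by (rule independent_mono[OF independent_Basis]) (auto simp: B_def axis_in_Basis_iff)
  moreover have "card B = card J"
    unfolding B_def by (intro card_image) (auto simp: inj_on_def axis_eq_axis)
  ultimately show ?thesis by (metis dim_eq_card_independent dim_span)
qed

lemma cells_eq:
  assumes s: "s > 0" shows "cells s k = {cell s v J | v J. card J = k}"
proof (intro equalityI subsetI)
  fix F assume "F \<in> cells s k"
  then obtain v where F: "F face_of cell s v UNIV" "aff_dim F = int k"
    by (auto simp: cells_def cubulation_eq)
  then have "F \<noteq> {}" by auto
  then obtain w I where "F = cell s w I" using face_of_cell[OF s F(1)] by blast
  then show "F \<in> {cell s v J | v J. card J = k}" using F(2) aff_dim_cell[OF s] by auto
next
  fix F assume "F \<in> {cell s v J | v J. card J = k}"
  then obtain v J where F: "F = cell s v J" "card J = k" by blast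
  have "F face_of cell s v UNIV" unfolding F(1) by (rule cell_face[OF s]) auto
  then show "F \<in> cells s k" using F aff_dim_cell[OF s] by (auto simp: cells_def cubulation_eq)
qed

section \<open>The cubical knot\<close>

definition square_norm :: "real^4 \<Rightarrow> real" where
  "square_norm x = max \<bar>x $ 3 - 1 / 2\<bar> \<bar>x $ 4 - 1 / 2\<bar>"

definition knot :: "(real^4) set" where
  "knot = {x. strand (x $ 1) (x $ 2) (square_norm x)}"

text \<open>Membership of points with half-integral coordinates, in doubled coordinates: a cell with
  integral vertices lies in the knot if and only if its midpoint does.\<close>

definition doubled_strand :: "int \<Rightarrow> int \<Rightarrow> int \<Rightarrow> bool" where
  "doubled_strand x y r \<longleftrightarrow>
    x = - 2 \<and> y = 0 \<and> r \<le> 3 \<or>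
    - 2 \<le> x \<and> x \<le> 2 \<and> y = 0 \<and> r = 3 \<or>
    x = 2 \<and> y = 0 \<and> 1 \<le> r \<and> r \<le> 3 \<or>
    2 \<le> x \<and> x \<le> 6 \<and> y = 0 \<and> r = 1 \<or>
    x = 6 \<and> 0 \<le> y \<and> y \<le> 4 \<and> r = 1 \<or>
    0 \<le> x \<and> x \<le> 6 \<and> y = 4 \<and> r = 1 \<or>
    x = 0 \<and> - 2 \<le> y \<and> y \<le> 4 \<and> r = 1 \<or>
    0 \<le> x \<and> x \<le> 4 \<and> y = - 2 \<and> r = 1 \<or>
    x = 4 \<and> y = - 2 \<and> 1 \<le> r \<and> r \<le> 3 \<or>
    x = 4 \<and> - 2 \<le> y \<and> y \<le> 2 \<and> r = 3 \<or>
    x = 4 \<and> y = 2 \<and> r \<le> 3"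

lemma doubled_strand_of_strand:
  "strand (real_of_int a / 2) (real_of_int b / 2) (real_of_int r / 2) \<Longrightarrow> doubled_strand a b r"
  unfolding strand_def doubled_strand_def by (elim disjE conjE) (simp_all add: field_simps)

text \<open>In doubled coordinates the centre of the unit square is (1, 1), and the maximum is the
  doubled \<open>square_norm\<close> of the point.\<close>

definition half_lattice_knot :: "int \<Rightarrow> int \<Rightarrow> int \<Rightarrow> int \<Rightarrow> bool" where
  "half_lattice_knot a b c d \<longleftrightarrow> doubled_strand a b (max \<bar>c - 1\<bar> \<bar>d - 1\<bar>)"

text \<open>A unit lattice interval has an odd doubled midpoint and never straddles an integer. An
  even bound for the doubled midpoint thus bounds the whole interval.\<close>

lemma cell_coordinate_bounds:
  fixes v a b :: int and e :: bool and x :: real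
  assumes "real_of_int v \<le> x" "x \<le> real_of_int (v + of_bool e)"
  shows "2 * a \<le> 2 * v + of_bool e \<Longrightarrow> real_of_int a \<le> x"
    and "2 * v + of_bool e \<le> 2 * b \<Longrightarrow> x \<le> real_of_int b"
proof -
  show "real_of_int a \<le> x" if "2 * a \<le> 2 * v + of_bool e"
  proof -
    have "a \<le> v" using that by (cases e) auto
    then show ?thesis using assms(1) by linarith
  qed
  show "x \<le> real_of_int b" if "2 * v + of_bool e \<le> 2 * b"
  proof -
    have "v + of_bool e \<le> b" using that by (cases e) auto
    then show ?thesis using assms(2) by (meson of_int_le_iff order_trans)
  qed
qed

text \<open>Necessity is membership of the midpoint. For sufficiency, the bounds on the first two
  coordinates in \<open>strand\<close> are integers and the positive bounds on the radius are
  half-integral, so every bound is a lattice hyperplane in one of the four coordinates. No cell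
  crosses such a wall, and the midpoint decides for all its points.\<close>

lemma cell_subset_knot_iff:
  "cell 1 v J \<subseteq> knot \<longleftrightarrow>
    half_lattice_knot (2 * v 1 + of_bool (1 \<in> J)) (2 * v 2 + of_bool (2 \<in> J))
      (2 * v 3 + of_bool (3 \<in> J)) (2 * v 4 + of_bool (4 \<in> J))"
    (is "_ \<longleftrightarrow> half_lattice_knot ?a ?b ?c ?d")
proof
  assume sub: "cell 1 v J \<subseteq> knot"
  define x :: "real^4" where "x = (\<chi> i. real_of_int (2 * v i + of_bool (i \<in> J)) / 2)"
  have "x \<in> cell 1 v J" by (auto simp: in_cell x_def field_simps)
  then have "x \<in> knot" using sub by blast
  moreover have "square_norm x = real_of_int (max \<bar>?c - 1\<bar> \<bar>?d - 1\<bar>) / 2"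
  proof -
    have h: "real_of_int k / 2 - 1 / 2 = real_of_int (k - 1) / 2" for k by simp
    show ?thesis
      unfolding square_norm_def x_def vec_lambda_beta h abs_divide of_int_abs[symmetric] of_int_max
      by (simp only: max_divide_distrib_right) simp
  qed
  moreover define R where "R = max \<bar>?c - 1\<bar> \<bar>?d - 1\<bar>"
  ultimately have "strand (real_of_int ?a / 2) (real_of_int ?b / 2) (real_of_int R / 2)"
    by (simp only: knot_def mem_Collect_eq x_def vec_lambda_beta)
  then have "doubled_strand ?a ?b R"
    by (rule doubled_strand_of_strand)
  then show "half_lattice_knot ?a ?b ?c ?d" by (simp add: half_lattice_knot_def R_def)
next
  assume h: "half_lattice_knot ?a ?b ?c ?d"
  show "cell 1 v J \<subseteq> knot"
  proof
    fix x assume "x \<in> cell 1 v J"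
    then have x: "real_of_int (v i) \<le> x $ i" "x $ i \<le> real_of_int (v i + of_bool (i \<in> J))" for i
      by (auto simp: in_cell)
    note lower = cell_coordinate_bounds(1)[OF x] and upper = cell_coordinate_bounds(2)[OF x]
    define R where "R = max \<bar>?c - 1\<bar> \<bar>?d - 1\<bar>"
    have r_le: "square_norm x \<le> real_of_int k + 1 / 2" if "R \<le> 2 * k + 1" for k
    proof -
      have "2 * (- k) \<le> ?c" "?c \<le> 2 * (k + 1)" "2 * (- k) \<le> ?d" "?d \<le> 2 * (k + 1)"
        using that by (auto simp: R_def)
      then have "real_of_int (- k) \<le> x $ 3" "x $ 3 \<le> real_of_int (k + 1)" "real_of_int (- k) \<le> x $ 4" "x $ 4 \<le> real_of_int (k + 1)"
        using lower upper by blast+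
      then show ?thesis by (auto simp: square_norm_def)
    qed
    \<comment> \<open>A lower bound on a maximum needs only one coordinate: if the midpoint is on or
      beyond one of the four walls of the square of radius \<open>k + 1 / 2\<close>, then so is the
      whole cell.\<close>
    have r_ge: "square_norm x \<ge> real_of_int k + 1 / 2" if "R \<ge> 2 * k + 1" for k
    proof -
      have "2 * k + 1 \<le> \<bar>?c - 1\<bar> \<or> 2 * k + 1 \<le> \<bar>?d - 1\<bar>"
        using that unfolding R_def by (simp only: le_max_iff_disj)
      moreover have "2 * (k + 1) \<le> c \<or> c \<le> 2 * (- k)" if "2 * k + 1 \<le> \<bar>c - 1\<bar>" for c
        using that by (auto simp: abs_if split: if_splits)
      ultimately have "2 * (k + 1) \<le> ?c \<or> ?c \<le> 2 * (- k) \<or> 2 * (k + 1) \<le> ?d \<or> ?d \<le> 2 * (- k)"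
        by metis
      then have "real_of_int (k + 1) \<le> x $ 3 \<or> x $ 3 \<le> real_of_int (- k) \<or>
        real_of_int (k + 1) \<le> x $ 4 \<or> x $ 4 \<le> real_of_int (- k)"
        by (blast intro: lower upper)
      then show ?thesis by (auto simp: square_norm_def)
    qed
    have r0: "square_norm x \<ge> 0" by (simp add: square_norm_def)
    have eq: "x $ i = real_of_int a" if "2 * v i + of_bool (i \<in> J) = 2 * a" for i a
      using lower[of a i] upper[of i a] that by simp
    have "doubled_strand ?a ?b R" using h by (simp add: half_lattice_knot_def R_def)
    then have "strand (x $ 1) (x $ 2) (square_norm x)"
      unfolding doubled_strand_def strand_def
      apply (elim disjE conjE)
      using r0 r_le[of 1] r_ge[of 1] r_le[of 0] r_ge[of 0]
        eq[of 1 "- 1"] eq[of 1 0] eq[of 1 1] eq[of 1 2] eq[of 1 3] eq[of 2 "- 1"] eq[of 2 0] eq[of 2 1] eq[of 2 2]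
        lower[of "- 1" 1] upper[of 1 1] lower[of 1 1] upper[of 1 3] lower[of 0 1] upper[of 1 2]
        lower[of 0 2] upper[of 2 2] lower[of "- 1" 2] upper[of 2 1]
      by (simp_all; fail)+
    then show "x \<in> knot" by (simp add: knot_def)
  qed
qed

lemma half_lattice_knot_bounds:
  "half_lattice_knot a b c d \<Longrightarrow> - 2 \<le> a \<and> a \<le> 6 \<and> - 2 \<le> b \<and> b \<le> 4 \<and> - 2 \<le> c \<and> c \<le> 4 \<and> - 2 \<le> d \<and> d \<le> 4"
  unfolding half_lattice_knot_def doubled_strand_def by linarith

section \<open>Enumerations over doubled midpoints\<close>

definition odd_count :: "int \<Rightarrow> int \<Rightarrow> int \<Rightarrow> int \<Rightarrow> int" where
  "odd_count a b c d = a mod 2 + b mod 2 + c mod 2 + d mod 2"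

text \<open>The number agrees with a count by edges. The 12 unit edges at radius 1/2 sweep 4 squares
  each and the 4 unit edges at radius 3/2 sweep 12 each; the two vertical segments between these
  radii give annuli of 9 - 1 = 8 squares, and the two that reach radius 0 give full 3 by 3 blocks.
  In total 48 + 48 + 16 + 18.\<close>

lemma sum_squares_computed:
  "(\<Sum>a\<leftarrow>[- 2..6]. \<Sum>b\<leftarrow>[- 2..4]. \<Sum>c\<leftarrow>[- 2..4]. \<Sum>d\<leftarrow>[- 2..4].
    if odd_count a b c d = 2 \<and> half_lattice_knot a b c d then 1 else 0) = (130 :: int)"
  by code_simp

text \<open>A cell extends in a direction exactly when its doubled midpoint is odd there; the
  midpoints of the two facets orthogonal to this direction are then the neighbours
  \<open>a - 1\<close> and \<open>a + 1\<close>.\<close>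

definition full_facets :: "int \<Rightarrow> (int \<Rightarrow> bool) \<Rightarrow> int" where
  "full_facets a f = (if a mod 2 = 1 then of_bool (f (a - 1)) + of_bool (f (a + 1)) else 0)"

text \<open>Each of the four numbers is 0, 1 or 2. In the second alternative two of them are 2 and
  the others 0: two pairs of opposite squares, which form a band.\<close>

definition three_cube_ok :: "int \<Rightarrow> int \<Rightarrow> int \<Rightarrow> int \<Rightarrow> bool" where
  "three_cube_ok a b c d \<longleftrightarrow>
    (let p = full_facets a (\<lambda>t. half_lattice_knot t b c d); q = full_facets b (\<lambda>t. half_lattice_knot a t c d);
       r = full_facets c (\<lambda>t. half_lattice_knot a b t d); s = full_facets d (\<lambda>t. half_lattice_knot a b c t)
     in p + q + r + s \<le> 3 \<or> p \<noteq> 1 \<and> q \<noteq> 1 \<and> r \<noteq> 1 \<and> s \<noteq> 1 \<and> p + q + r + s = 4)"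

lemma three_cubes_computed:
  "list_all (\<lambda>a. list_all (\<lambda>b. list_all (\<lambda>c. list_all (\<lambda>d.
    odd_count a b c d = 3 \<longrightarrow> three_cube_ok a b c d) [- 2..4]) [- 2..4]) [- 2..4]) [- 2..6]"
  by code_simp

lemma double_plus_bit_inject: "2 * v + of_bool b = 2 * w + of_bool c \<Longrightarrow> v = w \<and> b = c" for v w :: int
  by (cases b; cases c) (simp_all, presburger+)

lemma card_as_odd_count:
  fixes v :: "4 \<Rightarrow> int" and J :: "4 set"
  shows "int (card J) = odd_count (2 * v 1 + of_bool (1 \<in> J)) (2 * v 2 + of_bool (2 \<in> J))
    (2 * v 3 + of_bool (3 \<in> J)) (2 * v 4 + of_bool (4 \<in> J))"
proof -
  have "int (card J) = (\<Sum>i\<in>UNIV. of_bool (i \<in> J))"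
  proof -
    have "int (card J) = (\<Sum>i\<in>J. 1)" by simp
    also have "\<dots> = (\<Sum>i\<in>UNIV. of_bool (i \<in> J))" by (rule sum.mono_neutral_cong_left) auto
    finally show ?thesis .
  qed
  then show ?thesis by (simp add: odd_count_def sum_4)
qed

text \<open>Parity recovers the directions of a cell and integer halving its corner. Cells of all
  dimensions thus correspond to the points of the integer lattice, and counting cells becomes
  counting lattice points.\<close>

definition doubled_midpoint :: "(4 \<Rightarrow> int) \<times> 4 set \<Rightarrow> int \<times> int \<times> int \<times> int" where
  "doubled_midpoint = (\<lambda>(v, J). (2 * v 1 + of_bool (1 \<in> J), 2 * v 2 + of_bool (2 \<in> J),
     2 * v 3 + of_bool (3 \<in> J), 2 * v 4 + of_bool (4 \<in> J)))"

lemma inj_doubled_midpoint: "inj doubled_midpoint"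
proof (rule injI, clarify)
  fix v w J I assume "doubled_midpoint (v, J) = doubled_midpoint (w, I)"
  then have "v i = w i \<and> (i \<in> J) = (i \<in> I)" for i
    using exhaust_4[of i] by (auto simp: doubled_midpoint_def dest!: double_plus_bit_inject)
  then show "v = w \<and> J = I" by blast
qed

lemma surj_doubled_midpoint: "surj doubled_midpoint"
proof -
  have "\<exists>x. doubled_midpoint x = (a, b, c, d)" for a b c d
  proof -
    define n where "n i = (if i = (1::4) then a else if i = 2 then b else if i = 3 then c else d)" for i
    have "2 * (n i div 2) + of_bool (i \<in> {i. odd (n i)}) = n i" for i
      by (cases "odd (n i)") (auto elim!: oddE evenE)
    then have "doubled_midpoint (\<lambda>i. n i div 2, {i. odd (n i)}) = (n 1, n 2, n 3, n 4)"
      by (simp add: doubled_midpoint_def del: mem_Collect_eq)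
    then show ?thesis by (auto simp: n_def)
  qed
  then show ?thesis by (metis surj_def prod_cases4)
qed

definition knot_squares :: "((4 \<Rightarrow> int) \<times> 4 set) set" where
  "knot_squares = {(v, J). card J = 2 \<and> cell 1 v J \<subseteq> knot}"

lemma interval_sum: "(\<Sum>a\<in>{l..u}. f a) = (\<Sum>a\<leftarrow>[l..u]. f a)" for l u :: int and f :: "int \<Rightarrow> int"
  by (simp add: sum_list_distinct_conv_sum_set)

lemma card_knot_squares: "finite knot_squares" "card knot_squares = 130"
proof -
  let ?P = "\<lambda>(a, b, c, d). odd_count a b c d = 2 \<and> half_lattice_knot a b c d"
  let ?B = "{- 2..6::int} \<times> {- 2..4::int} \<times> {- 2..4::int} \<times> {- 2..4::int}"
  have "doubled_midpoint ` knot_squares = {x. ?P x}"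
  proof -
    have "(v, J) \<in> knot_squares \<longleftrightarrow> ?P (doubled_midpoint (v, J))" for v J
      using card_as_odd_count[of J v]
      by (auto simp: knot_squares_def doubled_midpoint_def cell_subset_knot_iff)
    then have eq: "knot_squares = doubled_midpoint -` {x. ?P x}" by auto
    show ?thesis unfolding eq by (rule surj_image_vimage_eq[OF surj_doubled_midpoint])
  qed
  also have "\<dots> = {x \<in> ?B. ?P x}"
    using half_lattice_knot_bounds by auto
  finally have img: "doubled_midpoint ` knot_squares = {x \<in> ?B. ?P x}" .
  have fin: "finite {x \<in> ?B. ?P x}" by simp
  have inj: "inj_on doubled_midpoint knot_squares" using inj_doubled_midpoint inj_on_subset by blast
  show "finite knot_squares" using img fin inj finite_imageD by metis
  have "int (card knot_squares) = int (card {x \<in> ?B. ?P x})" using card_image[OF inj] img by simp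
  also have "\<dots> = (\<Sum>x\<in>?B. if ?P x then 1 else 0)"
    by (simp add: sum.inter_filter[symmetric])
  also have "\<dots> = (\<Sum>a\<in>{- 2..6}. \<Sum>b\<in>{- 2..4}. \<Sum>c\<in>{- 2..4}. \<Sum>d\<in>{- 2..4}.
      if odd_count a b c d = 2 \<and> half_lattice_knot a b c d then 1 else 0)"
    by (simp only: sum.cartesian_product' case_prod_conv)
  also have "\<dots> = 130"
    unfolding interval_sum by (rule sum_squares_computed)
  finally show "card knot_squares = 130" by simp
qed

lemma area_knot: "area knot = 130"
proof -
  have "{S \<in> cells 1 2. S \<subseteq> knot} = (\<lambda>(v, J). cell 1 v J) ` knot_squares"
    by (auto simp: cells_eq knot_squares_def)
  moreover have "inj_on (\<lambda>(v, J). cell 1 v J) knot_squares"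
  proof (rule inj_onI, clarify)
    fix v J w I assume "cell 1 v J = cell 1 w I"
    then show "v = w \<and> J = I" by (intro cell_inject) simp_all
  qed
  ultimately show ?thesis using card_knot_squares(2) by (simp add: area_def card_image)
qed

lemma finite_cells_subset:
  assumes s: "s > 0" and b: "bounded X"
  shows "finite {S \<in> cells s k. S \<subseteq> X}"
proof -
  obtain r where r: "\<And>x. x \<in> X \<Longrightarrow> norm x \<le> r" using b bounded_iff by blast
  let ?A = "{- \<lceil>r / s\<rceil>..\<lceil>r / s\<rceil>}"
  have "{S \<in> cells s k. S \<subseteq> X} \<subseteq> (\<lambda>(v, J). cell s v J) ` ((UNIV \<rightarrow>\<^sub>E ?A) \<times> UNIV)"
  proof
    fix S assume "S \<in> {S \<in> cells s k. S \<subseteq> X}"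
    then obtain v J where S: "S = cell s v J" "S \<subseteq> X" using cells_eq[OF s] by blast
    have "(\<chi> i. s * real_of_int (v i)) \<in> S" using s by (simp add: S(1) in_cell)
    then have n: "norm (\<chi> i. s * real_of_int (v i)) \<le> r" using S(2) r by blast
    have "v i \<in> ?A" for i
    proof -
      have "\<bar>s * real_of_int (v i)\<bar> \<le> r"
        using component_le_norm_cart[of "\<chi> i. s * real_of_int (v i)" i] n by simp
      then have "\<bar>real_of_int (v i)\<bar> \<le> r / s" using s by (simp add: abs_mult field_simps)
      then show ?thesis using le_of_int_ceiling[of "r / s"] by (simp add: abs_le_iff) linarith
    qed
    then show "S \<in> (\<lambda>(v, J). cell s v J) ` ((UNIV \<rightarrow>\<^sub>E ?A) \<times> UNIV)"
      using S(1) by (intro image_eqI[of _ _ "(v, J)"]) auto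
  qed
  then show ?thesis
    by (rule finite_subset) (intro finite_imageI finite_cartesian_product finite_PiE, auto)
qed

lemma strand_bounds: "strand x y r \<Longrightarrow> - 1 \<le> x \<and> x \<le> 3 \<and> - 1 \<le> y \<and> y \<le> 2 \<and> 0 \<le> r \<and> r \<le> 3 / 2"
  unfolding strand_def by linarith

lemma bounded_knot: "bounded knot"
proof -
  have "knot \<subseteq> cbox (\<chi> i. - 3) (\<chi> i. 3)"
  proof
    fix x assume "x \<in> knot"
    then have "- 1 \<le> x $ 1" "x $ 1 \<le> 3" "- 1 \<le> x $ 2" "x $ 2 \<le> 2" "square_norm x \<le> 3 / 2"
      using strand_bounds by (auto simp: knot_def)
    moreover have "\<bar>x $ 3 - 1 / 2\<bar> \<le> 3 / 2" "\<bar>x $ 4 - 1 / 2\<bar> \<le> 3 / 2"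
      using calculation(5) unfolding square_norm_def by (simp_all only: max.bounded_iff)
    ultimately show "x \<in> cbox (\<chi> i. - 3) (\<chi> i. 3)"
      unfolding mem_box_cart forall_4 vec_lambda_beta by linarith
  qed
  then show ?thesis using bounded_cbox bounded_subset by blast
qed

text \<open>Each unit square contains \<open>m * m\<close> small squares with the same directions.
  The unit square is recovered from the corner of a small one by integer division by
  \<open>m\<close>, so none is counted twice.\<close>

lemma card_subdivided_knot:
  assumes m: "m \<ge> 1"
  shows "130 * m\<^sup>2 \<le> card {S \<in> cells (1 / real m) 2. S \<subseteq> knot}"
proof -
  have s: "1 / real m > 0" using m by simp
  \<comment> \<open>In a direction of \<open>J\<close> the half-open interval lists the
    \<open>m\<close> possible corners, leaving out the far end; in any other direction only the
    value \<open>int m * v k\<close> remains.\<close>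
  define M where "M = (\<lambda>(v, J). PiE UNIV (\<lambda>k::4. {int m * v k..<int m * v k + (if k \<in> J then int m else 1)}))"
  have cM: "card (M x) = m\<^sup>2" if x: "x \<in> knot_squares" for x
  proof -
    obtain v J where vJ: "x = (v, J)" "card J = 2" using x by (auto simp: knot_squares_def)
    have "card (M x) = (\<Prod>k\<in>UNIV. if k \<in> J then m else 1)"
      unfolding M_def vJ(1) by (auto simp: card_PiE intro!: prod.cong)
    also have "\<dots> = m ^ card J" by (simp add: prod.If_cases)
    finally show ?thesis using vJ(2) by simp
  qed
  have fM: "finite (M x)" for x by (auto simp: M_def split: prod.split intro!: finite_PiE)
  let ?f = "\<lambda>(x, w). cell (1 / real m) w (snd x)"
  have "card (Sigma knot_squares M) = 130 * m\<^sup>2"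
    using card_knot_squares fM cM by (simp add: card_SigmaI)
  moreover have "inj_on ?f (Sigma knot_squares M)"
  proof (rule inj_onI)
    fix p q assume p: "p \<in> Sigma knot_squares M" and q: "q \<in> Sigma knot_squares M" and eq: "?f p = ?f q"
    obtain v J w where pv: "p = ((v, J), w)" by (metis prod.exhaust)
    obtain v' J' w' where qv: "q = ((v', J'), w')" by (metis prod.exhaust)
    have JJ: "w = w' \<and> J = J'" using cell_inject[OF s] eq by (simp add: pv qv)
    have dv: "u k = x k div int m" if "x \<in> M (u, I)" for u x I k
    proof -
      have "int m * u k \<le> x k" "x k < int m * u k + int m"
        using that m by (auto simp: M_def PiE_iff dest!: spec[of _ k] split: if_splits)
      then have "x k div int m = u k"
        by (intro int_div_pos_eq[of "x k" "int m" "u k" "x k - int m * u k"]) auto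
      then show ?thesis by simp
    qed
    have "w \<in> M (v, J)" "w \<in> M (v', J')" using p q JJ by (simp_all add: pv qv)
    then have "v = v'" using dv by (metis ext)
    then show "p = q" using JJ by (simp add: pv qv)
  qed
  moreover have "?f ` Sigma knot_squares M \<subseteq> {S \<in> cells (1 / real m) 2. S \<subseteq> knot}"
  proof
    fix S assume "S \<in> ?f ` Sigma knot_squares M"
    then obtain v J w where S: "S = cell (1 / real m) w J" "(v, J) \<in> knot_squares" "w \<in> M (v, J)" by auto
    have "cell (1 / real m) w J \<subseteq> cell 1 v J"
    proof
      fix x assume x: "x \<in> cell (1 / real m) w J"
      have "real_of_int (v k) \<le> x $ k \<and> x $ k \<le> real_of_int (v k + of_bool (k \<in> J))" for k
      proof -
        have w: "int m * v k \<le> w k" "w k + of_bool (k \<in> J) \<le> int m * (v k + of_bool (k \<in> J))"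
        proof -
          have "w k \<in> {int m * v k..<int m * v k + (if k \<in> J then int m else 1)}"
            using S(3) by (simp add: M_def PiE_iff)
          then show "int m * v k \<le> w k" "w k + of_bool (k \<in> J) \<le> int m * (v k + of_bool (k \<in> J))"
            by (cases "k \<in> J"; simp add: distrib_left)+
        qed
        have "real m * real_of_int (v k) \<le> real_of_int (w k)"
          "real_of_int (w k + of_bool (k \<in> J)) \<le> real m * real_of_int (v k + of_bool (k \<in> J))"
          using w[folded of_int_le_iff[where ?'a = real]] by (simp_all only: of_int_mult of_int_of_nat_eq)
        moreover have "real_of_int (w k) \<le> real m * x $ k" "real m * x $ k \<le> real_of_int (w k + of_bool (k \<in> J))"
        proof -
          have "1 / real m * real_of_int (w k) \<le> x $ k" "x $ k \<le> 1 / real m * real_of_int (w k + of_bool (k \<in> J))"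
            using x unfolding in_cell by blast+
          then show "real_of_int (w k) \<le> real m * x $ k" "real m * x $ k \<le> real_of_int (w k + of_bool (k \<in> J))"
            using m by (simp_all add: field_simps)
        qed
        ultimately have "real m * real_of_int (v k) \<le> real m * x $ k" "real m * x $ k \<le> real m * real_of_int (v k + of_bool (k \<in> J))"
          by linarith+
        then show ?thesis using m by (simp del: of_int_add)
      qed
      then show "x \<in> cell 1 v J" by (simp add: in_cell)
    qed
    then show "S \<in> {S \<in> cells (1 / real m) 2. S \<subseteq> knot}"
      using S s by (auto simp: cells_eq knot_squares_def)
  qed
  ultimately show ?thesis
    using card_inj_on_le[of ?f "Sigma knot_squares M" "{S \<in> cells (1 / real m) 2. S \<subseteq> knot}"]
      finite_cells_subset[OF s bounded_knot] by simp
qed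

lemma in_skeleton2I:
  assumes "i \<noteq> j" "x $ i \<in> \<int>" "x $ j \<in> \<int>"
  shows "x \<in> skeleton2 1"
proof -
  have "x \<in> cell 1 (\<lambda>k. \<lfloor>x $ k\<rfloor>) (UNIV - {i, j})"
    using assms(2,3) by (auto simp: in_cell of_bool_def)
  moreover have "card (UNIV - {i, j}) = 2" using assms(1) by (simp add: card_Diff_subset)
  ultimately show ?thesis unfolding skeleton2_def using cells_eq[of 1 2] by auto
qed

lemma knot_subset_skeleton2: "knot \<subseteq> skeleton2 1"
proof
  fix x assume x: "x \<in> knot"
  have r: "x $ 3 \<in> \<int> \<or> x $ 4 \<in> \<int>" if "square_norm x = 1 / 2 \<or> square_norm x = 3 / 2"
  proof -
    have int: "t \<in> \<int>" if "\<bar>t - 1 / 2\<bar> = 1 / 2 \<or> \<bar>t - 1 / 2\<bar> = 3 / 2" for t :: real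
    proof -
      have "t = 0 \<or> t = 1 \<or> t = - 1 \<or> t = 2" using that by linarith
      then show ?thesis by auto
    qed
    have "square_norm x = \<bar>x $ 3 - 1 / 2\<bar> \<or> square_norm x = \<bar>x $ 4 - 1 / 2\<bar>"
      by (simp add: square_norm_def max_def)
    then show ?thesis using that int by metis
  qed
  have "x $ 1 \<in> \<int> \<and> x $ 2 \<in> \<int> \<or> (x $ 1 \<in> \<int> \<or> x $ 2 \<in> \<int>) \<and> (square_norm x = 1 / 2 \<or> square_norm x = 3 / 2)"
    using x unfolding knot_def strand_def by (elim CollectE disjE conjE) simp_all
  then show "x \<in> skeleton2 1"
    using r in_skeleton2I[of 1 2 x] in_skeleton2I[of 1 3 x] in_skeleton2I[of 1 4 x]
      in_skeleton2I[of 2 3 x] in_skeleton2I[of 2 4 x] by auto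
qed

lemma knot_not_subset_coarse_skeleton2:
  assumes k: "k > 1"
  shows "\<not> knot \<subseteq> skeleton2 (real k)"
proof
  assume sub: "knot \<subseteq> skeleton2 (real k)"
  \<comment> \<open>All coordinates of this point are 1 or -1, hence not divisible by
    \<open>k > 1\<close>, whereas a point of a 2-cell of side \<open>k\<close> has two coordinates
    that are multiples of \<open>k\<close>.\<close>
  let ?p = "vector [1, - 1, 1, 1] :: real^4"
  have "?p \<in> knot" by (simp add: knot_def strand_def square_norm_def)
  then obtain v J where p: "?p \<in> cell (real k) v J" "card J = 2"
    using sub k by (auto simp: skeleton2_def cells_eq)
  have "J \<noteq> UNIV" using p(2) by auto
  then obtain i where i: "i \<notin> J" by auto
  have "?p $ i = real k * real_of_int (v i)"
    using p(1) i by (auto simp: in_cell intro!: antisym dest!: spec[of _ i])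
  moreover have "?p $ i = 1 \<or> ?p $ i = - 1" using exhaust_4[of i] by auto
  ultimately have "real_of_int (int k * v i) = 1 \<or> real_of_int (int k * v i) = - 1" by auto
  then have "int k * v i = 1 \<or> int k * v i = - 1" by linarith
  then have "int k dvd 1" by (metis dvd_triv_left dvd_minus_iff)
  then show False using k by simp
qed

section \<open>Face boundary moves\<close>

definition open_cell :: "real \<Rightarrow> (4 \<Rightarrow> int) \<Rightarrow> 4 set \<Rightarrow> (real^4) set" where
  "open_cell s v J = {x. \<forall>i. if i \<in> J then s * real_of_int (v i) < x $ i \<and> x $ i < s * real_of_int (v i + 1)
     else x $ i = s * real_of_int (v i)}"

lemma open_cell_subset: "open_cell s v J \<subseteq> cell s v J"
proof
  fix x assume x: "x \<in> open_cell s v J"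
  show "x \<in> cell s v J"
    unfolding in_cell
  proof
    fix i show "s * real_of_int (v i) \<le> x $ i \<and> x $ i \<le> s * real_of_int (v i + of_bool (i \<in> J))"
      using x by (cases "i \<in> J") (auto simp: open_cell_def dest!: spec[of _ i])
  qed
qed

text \<open>An open lattice interval meets just one closed one, and no single lattice point, which
  forces \<open>J \<subseteq> I\<close>. Equal cardinality leaves no further direction, and the
  remaining coordinates are fixed in both cells.\<close>

lemma open_cell_meets_cell:
  assumes s: "s > 0" and x: "x \<in> open_cell s v J" "x \<in> cell s w I" and card: "card I = card J"
  shows "w = v \<and> I = J"
proof -
  have m: "s * real_of_int a < s * real_of_int b \<longleftrightarrow> a < b" "s * real_of_int a \<le> s * real_of_int b \<longleftrightarrow> a \<le> b" for a b
    using s by simp_all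
  have J: "w i = v i \<and> i \<in> I" if "i \<in> J" for i
  proof -
    have a: "s * real_of_int (v i) < x $ i" "x $ i < s * real_of_int (v i + 1)"
      using x(1) that by (auto simp: open_cell_def dest!: spec[of _ i])
    have b: "s * real_of_int (w i) \<le> x $ i" "x $ i \<le> s * real_of_int (w i + of_bool (i \<in> I))"
      using x(2) unfolding in_cell by blast+
    have "v i < w i + of_bool (i \<in> I)" "w i < v i + 1"
      using m(1) a b by (meson le_less_trans less_le_trans)+
    then show ?thesis by (cases "i \<in> I") auto
  qed
  then have "J \<subseteq> I" by blast
  then have IJ: "I = J" using card by (metis card_subset_eq finite_class.finite)
  have "w i = v i" if "i \<notin> J" for i
  proof -
    have "x $ i = s * real_of_int (v i)" using x(1) that by (auto simp: open_cell_def dest!: spec[of _ i])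
    moreover have "s * real_of_int (w i) \<le> x $ i" "x $ i \<le> s * real_of_int (w i + of_bool (i \<in> I))"
      using x(2) unfolding in_cell by blast+
    ultimately show ?thesis using m(2) that IJ by simp
  qed
  then show ?thesis using J IJ by blast
qed

lemma cell_subset_closure_open_cell:
  assumes s: "s > 0" shows "cell s v J \<subseteq> closure (open_cell s v J)"
proof
  fix x assume x: "x \<in> cell s v J"
  define c :: "real^4" where "c = (\<chi> i. s * (real_of_int (v i) + of_bool (i \<in> J) / 2))"
  have oc: "x + t *\<^sub>R (c - x) \<in> open_cell s v J" if t: "0 < t" "t < 1" for t
    unfolding open_cell_def mem_Collect_eq
  proof
    fix i
    have eq: "(x + t *\<^sub>R (c - x)) $ i = (1 - t) * x $ i + t * c $ i" by (simp add: algebra_simps)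
    have xi: "s * real_of_int (v i) \<le> x $ i" "x $ i \<le> s * real_of_int (v i + of_bool (i \<in> J))"
      using x unfolding in_cell by blast+
    show "if i \<in> J then s * real_of_int (v i) < (x + t *\<^sub>R (c - x)) $ i \<and> (x + t *\<^sub>R (c - x)) $ i < s * real_of_int (v i + 1)
      else (x + t *\<^sub>R (c - x)) $ i = s * real_of_int (v i)"
    proof (cases "i \<in> J")
      case True
      have "(1 - t) * (s * real_of_int (v i)) + t * (s * real_of_int (v i)) < (1 - t) * x $ i + t * c $ i"
        using t xi True s by (intro add_le_less_mono mult_left_mono mult_strict_left_mono) (auto simp: c_def)
      moreover have "(1 - t) * x $ i + t * c $ i < (1 - t) * (s * real_of_int (v i + 1)) + t * (s * real_of_int (v i + 1))"
        using t xi True s by (intro add_le_less_mono mult_left_mono mult_strict_left_mono) (auto simp: c_def)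
      ultimately show ?thesis using True unfolding eq by (simp add: algebra_simps)
    next
      case False
      then show ?thesis using xi unfolding eq by (simp add: c_def algebra_simps)
    qed
  qed
  have "((\<lambda>t. x + t *\<^sub>R (c - x)) \<longlongrightarrow> x + 0 *\<^sub>R (c - x)) (at_right 0)"
    by (intro tendsto_intros)
  then have lim: "((\<lambda>t. x + t *\<^sub>R (c - x)) \<longlongrightarrow> x) (at_right 0)" by simp
  have "\<forall>\<^sub>F t in at_right 0. (0::real) < t" by (rule eventually_at_right_less)
  moreover have "\<forall>\<^sub>F t in at_right 0. t < (1::real)"
    by (rule order_tendstoD(2)[OF tendsto_ident_at]) simp
  ultimately have "\<forall>\<^sub>F t in at_right (0::real). x + t *\<^sub>R (c - x) \<in> closure (open_cell s v J)"
    by eventually_elim (use oc closure_subset in blast)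
  then show "x \<in> closure (open_cell s v J)"
    by (rule Lim_in_closed_set[OF closed_closure _ trivial_limit_at_right_real lim])
qed

text \<open>This keeps squares of the knot outside \<open>A\<close> from meeting the interior of \<open>A\<close>, which a
  face boundary move deletes. The proof is invariance of domain in the punctured sphere.\<close>

lemma open_disc_in_two_knot:
  fixes K :: "(real^4) set"
  assumes K: "two_knot K" and F: "convex F" "bounded F" "aff_dim F = 3"
    and D: "openin (top_of_set (rel_frontier F)) D" "D \<subseteq> K" and y: "y \<in> K - D" and x: "x \<in> D"
  obtains U where "open U" "x \<in> U" "U \<inter> K \<subseteq> D"
proof -
  obtain \<phi> \<phi>' where \<phi>: "homeomorphism K (sphere (0::real^3) 1) \<phi> \<phi>'"
    using K by (auto simp: two_knot_def homeomorphic_def)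
  define T where "T = {z :: real^3. axis 1 1 \<bullet> z = 0}"
  have T: "affine T" "aff_dim T < aff_dim F"
    unfolding T_def F(3) by (simp_all add: affine_hyperplane aff_dim_hyperplane)
  have "\<phi> y \<in> sphere 0 1" using \<phi> y homeomorphism_image1 by blast
  then have "sphere (0::real^3) 1 - {\<phi> y} homeomorphic T"
    unfolding T_def by (intro homeomorphic_punctured_sphere_hyperplane) auto
  then obtain \<sigma> \<sigma>' where \<sigma>: "homeomorphism (sphere (0::real^3) 1 - {\<phi> y}) T \<sigma> \<sigma>'"
    by (auto simp: homeomorphic_def)
  let ?K = "K - {y}"
  have inj\<phi>: "inj_on \<phi> K" using \<phi> by (metis homeomorphism_apply1 inj_on_inverseI)
  have im: "\<phi> ` ?K = sphere 0 1 - {\<phi> y}"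
  proof -
    have "\<phi> ` ?K = \<phi> ` K - \<phi> ` {y}" by (rule inj_on_image_set_diff[OF inj\<phi>]) (use y in auto)
    then show ?thesis using homeomorphism_image1[OF \<phi>] by simp
  qed
  have cont: "continuous_on ?K (\<sigma> \<circ> \<phi>)"
    using \<phi> \<sigma> im by (intro continuous_on_compose) (auto simp: homeomorphism_def intro: continuous_on_subset)
  have inj: "inj_on (\<sigma> \<circ> \<phi>) ?K"
  proof (rule comp_inj_on)
    show "inj_on \<phi> ?K" using inj\<phi> inj_on_subset by blast
    show "inj_on \<sigma> (\<phi> ` ?K)" unfolding im by (rule inj_on_inverseI[of _ \<sigma>']) (rule homeomorphism_apply1[OF \<sigma>])
  qed
  have DK: "D \<subseteq> ?K" using D(2) y by blast
  have imT: "(\<sigma> \<circ> \<phi>) ` ?K = T" unfolding image_comp[symmetric] im by (rule homeomorphism_image1[OF \<sigma>])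
  \<comment> \<open>Since \<open>y\<close> lies outside \<open>D\<close>, all of \<open>D\<close>
    survives the puncture and is embedded in the plane \<open>T\<close>. Its dimension does not
    exceed that of the sphere \<open>rel_frontier F\<close>, so the image is open, and pulling it
    back makes \<open>D\<close> relatively open in the punctured knot.\<close>
  have "openin (top_of_set T) ((\<sigma> \<circ> \<phi>) ` D)"
  proof (rule invariance_of_domain_sphere_affine_set_gen[OF _ _ _ F(2) F(1) T D(1)])
    show "continuous_on D (\<sigma> \<circ> \<phi>)" using cont DK by (rule continuous_on_subset)
    show "inj_on (\<sigma> \<circ> \<phi>) D" using inj DK by (rule inj_on_subset)
    show "\<sigma> \<circ> \<phi> \<in> D \<rightarrow> T" using imT DK by blast
  qed
  then have "openin (top_of_set ?K) (?K \<inter> (\<sigma> \<circ> \<phi>) -` ((\<sigma> \<circ> \<phi>) ` D))"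
    using imT by (intro continuous_openin_preimage[OF cont]) auto
  moreover have "?K \<inter> (\<sigma> \<circ> \<phi>) -` ((\<sigma> \<circ> \<phi>) ` D) = D"
    using inj_onD[OF inj] DK by blast
  ultimately obtain U where U: "open U" "D = ?K \<inter> U" by (auto simp: openin_open)
  show ?thesis
  proof (rule that[of "U - {y}"])
    show "open (U - {y})" using U(1) by (simp add: open_delete)
    show "x \<in> U - {y}" using x U(2) by blast
    show "(U - {y}) \<inter> K \<subseteq> D" using U(2) by blast
  qed
qed

section \<open>Facets of a 3-cube and the effect of a move on the number of squares\<close>

definition facet :: "real \<Rightarrow> (4 \<Rightarrow> int) \<Rightarrow> 4 set \<Rightarrow> 4 \<times> bool \<Rightarrow> (real^4) set" where
  "facet s w J = (\<lambda>(i, b). cell s (w(i := w i + of_bool b)) (J - {i}))"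

lemma facet_inj:
  assumes s: "s > 0" shows "inj_on (facet s w J) (J \<times> UNIV)"
proof (rule inj_onI, clarify)
  fix i b j c assume ij: "i \<in> J" "j \<in> J" and eq: "facet s w J (i, b) = facet s w J (j, c)"
  have "w(i := w i + of_bool b) = w(j := w j + of_bool c) \<and> J - {i} = J - {j}"
    using eq unfolding facet_def prod.case by (rule cell_inject[OF s])
  then have "i = j" and e: "w(i := w i + of_bool b) = w(j := w j + of_bool c)" using ij by blast+
  have "of_bool b = (of_bool c :: int)" using fun_cong[OF e, of i] \<open>i = j\<close> by simp
  then show "i = j \<and> b = c" using \<open>i = j\<close> by (cases b; cases c) auto
qed

lemma facet_cells:
  assumes "s > 0" "card J = 3" "i \<in> J"
  shows "facet s w J (i, b) \<in> cells s 2" "facet s w J (i, b) \<subseteq> rel_frontier (cell s w J)"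
proof -
  have c: "card (J - {i}) = 2" using assms by simp
  then show "facet s w J (i, b) \<in> cells s 2" using cells_eq[OF assms(1)] by (auto simp: facet_def)
  have "facet s w J (i, b) face_of cell s w J"
    unfolding facet_def prod.case using assms(3) by (intro cell_face[OF assms(1)]) (cases b; auto)
  moreover have "facet s w J (i, b) \<noteq> cell s w J"
  proof
    assume "facet s w J (i, b) = cell s w J"
    then have "J - {i} = J" unfolding facet_def prod.case using cell_inject[OF assms(1)] by blast
    then show False using assms(3) by blast
  qed
  ultimately show "facet s w J (i, b) \<subseteq> rel_frontier (cell s w J)"
    by (rule face_of_subset_rel_frontier)
qed

lemma square_subset_three_cell:
  assumes s: "s > 0" and J: "card J = 3" and S: "S \<in> cells s 2" "S \<subseteq> cell s w J"
  obtains i b where "i \<in> J" "S = facet s w J (i, b)"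
proof -
  obtain v I where vI: "S = cell s v I" "card I = 2" using S(1) cells_eq[OF s] by blast
  have sub: "w i \<le> v i \<and> v i + of_bool (i \<in> I) \<le> w i + of_bool (i \<in> J)" for i
    using S(2) unfolding vI(1) cell_subset_iff[OF s] by blast
  have "I \<subseteq> J"
  proof
    fix i assume "i \<in> I" then show "i \<in> J" using sub[of i] by (cases "i \<in> J") auto
  qed
  then have "card (J - I) = 1" using vI(2) J by (simp add: card_Diff_subset)
  then obtain i where i: "J - I = {i}" using card_1_singletonE by blast
  then have I: "I = J - {i}" "i \<in> J" using \<open>I \<subseteq> J\<close> by blast+
  define b where "b = (v i \<noteq> w i)"
  have "v = w(i := w i + of_bool b)"
  proof
    fix k show "v k = (w(i := w i + of_bool b)) k"
      using sub[of k] I by (cases "k = i"; cases "k \<in> J") (auto simp: b_def)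
  qed
  then show ?thesis using that[of i b] I vI(1) by (simp add: facet_def)
qed

text \<open>The new set keeps the squares of \<open>K\<close> outside \<open>A\<close> and gains the
  facets of the cube outside \<open>A\<close>, at least \<open>6 - p \<ge> p\<close> of them. The
  gained ones are distinct from the kept ones, because a facet contained in \<open>K\<close> lies in
  \<open>Q\<close> and hence in \<open>A\<close>.\<close>

lemma face_boundary_move_squares:
  assumes K: "two_knot K" "bounded K" and s: "s > 0"
    and Q: "Q \<in> cubulation s" "F face_of Q" "aff_dim F = 3"
    and A: "A = K \<inter> Q" "A = \<Union>\<S>" "\<S> \<subseteq> cells s 2" "A \<subseteq> rel_frontier F"
    and p: "card {S \<in> cells s 2. S \<subseteq> A} \<le> 3"
  shows "card {S \<in> cells s 2. S \<subseteq> K} \<le> card {S \<in> cells s 2. S \<subseteq> (K - A) \<union> closure (rel_frontier F - A)}"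
proof -
  have "F \<in> cells s 3" using Q by (auto simp: cells_def)
  then obtain w J where F: "F = cell s w J" "card J = 3" using cells_eq[OF s] by blast
  define B where "B = closure (rel_frontier F - A)"
  have fsub: "rel_frontier F \<subseteq> F"
    using closure_closed[of F] by (auto simp: rel_frontier_def F(1) cell_eq_cbox)
  \<comment> \<open>As \<open>A\<close> is a union of squares, a single point of \<open>A\<close> in
    the open part of a square would put the whole square into \<open>A\<close>.\<close>
  have disj: "open_cell s v I \<inter> A = {}" if S: "card I = 2" "\<not> cell s v I \<subseteq> A" for v I
  proof (rule ccontr)
    assume "open_cell s v I \<inter> A \<noteq> {}"
    then obtain x S where x: "x \<in> open_cell s v I" "x \<in> S" "S \<in> \<S>" using A(2) by blast
    then obtain v' I' where S': "S = cell s v' I'" "card I' = 2" using A(3) cells_eq[OF s] by blast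
    then have "v' = v \<and> I' = I" using open_cell_meets_cell[OF s x(1)] x(2) S(1) by simp
    then show False using S' x(3) A(2) S(2) by blast
  qed
  let ?X = "{S \<in> cells s 2. S \<subseteq> K \<and> \<not> S \<subseteq> A}" and ?Fc = "facet s w J ` (J \<times> UNIV)"
  let ?Y = "{S \<in> ?Fc. \<not> S \<subseteq> A}" and ?P = "{S \<in> cells s 2. S \<subseteq> A}"
  have X: "S \<subseteq> (K - A) \<union> B" if "S \<in> ?X" for S
  proof
    fix x assume x: "x \<in> S"
    have SX: "S \<in> cells s 2" "S \<subseteq> K" "\<not> S \<subseteq> A" using that by auto
    then obtain v I where vI: "S = cell s v I" "card I = 2" unfolding cells_eq[OF s] by blast
    note S = vI SX(2,3)
    show "x \<in> (K - A) \<union> B"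
    proof (rule ccontr)
      assume "x \<notin> (K - A) \<union> B"
      then have xA: "x \<in> A" "x \<notin> B" using x S(3) by blast+
      \<comment> \<open>The interior of \<open>A\<close> relative to the boundary of the cube, that
        is, the points not restored by \<open>B\<close>. If a kept square had a point in
        \<open>D\<close>, the knot would lie in \<open>D\<close> near that point, although the open
        part of the square avoids \<open>A\<close> and accumulates there.\<close>
      define D where "D = rel_frontier F - B"
      have DA: "D \<subseteq> A" unfolding D_def B_def using closure_subset[of "rel_frontier F - A"] by blast
      have D: "openin (top_of_set (rel_frontier F)) D"
      proof -
        have "D = rel_frontier F \<inter> (- B)" by (auto simp: D_def)
        then show ?thesis unfolding B_def by (simp add: openin_open_Int open_Compl)
      qed
      obtain y where "y \<in> S" "y \<notin> A" using S(4) by blast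
      then have y: "y \<in> K - D" using DA S(3) by blast
      have x': "x \<in> D" using xA A(4) by (auto simp: D_def)
      have DK: "D \<subseteq> K" using DA A(1) by blast
      have F': "convex F" "bounded F" unfolding F(1) by (rule convex_cell, rule bounded_cell)
      obtain U where U: "open U" "x \<in> U" "U \<inter> K \<subseteq> D"
        by (rule open_disc_in_two_knot[OF K(1) F' Q(3) D DK y x'])
      have "x \<in> closure (open_cell s v I)" using cell_subset_closure_open_cell[OF s, of v I] x S(1) by blast
      then obtain z where "z \<in> open_cell s v I" "z \<in> U" using U(1,2) unfolding closure_iff_nhds_not_empty by blast
      then have "z \<in> open_cell s v I \<inter> A" using U(3) DA open_cell_subset[of s v I] S(1,3) by blast
      then show False using disj[OF S(2)] S(1,4) by blast
    qed
  qed
  have Fc: "S \<in> cells s 2 \<and> S \<subseteq> rel_frontier F" if S: "S \<in> ?Fc" for S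
  proof -
    obtain i b where "i \<in> J" "S = facet s w J (i, b)" using S by auto
    then show ?thesis using facet_cells[OF s F(2), of i w b] F(1) by simp
  qed
  have Y: "S \<subseteq> B \<and> S \<in> cells s 2" if "S \<in> ?Y" for S
  proof -
    have S: "S \<in> cells s 2" "S \<subseteq> rel_frontier F" "\<not> S \<subseteq> A"
      using that Fc by blast+
    then obtain v I where vI: "S = cell s v I" "card I = 2" unfolding cells_eq[OF s] by blast
    have "open_cell s v I \<subseteq> rel_frontier F - A"
      using disj[OF vI(2)] S vI(1) open_cell_subset[of s v I] by blast
    then have "closure (open_cell s v I) \<subseteq> B" unfolding B_def by (rule closure_mono)
    then show ?thesis using cell_subset_closure_open_cell[OF s, of v I] S vI(1) by blast
  qed
  have bF: "bounded B"
    unfolding B_def by (rule bounded_closure, rule bounded_subset[of F]) (use fsub bounded_cell F(1) in auto)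
  have "bounded ((K - A) \<union> B)" using bounded_subset[OF K(2), of "K - A"] bF by auto
  then have fin: "finite {S \<in> cells s 2. S \<subseteq> K}" "finite {S \<in> cells s 2. S \<subseteq> (K - A) \<union> B}"
    using finite_cells_subset[OF s K(2), of 2] finite_cells_subset[OF s, of "(K - A) \<union> B" 2] by blast+
  have fX: "finite ?X" and fP: "finite ?P"
    using fin(1) A(1) by (auto elim: rev_finite_subset)
  have fFc: "finite ?Fc" by simp
  have cFc: "card ?Fc = 6" using card_image[OF facet_inj[OF s]] F(2) by (simp add: card_cartesian_product)
  have "{S \<in> cells s 2. S \<subseteq> K} = ?X \<union> ?P" "?X \<inter> ?P = {}" using A(1) by auto
  then have NK: "card {S \<in> cells s 2. S \<subseteq> K} = card ?X + card ?P"
    using card_Un_disjoint[OF fX fP] by simp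
  have "?Fc \<subseteq> ?Y \<union> ?P" using Fc by blast
  then have "6 \<le> card ?Y + card ?P"
    using card_mono[of "?Y \<union> ?P" ?Fc] card_Un_le[of ?Y ?P] fFc fP cFc by simp
  then have Y3: "card ?Y \<ge> card ?P" using p by linarith
  have XY: "?X \<inter> ?Y = {}"
  proof -
    have "S \<subseteq> A" if "S \<in> ?Y" "S \<subseteq> K" for S
    proof -
      have "S \<subseteq> rel_frontier F" using that(1) Fc by blast
      then have "S \<subseteq> Q" using fsub face_of_imp_subset[OF Q(2)] by blast
      then show ?thesis using that(2) A(1) by blast
    qed
    then show ?thesis by blast
  qed
  have "card ?X + card ?Y = card (?X \<union> ?Y)" using card_Un_disjoint[OF fX _ XY] fFc by simp
  also have "\<dots> \<le> card {S \<in> cells s 2. S \<subseteq> (K - A) \<union> B}"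
    using X Y by (intro card_mono[OF fin(2)]) blast
  finally show ?thesis using NK Y3 unfolding B_def by linarith
qed

lemma facets_in_subset:
  assumes s: "s > 0" and J: "card J = 3" and A: "A \<subseteq> cell s w J"
  shows "{S \<in> cells s 2. S \<subseteq> A} = facet s w J ` {x \<in> J \<times> UNIV. facet s w J x \<subseteq> A}"
proof
  show "{S \<in> cells s 2. S \<subseteq> A} \<subseteq> facet s w J ` {x \<in> J \<times> UNIV. facet s w J x \<subseteq> A}"
  proof
    fix S assume S: "S \<in> {S \<in> cells s 2. S \<subseteq> A}"
    then have "S \<in> cells s 2" "S \<subseteq> cell s w J" using A by auto
    then obtain i b where "i \<in> J" "S = facet s w J (i, b)" by (rule square_subset_three_cell[OF s J])
    then show "S \<in> facet s w J ` {x \<in> J \<times> UNIV. facet s w J x \<subseteq> A}" using S by blast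
  qed
  show "facet s w J ` {x \<in> J \<times> UNIV. facet s w J x \<subseteq> A} \<subseteq> {S \<in> cells s 2. S \<subseteq> A}"
    using facet_cells(1)[OF s J] by auto
qed

lemma card_facets_in_subset:
  assumes s: "s > 0" and J: "card J = 3" and A: "A \<subseteq> cell s w J"
  shows "card {S \<in> cells s 2. S \<subseteq> A} = card {x \<in> J \<times> UNIV. facet s w J x \<subseteq> A}"
proof -
  have "inj_on (facet s w J) {x \<in> J \<times> UNIV. facet s w J x \<subseteq> A}"
    using facet_inj[OF s] by (rule inj_on_subset) auto
  then show ?thesis unfolding facets_in_subset[OF assms] by (rule card_image)
qed

text \<open>At the midpoint of a small square the coordinates along the square are odd multiples of
  \<open>1 / (2 * m)\<close> and so never integers. If the square lies in the coarse 2-skeleton,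
  integrality must come from the other two coordinates, in particular from coordinate
  \<open>i\<close>. For opposite squares this gives two integers at distance
  \<open>1 / m < 1\<close>.\<close>

lemma opposite_facets_fine:
  assumes m: "m \<ge> 2" and J: "card J = 3" "i \<in> J"
    and sub: "facet (1 / real m) w J (i, False) \<subseteq> skeleton2 1" "facet (1 / real m) w J (i, True) \<subseteq> skeleton2 1"
  shows False
proof -
  define s where "s = 1 / real m"
  have s: "s > 0" "s < 1" using m by (simp_all add: s_def)
  have int: "s * (real_of_int (w i) + of_bool b) \<in> \<int>" for b
  proof -
    define x :: "real^4" where "x = (\<chi> k. s * (real_of_int (w k) + (if k = i then of_bool b else if k \<in> J then 1 / 2 else 0)))"
    have "x \<in> facet s w J (i, b)"
      using s by (auto simp: facet_def in_cell x_def)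
    then have "x \<in> skeleton2 1" using sub by (cases b) (auto simp: s_def)
    then obtain v I where I: "card I = 2" "x \<in> cell 1 v I" by (auto simp: skeleton2_def cells_eq)
    have xI: "x $ k = real_of_int (v k)" if "k \<notin> I" for k
      using I(2) that by (auto simp: in_cell intro!: antisym dest!: spec[of _ k])
    have "k \<in> I" if k: "k \<in> J - {i}" for k
    proof (rule ccontr)
      assume "k \<notin> I"
      then have "s * (real_of_int (w k) + 1 / 2) = real_of_int (v k)" using xI[of k] k by (simp add: x_def)
      then have "2 * real_of_int (w k) + 1 = 2 * (real m * real_of_int (v k))"
        using m by (simp add: s_def field_simps)
      then have "real_of_int (2 * w k + 1) = real_of_int (2 * (int m * v k))" by simp
      then have "2 * w k + 1 = 2 * (int m * v k)" by (simp only: of_int_eq_iff)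
      then show False by presburger
    qed
    then have "J - {i} \<subseteq> I" by blast
    moreover have "card (J - {i}) = card I" using J I(1) by simp
    ultimately have "J - {i} = I" by (intro card_subset_eq) auto
    then have "x $ i \<in> \<int>" using xI[of i] by auto
    then show ?thesis by (simp add: x_def)
  qed
  have "s \<in> \<int>" using Ints_diff[OF int[of True] int[of False]] by (simp add: algebra_simps)
  then obtain z where "s = real_of_int z" by (rule Ints_cases)
  then show False using s by simp
qed

text \<open>Each of the three directions of the cube contributes at most one of its two opposite
  facets.\<close>

lemma card_facets_fine:
  assumes m: "m \<ge> 2" and J: "card J = 3" and K: "K \<subseteq> skeleton2 1"
  shows "card {x \<in> J \<times> UNIV. facet (1 / real m) w J x \<subseteq> K} \<le> 3"
proof -
  let ?P = "{x \<in> J \<times> UNIV. facet (1 / real m) w J x \<subseteq> K}"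
  have "inj_on fst ?P"
  proof (rule inj_onI)
    fix x y assume xy: "x \<in> ?P" "y \<in> ?P" "fst x = fst y"
    obtain i b where x: "x = (i, b)" by fastforce
    obtain c where y: "y = (i, c)" using xy(3) x by (metis fst_conv prod.exhaust)
    have "b = c"
    proof (rule ccontr)
      assume "b \<noteq> c"
      then have "facet (1 / real m) w J (i, False) \<subseteq> K" "facet (1 / real m) w J (i, True) \<subseteq> K" "i \<in> J"
        using xy(1,2) x y by (cases b; cases c; simp)+
      then show False using opposite_facets_fine[OF m J] K by blast
    qed
    then show "x = y" using x y by simp
  qed
  then have "card ?P = card (fst ` ?P)" by (simp add: card_image)
  also have "\<dots> \<le> card J" by (intro card_mono) auto
  finally show ?thesis using J by simp
qed

section \<open>Cubes of the canonical cubulation that meet the knot in a band\<close>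

definition facet_count :: "(4 \<Rightarrow> int) \<Rightarrow> 4 set \<Rightarrow> 4 \<Rightarrow> int" where
  "facet_count w J i = (if i \<in> J then of_bool (facet 1 w J (i, False) \<subseteq> knot) + of_bool (facet 1 w J (i, True) \<subseteq> knot) else 0)"

lemma facet_count_full_facets:
  fixes w :: "4 \<Rightarrow> int" and J :: "4 set"
  defines "n \<equiv> \<lambda>i. 2 * w i + of_bool (i \<in> J)"
  shows "facet_count w J 1 = full_facets (n 1) (\<lambda>t. half_lattice_knot t (n 2) (n 3) (n 4))"
    and "facet_count w J 2 = full_facets (n 2) (\<lambda>t. half_lattice_knot (n 1) t (n 3) (n 4))"
    and "facet_count w J 3 = full_facets (n 3) (\<lambda>t. half_lattice_knot (n 1) (n 2) t (n 4))"
    and "facet_count w J 4 = full_facets (n 4) (\<lambda>t. half_lattice_knot (n 1) (n 2) (n 3) t)"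
  unfolding facet_count_def full_facets_def facet_def prod.case cell_subset_knot_iff n_def
  by (auto simp: algebra_simps)

lemma three_cubes_ok:
  assumes "odd_count a b c d = 3" "- 2 \<le> a" "a \<le> 6" "- 2 \<le> b" "b \<le> 4" "- 2 \<le> c" "c \<le> 4" "- 2 \<le> d" "d \<le> 4"
  shows "three_cube_ok a b c d"
  using three_cubes_computed assms unfolding list_all_iff set_upto by (simp only: atLeastAtMost_iff)

text \<open>If no direction has both facets in the knot, the three directions contribute at most 1
  each. Otherwise two opposite neighbours of the midpoint satisfy \<open>half_lattice_knot\<close>;
  its bounds confine the cube to the enumerated box.\<close>

lemma facet_count_cases:
  assumes J: "card J = 3"
  shows "(\<Sum>i\<in>UNIV. facet_count w J i) \<le> 3 \<or> (\<forall>i. facet_count w J i \<noteq> 1) \<and> (\<Sum>i\<in>UNIV. facet_count w J i) = 4"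
proof (cases "\<exists>i. facet_count w J i = 2")
  case False
  have "facet_count w J i \<le> of_bool (i \<in> J)" for i
  proof -
    have "facet_count w J i \<noteq> 2" using False by blast
    then show ?thesis by (auto simp: facet_count_def of_bool_def split: if_splits)
  qed
  then have "(\<Sum>i\<in>UNIV. facet_count w J i) \<le> (\<Sum>i\<in>UNIV. of_bool (i \<in> J))" by (rule sum_mono)
  also have "\<dots> = (\<Sum>i\<in>J. 1)" by (rule sum.mono_neutral_cong_right) auto
  finally show ?thesis using J by simp
next
  case True
  define n where "n i = 2 * w i + of_bool (i \<in> J)" for i
  note counts = facet_count_full_facets[of w J, folded n_def]
  obtain i where i: "facet_count w J i = 2" using True by blast
  have two: "f (a - 1) \<and> f (a + 1)" if "full_facets a f = 2" for a f
    using that by (auto simp: full_facets_def of_bool_def split: if_splits)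
  have "- 2 \<le> n 1 \<and> n 1 \<le> 6 \<and> - 2 \<le> n 2 \<and> n 2 \<le> 4 \<and> - 2 \<le> n 3 \<and> n 3 \<le> 4 \<and> - 2 \<le> n 4 \<and> n 4 \<le> 4"
    using i exhaust_4[of i] by (auto simp: counts dest!: two half_lattice_knot_bounds)
  then have "three_cube_ok (n 1) (n 2) (n 3) (n 4)"
    using card_as_odd_count[of J w] J unfolding n_def[symmetric] by (intro three_cubes_ok) auto
  then show ?thesis
    unfolding three_cube_ok_def Let_def counts[symmetric] sum_4 forall_4 by linarith
qed

lemma card_knot_facets:
  fixes J :: "4 set"
  shows "int (card {x \<in> J \<times> UNIV. facet 1 w J x \<subseteq> knot}) = (\<Sum>i\<in>UNIV. facet_count w J i)"
proof -
  let ?Q = "\<lambda>x. facet 1 w J x \<subseteq> knot"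
  have "int (card {x \<in> J \<times> (UNIV :: bool set). ?Q x}) = (\<Sum>x\<in>J \<times> UNIV. if ?Q x then 1 else 0)"
    by (simp add: sum.inter_filter[symmetric])
  also have "\<dots> = (\<Sum>i\<in>J. \<Sum>b\<in>UNIV. if ?Q (i, b) then 1 else 0)"
    by (rule sum.cartesian_product')
  also have "\<dots> = (\<Sum>i\<in>J. facet_count w J i)"
    by (intro sum.cong) (auto simp: facet_count_def UNIV_bool)
  also have "\<dots> = (\<Sum>i\<in>UNIV. facet_count w J i)"
    by (rule sum.mono_neutral_left) (auto simp: facet_count_def)
  finally show ?thesis .
qed

text \<open>The identity of the circle factors through the band, so a contraction of the band would
  contract the circle.\<close>

lemma band_not_contractible:
  fixes w :: "4 \<Rightarrow> int"
  assumes ij: "i \<in> J" "j \<in> J" "i \<noteq> j"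
  shows "\<not> contractible (facet 1 w J (i, False) \<union> facet 1 w J (i, True) \<union> (facet 1 w J (j, False) \<union> facet 1 w J (j, True)))"
    (is "\<not> contractible ?A")
proof
  assume A: "contractible ?A"
  \<comment> \<open>Projection to the plane of the directions \<open>i\<close> and \<open>j\<close>,
    centred at the cube. On the band one of the two coordinates is 1/2 or -1/2, so the origin is
    avoided and normalising by \<open>sgn\<close> is continuous.\<close>
  define q where "q x = Complex (x $ i - real_of_int (w i) - 1 / 2) (x $ j - real_of_int (w j) - 1 / 2)" for x :: "real^4"
  have side: "\<bar>x $ k - real_of_int (w k) - 1 / 2\<bar> = 1 / 2" if "x \<in> facet 1 w J (k, b)" "k \<in> J" for x k b
  proof -
    have "real_of_int (w k) + of_bool b \<le> x $ k" "x $ k \<le> real_of_int (w k) + of_bool b"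
      using that by (auto simp: facet_def in_cell dest!: spec[of _ k])
    then show ?thesis by (cases b) auto
  qed
  have q0: "q x \<noteq> 0" if "x \<in> ?A" for x
  proof -
    have "\<bar>x $ i - real_of_int (w i) - 1 / 2\<bar> = 1 / 2 \<or> \<bar>x $ j - real_of_int (w j) - 1 / 2\<bar> = 1 / 2"
      using that side ij by blast
    then show ?thesis by (auto simp: q_def complex_eq_iff)
  qed
  define M where "M \<zeta> = 2 * max \<bar>Re \<zeta>\<bar> \<bar>Im \<zeta>\<bar>" for \<zeta>
  have M: "M \<zeta> > 0" if "\<zeta> \<in> sphere 0 1" for \<zeta>
  proof -
    have "\<zeta> \<noteq> 0" using that by auto
    then have "\<bar>Re \<zeta>\<bar> > 0 \<or> \<bar>Im \<zeta>\<bar> > 0" by (simp add: complex_eq_iff)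
    then show ?thesis by (simp add: M_def less_max_iff_disj)
  qed
  \<comment> \<open>The circle is pushed radially to the boundary of a unit square, which is placed
    in the band at the lower end of the remaining coordinates. Dividing by \<open>M\<close>, twice
    the maximum norm, yields maximum norm 1/2.\<close>
  define \<sigma> :: "complex \<Rightarrow> real^4" where "\<sigma> \<zeta> = (\<chi> k. if k = i then real_of_int (w i) + 1 / 2 + Re \<zeta> / M \<zeta>
    else if k = j then real_of_int (w j) + 1 / 2 + Im \<zeta> / M \<zeta> else real_of_int (w k))" for \<zeta>
  have cM: "continuous_on (sphere 0 1) M" unfolding M_def by (intro continuous_intros)
  have "continuous_on (sphere 0 1) (\<lambda>\<zeta>. if k = i then real_of_int (w i) + 1 / 2 + Re \<zeta> / M \<zeta>
    else if k = j then real_of_int (w j) + 1 / 2 + Im \<zeta> / M \<zeta> else real_of_int (w k))" for k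
  proof -
    have "continuous_on (sphere 0 1) (\<lambda>\<zeta>. real_of_int (w i) + 1 / 2 + Re \<zeta> / M \<zeta>)"
      "continuous_on (sphere 0 1) (\<lambda>\<zeta>. real_of_int (w j) + 1 / 2 + Im \<zeta> / M \<zeta>)"
      using M by (auto intro!: continuous_intros cM simp: less_imp_neq[symmetric])
    then show ?thesis by (cases "k = i"; cases "k = j"; simp)
  qed
  then have c\<sigma>: "continuous_on (sphere 0 1) \<sigma>"
    unfolding \<sigma>_def by (intro continuous_on_vec_lambda)
  have im\<sigma>: "\<sigma> \<zeta> \<in> ?A" if z: "\<zeta> \<in> sphere 0 1" for \<zeta>
  proof -
    note Mz = M[OF z]
    have le: "\<bar>Re \<zeta> / M \<zeta>\<bar> \<le> 1 / 2" "\<bar>Im \<zeta> / M \<zeta>\<bar> \<le> 1 / 2"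
      using Mz by (auto simp: M_def abs_divide divide_le_eq)
    then have le': "0 \<le> 1 / 2 + Re \<zeta> / M \<zeta>" "1 / 2 + Re \<zeta> / M \<zeta> \<le> 1"
      "0 \<le> 1 / 2 + Im \<zeta> / M \<zeta>" "1 / 2 + Im \<zeta> / M \<zeta> \<le> 1"
      by linarith+
    have "\<bar>Re \<zeta>\<bar> = M \<zeta> / 2 \<or> \<bar>Im \<zeta>\<bar> = M \<zeta> / 2" by (simp add: M_def max_def)
    then have "\<bar>Re \<zeta> / M \<zeta>\<bar> = 1 / 2 \<or> \<bar>Im \<zeta> / M \<zeta>\<bar> = 1 / 2"
      using Mz by (auto simp: abs_divide)
    then consider b where "Re \<zeta> / M \<zeta> = of_bool b - 1 / 2" | b where "Im \<zeta> / M \<zeta> = of_bool b - 1 / 2"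
    proof -
      have "\<exists>b. t = of_bool b - 1 / 2" if "\<bar>t\<bar> = 1 / 2" for t :: real
        using that by (cases "t \<ge> 0") (auto intro: exI[of _ True] exI[of _ False])
      then show ?thesis using \<open>\<bar>Re \<zeta> / M \<zeta>\<bar> = 1 / 2 \<or> \<bar>Im \<zeta> / M \<zeta>\<bar> = 1 / 2\<close> that by blast
    qed
    then show ?thesis
    proof cases
      case 1
      then have "\<sigma> \<zeta> \<in> facet 1 w J (i, b)"
        using le'(3,4) ij by (auto simp: facet_def in_cell \<sigma>_def)
      then show ?thesis by (cases b) auto
    next
      case 2
      then have "\<sigma> \<zeta> \<in> facet 1 w J (j, b)"
        using le'(1,2) ij by (auto simp: facet_def in_cell \<sigma>_def)
      then show ?thesis by (cases b) auto
    qed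
  qed
  have r\<sigma>: "sgn (q (\<sigma> \<zeta>)) = \<zeta>" if z: "\<zeta> \<in> sphere 0 1" for \<zeta>
  proof -
    have "q (\<sigma> \<zeta>) = (1 / M \<zeta>) *\<^sub>R \<zeta>"
      using ij(3) by (simp add: q_def \<sigma>_def complex_eq_iff)
    then show ?thesis using M[OF z] z by (simp add: sgn_scaleR sgn_div_norm)
  qed
  have cr: "continuous_on ?A (\<lambda>x. sgn (q x))"
    using q0 unfolding q_def by (intro continuous_intros) auto
  have "\<sigma> \<in> sphere 0 1 \<rightarrow> ?A" "(\<lambda>x. sgn (q x)) \<in> ?A \<rightarrow> sphere 0 1"
    using im\<sigma> q0 by (auto simp: norm_sgn)
  then obtain c where "homotopic_with_canon (\<lambda>h. True) (sphere 0 1) (sphere (0::complex) 1) ((\<lambda>x. sgn (q x)) \<circ> \<sigma>) (\<lambda>x. c)"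
    using nullhomotopic_through_contractible[OF c\<sigma> _ cr _ A] by blast
  then have "homotopic_with_canon (\<lambda>h. True) (sphere 0 1) (sphere (0::complex) 1) id (\<lambda>x. c)"
    by (rule homotopic_with_eq) (use r\<sigma> in auto)
  then have "contractible (sphere (0::complex) 1)" unfolding contractible_def by blast
  then show False by (simp add: contractible_sphere)
qed

text \<open>The cube lies in \<open>Q\<close>, so the facets in \<open>A\<close> are precisely those
  in the knot. More than three leave only the case of two opposite pairs, where \<open>A\<close> is
  a band; a disk, however, is contractible.\<close>

lemma knot_disc_squares:
  assumes F: "F = cell 1 w J" "card J = 3" "F \<subseteq> Q" and A: "A = knot \<inter> Q" "A = \<Union>\<S>" "\<S> \<subseteq> cells 1 2" "A \<subseteq> F"
    and disc: "A homeomorphic cball (0 :: real^2) 1"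
  shows "card {S \<in> cells 1 2. S \<subseteq> A} \<le> 3"
proof (rule ccontr)
  assume more: "\<not> card {S \<in> cells 1 2. S \<subseteq> A} \<le> 3"
  have fA: "facet 1 w J x \<subseteq> A \<longleftrightarrow> facet 1 w J x \<subseteq> knot" if xJ: "x \<in> J \<times> UNIV" for x
  proof -
    obtain i b where x: "x = (i, b)" "i \<in> J" using xJ by auto
    have "facet 1 w J x face_of cell 1 w J"
      unfolding facet_def x(1) prod.case using x(2) by (intro cell_face) (cases b; auto)+
    then have "facet 1 w J x \<subseteq> Q" using F face_of_imp_subset by blast
    then show ?thesis using A(1) by blast
  qed
  have P: "{x \<in> J \<times> UNIV. facet 1 w J x \<subseteq> A} = {x \<in> J \<times> UNIV. facet 1 w J x \<subseteq> knot}"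
    using fA by blast
  have AJ: "A \<subseteq> cell 1 w J" using A(4) F(1) by simp
  have count: "int (card {S \<in> cells 1 2. S \<subseteq> A}) = (\<Sum>i\<in>UNIV. facet_count w J i)"
    using card_facets_in_subset[OF _ F(2) AJ] card_knot_facets P by simp
  have s: "\<forall>i. facet_count w J i \<noteq> 1" "(\<Sum>i\<in>UNIV. facet_count w J i) = 4"
  proof -
    have "\<not> (\<Sum>i\<in>UNIV. facet_count w J i) \<le> 3"
      unfolding count[symmetric] using more by simp
    then show "\<forall>i. facet_count w J i \<noteq> 1" "(\<Sum>i\<in>UNIV. facet_count w J i) = 4"
      using facet_count_cases[OF F(2), of w] by blast+
  qed
  have vals: "facet_count w J i = 0 \<or> facet_count w J i = 2" for i
    using s(1)[THEN spec, of i] by (auto simp: facet_count_def of_bool_def split: if_splits)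
  have zero: "\<not> facet 1 w J (i, b) \<subseteq> knot" if "facet_count w J i = 0" "i \<in> J" for i b
    using that by (cases b) (auto simp: facet_count_def of_bool_def split: if_splits)
  have two: "i \<in> J \<and> facet 1 w J (i, b) \<subseteq> knot" if "facet_count w J i = 2" for i b
    using that by (cases b) (auto simp: facet_count_def of_bool_def split: if_splits)
  define I where "I = {i. facet_count w J i = 2}"
  have "(\<Sum>i\<in>UNIV. facet_count w J i) = (\<Sum>i\<in>I. 2)"
    using vals by (intro sum.mono_neutral_cong_right) (auto simp: I_def)
  then have "card I = 2" using s(2) by simp
  then obtain i j where ij: "I = {i, j}" "i \<noteq> j" by (meson card_2_iff)
  have iJ: "i \<in> J" "j \<in> J" using two ij(1) unfolding I_def by blast+
  have "{x \<in> J \<times> UNIV. facet 1 w J x \<subseteq> A} = {i, j} \<times> UNIV"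
    unfolding P using vals zero two ij(1) unfolding I_def by fastforce
  then have sq: "{S \<in> cells 1 2. S \<subseteq> A} = facet 1 w J ` ({i, j} \<times> UNIV)"
    using facets_in_subset[OF _ F(2) AJ] by simp
  have "A = \<Union> {S \<in> cells 1 2. S \<subseteq> A}" using A(2,3) by blast
  also have "\<dots> = facet 1 w J (i, False) \<union> facet 1 w J (i, True) \<union> (facet 1 w J (j, False) \<union> facet 1 w J (j, True))"
    unfolding sq by (auto simp: UNIV_bool)
  finally have "\<not> contractible A" using band_not_contractible[OF iJ ij(2)] by simp
  moreover have "contractible (cball (0 :: real^2) 1)" by (intro convex_imp_contractible convex_cball)
  ultimately show False using homeomorphic_contractible_eq[OF disc] by blast
qed

text \<open>Areas are compared in squares of side \<open>1 / m\<close>: the knot contains at least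
  \<open>130 * m\<^sup>2\<close> of them, so a move that does not lower their number does not lower
  the area. The inverse of a subdivision cannot be applied at all.\<close>

lemma weakly_minimal_knot:
  assumes K: "two_knot knot"
  shows "weakly_minimal knot"
  unfolding weakly_minimal_def
proof (intro conjI allI impI)
  show "cubical_two_knot knot" using K knot_subset_skeleton2 by (simp add: cubical_two_knot_def)
  have subdivided: "real (area knot) \<le> euclidean_area m K'"
    if "m \<ge> 1" "card {S \<in> cells (1 / real m) 2. S \<subseteq> knot} \<le> card {S \<in> cells (1 / real m) 2. S \<subseteq> K'}" for m K'
  proof -
    have "130 * m\<^sup>2 \<le> card {S \<in> cells (1 / real m) 2. S \<subseteq> K'}"
      using card_subdivided_knot[OF that(1)] that(2) by linarith
    then have "real (130 * m\<^sup>2) \<le> real (card {S \<in> cells (1 / real m) 2. S \<subseteq> K'})" by (simp only: of_nat_le_iff)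
    then have "130 * (real m)\<^sup>2 \<le> real (card {S \<in> cells (1 / real m) 2. S \<subseteq> K'})" by simp
    then show ?thesis using that(1) by (simp add: area_knot euclidean_area_def pos_le_divide_eq)
  qed
  fix m K' assume "cubulated_move knot m K'"
  then show "\<not> euclidean_area m K' < real (area knot)"
  proof cases
    case subdivision
    then show ?thesis using subdivided[of m knot] by simp
  next
    case (inverse_subdivision k)
    then show ?thesis using knot_not_subset_coarse_skeleton2 by blast
  next
    case (face_boundary Q F A B)
    have s: "1 / real m > 0" using face_boundary(2) by simp
    have "F \<in> cells (1 / real m) 3" using face_boundary by (auto simp: cells_def)
    then obtain w J where F: "F = cell (1 / real m) w J" "card J = 3" unfolding cells_eq[OF s] by blast
    obtain \<S> where S: "\<S> \<subseteq> cells (1 / real m) 2" "A = \<Union>\<S>" using face_boundary by blast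
    have FQ: "F \<subseteq> Q" using face_boundary by (intro face_of_imp_subset)
    have "rel_frontier F \<subseteq> F"
      using closure_closed[of F] by (auto simp: rel_frontier_def F(1) cell_eq_cbox)
    then have AF: "A \<subseteq> F" using face_boundary by blast
    have "card {S \<in> cells (1 / real m) 2. S \<subseteq> A} \<le> 3"
    proof (cases "m = 1")
      case True
      have "card {S \<in> cells 1 2. S \<subseteq> A} \<le> 3"
        by (rule knot_disc_squares[of F w J Q A \<S>]) (use True F S FQ AF face_boundary in simp_all)
      then show ?thesis using True by simp
    next
      case False
      then have m: "m \<ge> 2" using face_boundary(2) by simp
      have "A \<subseteq> skeleton2 1" using face_boundary knot_subset_skeleton2 by blast
      then show ?thesis
        using card_facets_fine[OF m F(2), of A w] card_facets_in_subset[OF s F(2), of A w] AF F(1) by simp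
    qed
    then have "card {S \<in> cells (1 / real m) 2. S \<subseteq> knot} \<le> card {S \<in> cells (1 / real m) 2. S \<subseteq> (knot - A) \<union> closure (rel_frontier F - A)}"
      using face_boundary S by (intro face_boundary_move_squares[OF K bounded_knot s, of Q F A \<S>]) auto
    then show ?thesis using subdivided[of m K'] face_boundary by simp
  qed
qed

section \<open>Spinning the arc\<close>

lemma embed3_Complex: "embed3 (Complex x y, r) = vector [x, y, r, 0]"
  by (simp add: embed3_def)

lemma vector_4_eq_iff: "(vector [a, b, c, d] :: real^4) = vector [a', b', c', d'] \<longleftrightarrow> a = a' \<and> b = b' \<and> c = c' \<and> d = d'"
  by (simp add: vec_eq_iff forall_4)

fun polyline :: "'a::real_normed_vector list \<Rightarrow> real \<Rightarrow> 'a" where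
  "polyline (a # b # c # xs) = linepath a b +++ polyline (b # c # xs)"
| "polyline [a, b] = linepath a b"
| "polyline xs = linepath 0 0"

lemma closed_segment_axis:
  fixes x x' y y' r r' :: real
  shows "x \<le> x' \<Longrightarrow> closed_segment (vector [x, y, r, 0] :: real^4) (vector [x', y, r, 0]) = {vector [t, y, r, 0] | t. x \<le> t \<and> t \<le> x'}"
    and "y \<le> y' \<Longrightarrow> closed_segment (vector [x, y, r, 0] :: real^4) (vector [x, y', r, 0]) = {vector [x, t, r, 0] | t. y \<le> t \<and> t \<le> y'}"
    and "r \<le> r' \<Longrightarrow> closed_segment (vector [x, y, r, 0] :: real^4) (vector [x, y, r', 0]) = {vector [x, y, t, 0] | t. r \<le> t \<and> t \<le> r'}"
proof -
  have conv: "{(1 - u) * a + u * b | u. 0 \<le> u \<and> u \<le> 1} = {a..b}" if "a \<le> b" for a b :: real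
    using that closed_segment_eq_real_ivl[of a b] by (simp add: closed_segment_def)
  have *: "(\<exists>u. 0 \<le> u \<and> u \<le> 1 \<and> P ((1 - u) * a + u * b)) \<longleftrightarrow> (\<exists>t. a \<le> t \<and> t \<le> b \<and> P t)" if "a \<le> b" for a b :: real and P
    using conv[OF that] by (smt (verit) atLeastAtMost_iff mem_Collect_eq)
  have same: "(1 - u) * a + u * a = a" for u a :: real by (simp add: algebra_simps)
  have comb: "(1 - u) *\<^sub>R (vector [a, b, c, 0] :: real^4) + u *\<^sub>R vector [a', b', c', 0] =
    vector [(1 - u) * a + u * a', (1 - u) * b + u * b', (1 - u) * c + u * c', 0]" for u a b c a' b' c'
    by (simp add: vec_eq_iff forall_4)
  show "x \<le> x' \<Longrightarrow> closed_segment (vector [x, y, r, 0] :: real^4) (vector [x', y, r, 0]) = {vector [t, y, r, 0] | t. x \<le> t \<and> t \<le> x'}"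
    unfolding closed_segment_def comb same using *[of x x' "\<lambda>t. z = vector [t, y, r, 0]" for z :: "real^4"] by blast
  show "y \<le> y' \<Longrightarrow> closed_segment (vector [x, y, r, 0] :: real^4) (vector [x, y', r, 0]) = {vector [x, t, r, 0] | t. y \<le> t \<and> t \<le> y'}"
    unfolding closed_segment_def comb same using *[of y y' "\<lambda>t. z = vector [x, t, r, 0]" for z :: "real^4"] by blast
  show "r \<le> r' \<Longrightarrow> closed_segment (vector [x, y, r, 0] :: real^4) (vector [x, y, r', 0]) = {vector [x, y, t, 0] | t. r \<le> t \<and> t \<le> r'}"
    unfolding closed_segment_def comb same using *[of r r' "\<lambda>t. z = vector [x, y, t, 0]" for z :: "real^4"] by blast
qed

definition strand_vertices :: "(real^4) list" where
  "strand_vertices = [vector [- 1, 0, 0, 0], vector [- 1, 0, 3 / 2, 0], vector [1, 0, 3 / 2, 0], vector [1, 0, 1 / 2, 0],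
     vector [3, 0, 1 / 2, 0], vector [3, 2, 1 / 2, 0], vector [0, 2, 1 / 2, 0], vector [0, - 1, 1 / 2, 0],
     vector [2, - 1, 1 / 2, 0], vector [2, - 1, 3 / 2, 0], vector [2, 1, 3 / 2, 0], vector [2, 1, 0, 0]]"

definition strand_path :: "real \<Rightarrow> real^4" where
  "strand_path = polyline strand_vertices"

definition strand_set :: "(real^4) set" where
  "strand_set = {vector [x, y, r, 0] | x y r. strand x y r}"

lemma in_strand_set: "vector [x, y, r, 0] \<in> strand_set \<longleftrightarrow> strand x y r"
  by (auto simp: strand_set_def vector_4_eq_iff)

lemma segment_commute_le:
  "x' \<le> x \<Longrightarrow> closed_segment (vector [x, y, r, 0] :: real^4) (vector [x', y, r, 0]) = {vector [t, y, r, 0] | t. x' \<le> t \<and> t \<le> x}"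
  "y' \<le> y \<Longrightarrow> closed_segment (vector [x, y, r, 0] :: real^4) (vector [x, y', r, 0]) = {vector [x, t, r, 0] | t. y' \<le> t \<and> t \<le> y}"
  "r' \<le> r \<Longrightarrow> closed_segment (vector [x, y, r, 0] :: real^4) (vector [x, y, r', 0]) = {vector [x, y, t, 0] | t. r' \<le> t \<and> t \<le> r}"
  for x x' y y' r r' :: real
  using closed_segment_axis(1)[of x' x y r] closed_segment_axis(2)[of y' y x r] closed_segment_axis(3)[of r' r x y]
  by (simp_all add: closed_segment_commute)

lemma polyline_ends:
  "pathstart (polyline (a # b # xs)) = a" "pathfinish (polyline (a # b # xs)) = last (b # xs)"
  by (induction "a # b # xs" arbitrary: a b xs rule: polyline.induct) auto

fun segments :: "'a::real_vector list \<Rightarrow> 'a set list" where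
  "segments (a # b # xs) = closed_segment a b # segments (b # xs)"
| "segments xs = []"

lemma path_image_polyline:
  "path_image (polyline (a # b # xs)) = \<Union> (set (segments (a # b # xs)))"
  by (induction "a # b # xs" arbitrary: a b xs rule: polyline.induct)
    (auto simp: path_image_join polyline_ends)

lemma arc_polyline_step:
  assumes "arc (polyline (b # c # xs))" "a \<noteq> b" "closed_segment a b \<inter> \<Union> (set (segments (b # c # xs))) \<subseteq> {b}"
  shows "arc (polyline (a # b # c # xs))"
  using assms arc_join[OF arc_linepath[OF assms(2)] assms(1)]
  by (simp add: polyline_ends path_image_polyline del: segments.simps)

lemmas segment_simps = closed_segment_axis segment_commute_le

lemma arc_strand_path: "arc strand_path"
  unfolding strand_path_def strand_vertices_def
  apply (intro arc_polyline_step)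
  apply (simp_all only: polyline.simps segments.simps)
  apply (simp_all add: vector_4_eq_iff)
  apply (simp_all add: segment_simps)
  apply (auto simp: vector_4_eq_iff)
  done

lemma path_image_strand_path: "path_image strand_path = strand_set"
proof -
  have "path_image strand_path = \<Union> (set (segments strand_vertices))"
    unfolding strand_path_def strand_vertices_def by (rule path_image_polyline)
  also have "\<dots> = strand_set"
  proof (intro equalityI subsetI)
    fix z assume "z \<in> \<Union> (set (segments strand_vertices))"
    then show "z \<in> strand_set"
      unfolding strand_vertices_def
      by (simp add: segment_simps) (elim disjE exE conjE; simp add: in_strand_set strand_def)
  next
    fix z assume "z \<in> strand_set"
    then obtain x y r where z: "z = vector [x, y, r, 0]" and "strand x y r" by (auto simp: strand_set_def)
    then show "z \<in> \<Union> (set (segments strand_vertices))"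
      unfolding strand_vertices_def strand_def z
      by (elim disjE conjE; simp add: segment_simps vector_4_eq_iff)
  qed
  finally show ?thesis .
qed

lemma closing_path:
  defines "c \<equiv> polyline [vector [- 1, 0, 0, 0], vector [- 1, 1, 0, 0], vector [2, 1, 0, 0]] :: real \<Rightarrow> real^4"
  shows "arc c" "path_image c = {vector [x, y, r, 0] | x y r. closing_strand x y r}"
    "pathstart c = vector [- 1, 0, 0, 0]" "pathfinish c = vector [2, 1, 0, 0]"
proof -
  show "arc c"
    unfolding c_def
    apply (intro arc_polyline_step)
    apply (simp_all only: polyline.simps segments.simps)
    apply (simp_all add: vector_4_eq_iff)
    apply (simp_all add: segment_simps)
    apply (auto simp: vector_4_eq_iff)
    done
  have "path_image c = \<Union> (set (segments [vector [- 1, 0, 0, 0], vector [- 1, 1, 0, 0], vector [2, 1, 0, 0]]))"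
    unfolding c_def by (rule path_image_polyline)
  then show "path_image c = {vector [x, y, r, 0] | x y r. closing_strand x y r}"
    by (simp add: segment_simps closing_strand_def) (auto simp: vector_4_eq_iff)
  show "pathstart c = vector [- 1, 0, 0, 0]" "pathfinish c = vector [2, 1, 0, 0]"
    unfolding c_def by (simp_all only: polyline_ends last.simps) simp_all
qed

lemma strand_path_ends: "pathstart strand_path = vector [- 1, 0, 0, 0]" "pathfinish strand_path = vector [2, 1, 0, 0]"
  unfolding strand_path_def strand_vertices_def by (simp_all only: polyline_ends last.simps) simp_all

lemma strand_ground: "strand x y 0 \<Longrightarrow> x = - 1 \<and> y = 0 \<or> x = 2 \<and> y = 1"
  unfolding strand_def by auto

text \<open>The arc is polygonal as it stands, so the identity witnesses tameness. Radius 0 occurs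
  only at the two end points, and injectivity keeps the open arc away from them.\<close>

lemma spinnable_strand_path: "spinnable_arc strand_path"
  unfolding spinnable_arc_def
proof (intro conjI)
  show "arc strand_path" by (rule arc_strand_path)
  show half: "path_image strand_path \<subseteq> half_space3"
    using strand_bounds by (auto simp: path_image_strand_path strand_set_def half_space3_def)
  show "tame_in_half_space3 (path_image strand_path)"
    unfolding tame_in_half_space3_def
  proof (intro exI conjI)
    show "homeomorphism half_space3 half_space3 id id" by (simp add: homeomorphism_def)
    show "finite (set (segments strand_vertices))" by simp
    show "\<forall>L\<in>set (segments strand_vertices). \<exists>a b. L = closed_segment a b"
      unfolding strand_vertices_def by (simp, blast)
    show "id ` path_image strand_path = \<Union> (set (segments strand_vertices))"
      unfolding strand_path_def strand_vertices_def by (simp only: path_image_polyline image_id id_apply)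
  qed
  show "pathstart strand_path \<in> plane2" "pathfinish strand_path \<in> plane2"
    by (simp_all add: strand_path_ends plane2_def)
  show "strand_path ` {0<..<1} \<subseteq> half_space3 - plane2"
  proof
    fix z assume "z \<in> strand_path ` {0<..<1}"
    then obtain t where t: "0 < t" "t < 1" "z = strand_path t" by auto
    then have zp: "z \<in> path_image strand_path" by (auto simp: path_image_def)
    have inj: "inj_on strand_path {0..1}" using arc_strand_path by (simp add: arc_def)
    have "z \<noteq> strand_path 0" "z \<noteq> strand_path 1"
      using t inj_onD[OF inj, of t 0] inj_onD[OF inj, of t 1] by auto
    then have ends: "z \<noteq> vector [- 1, 0, 0, 0]" "z \<noteq> vector [2, 1, 0, 0]"
      using strand_path_ends by (simp_all add: pathstart_def pathfinish_def)
    have "z \<notin> plane2"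
    proof
      assume "z \<in> plane2"
      moreover obtain x y r where z: "z = vector [x, y, r, 0]" "strand x y r"
        using zp by (auto simp: path_image_strand_path strand_set_def)
      ultimately have "strand x y 0" "r = 0" by (simp_all add: plane2_def)
      then show False using strand_ground ends z(1) by blast
    qed
    then show "z \<in> half_space3 - plane2" using half zp by blast
  qed
qed

lemma strand_union_closing:
  "path_image strand_path \<union> {vector [x, y, r, 0] | x y r. closing_strand x y r} = embed3 ` closed_strand"
proof -
  have "embed3 ` closed_strand = {vector [x, y, r, 0] | x y r. strand x y r \<or> closing_strand x y r}"
    unfolding closed_strand_def by (auto simp: embed3_Complex image_iff) (metis embed3_Complex)+
  then show ?thesis by (auto simp: path_image_strand_path strand_set_def)
qed

lemma spun_trefoil_strand: "spun_trefoil (spin strand_set)"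
proof -
  let ?c = "polyline [vector [- 1, 0, 0, 0], vector [- 1, 1, 0, 0], vector [2, 1, 0, 0]] :: real \<Rightarrow> real^4"
  have "path_image ?c \<subseteq> plane2"
    unfolding closing_path(2) by (auto simp: plane2_def closing_strand_def)
  moreover have "trefoil_knot (path_image strand_path \<union> path_image ?c)"
    unfolding closing_path(2) strand_union_closing by (rule trefoil_knot_closed_strand)
  ultimately show ?thesis
    unfolding spun_trefoil_def path_image_strand_path[symmetric]
    using spinnable_strand_path closing_path(1,3,4) strand_path_ends
    by (intro exI[of _ strand_path] exI[of _ ?c]) simp
qed

text \<open>Latitude on the sphere becomes the parameter of the arc and longitude the angle of
  rotation. At the poles the longitude is undefined, but there the arc meets the plane and the
  radius of rotation is 0, which gives continuity; compactness turns the continuous injection into a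
  homeomorphism.\<close>

lemma spin_arc_homeomorphic_sphere:
  assumes g: "spinnable_arc g"
  shows "spin (path_image g) homeomorphic sphere (0 :: real^3) 1"
proof -
  have arc: "arc g" and half: "path_image g \<subseteq> half_space3"
    and ends: "g 0 \<in> plane2" "g 1 \<in> plane2" and inner: "g ` {0<..<1} \<subseteq> half_space3 - plane2"
    using g by (auto simp: spinnable_arc_def pathstart_def pathfinish_def)
  have inj: "inj_on g {0..1}" and cont: "continuous_on {0..1} g"
    using arc by (auto simp: arc_def path_def)
  have g4: "g t $ 3 \<ge> 0" "g t $ 4 = 0" if "0 \<le> t" "t \<le> 1" for t
  proof -
    have "g t \<in> half_space3" using half that by (auto simp: path_image_def image_subset_iff)
    then show "g t $ 3 \<ge> 0" "g t $ 4 = 0" by (simp_all add: half_space3_def)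
  qed
  have g3: "g t $ 3 = 0 \<longleftrightarrow> t = 0 \<or> t = 1" if "0 \<le> t" "t \<le> 1" for t
  proof -
    have "g t $ 3 \<noteq> 0" if "0 < t" "t < 1"
    proof -
      have "g t \<in> half_space3 - plane2" using subsetD[OF inner imageI[of t "{0<..<1}" g]] that by simp
      then show ?thesis by (auto simp: half_space3_def plane2_def)
    qed
    moreover have "g 0 $ 3 = 0" "g 1 $ 3 = 0" using ends by (simp_all add: plane2_def)
    ultimately show ?thesis using that by (cases "t = 0 \<or> t = 1") auto
  qed
  have g_eq: "t = t'" if t: "0 \<le> t" "t \<le> 1" "0 \<le> t'" "t' \<le> 1"
    and eq: "g t $ 1 = g t' $ 1" "g t $ 2 = g t' $ 2" "g t $ 3 = g t' $ 3" for t t'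
  proof -
    have "g t = g t'" using eq g4 t by (simp add: vec_eq_iff forall_4)
    then show ?thesis using inj_onD[OF inj] t by simp
  qed
  define lat where "lat s = (s $ 3 + 1) / 2" for s :: "real^3"
  define hor where "hor s = Complex (s $ 1) (s $ 2)" for s :: "real^3"
  define \<Phi> :: "real^3 \<Rightarrow> real^4" where "\<Phi> s = vector [g (lat s) $ 1, g (lat s) $ 2,
    Re (of_real (g (lat s) $ 3) * sgn (hor s)), Im (of_real (g (lat s) $ 3) * sgn (hor s))]" for s
  have sph: "(s $ 3)\<^sup>2 + (norm (hor s))\<^sup>2 = 1" if "s \<in> sphere 0 1" for s
  proof -
    have "s \<bullet> s = 1" using that by (simp add: norm_eq_1)
    then show ?thesis unfolding cmod_power2 hor_def by (simp add: inner_vec_def sum_3 power2_eq_square)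
  qed
  have lat: "0 \<le> lat s \<and> lat s \<le> 1" if "s \<in> sphere 0 1" for s
  proof -
    have "(s $ 3)\<^sup>2 \<le> 1" using sph[OF that] zero_le_power2[of "norm (hor s)"] by linarith
    then have "\<bar>s $ 3\<bar> \<le> 1" by (simp add: abs_square_le_1)
    then show ?thesis by (auto simp: lat_def)
  qed
  have pole: "hor s = 0 \<longleftrightarrow> lat s = 0 \<or> lat s = 1" if "s \<in> sphere 0 1" for s
  proof -
    have "hor s = 0 \<longleftrightarrow> (s $ 3)\<^sup>2 = 1" using sph[OF that] by auto
    then show ?thesis by (auto simp: lat_def power2_eq_1_iff)
  qed
  have clat: "continuous_on (sphere 0 1) (\<lambda>s. g (lat s))"
    by (rule continuous_on_compose2[OF cont]) (use lat in \<open>auto simp: lat_def intro!: continuous_intros\<close>)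
  have chor: "continuous_on (sphere 0 1) hor" unfolding hor_def by (intro continuous_intros)
  have cspin: "continuous_on (sphere 0 1) (\<lambda>s. of_real (g (lat s) $ 3) * sgn (hor s))"
    unfolding continuous_on_eq_continuous_within
  proof
    fix s :: "real^3" assume s: "s \<in> sphere 0 1"
    have c3: "continuous (at s within sphere 0 1) (\<lambda>s. g (lat s) $ 3)"
      using clat s unfolding continuous_on_eq_continuous_within by (auto intro: continuous_component)
    show "continuous (at s within sphere 0 1) (\<lambda>s. of_real (g (lat s) $ 3) * sgn (hor s))"
    proof (cases "hor s = 0")
      case False
      have "continuous (at s within sphere 0 1) hor"
        using chor s by (simp add: continuous_on_eq_continuous_within)
      moreover have "continuous (at s within sphere 0 1) (\<lambda>s. g (lat s))"
        using clat s by (simp add: continuous_on_eq_continuous_within)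
      ultimately show ?thesis using False by (intro continuous_intros)
    next
      case True
      then have "g (lat s) $ 3 = 0" using pole[OF s] g3 lat[OF s] by blast
      then have "((\<lambda>s. g (lat s) $ 3) \<longlongrightarrow> 0) (at s within sphere 0 1)"
        using c3 by (simp add: continuous_within)
      then have "((\<lambda>s. \<bar>g (lat s) $ 3\<bar>) \<longlongrightarrow> 0) (at s within sphere 0 1)"
        by (rule tendsto_rabs_zero)
      moreover have "\<forall>\<^sub>F s in at s within sphere 0 1. norm (of_real (g (lat s) $ 3) * sgn (hor s)) \<le> \<bar>g (lat s) $ 3\<bar>"
        by (intro always_eventually) (simp add: norm_mult norm_sgn)
      ultimately have "((\<lambda>s. of_real (g (lat s) $ 3) * sgn (hor s)) \<longlongrightarrow> 0) (at s within sphere 0 1)"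
        by (rule Lim_null_comparison[rotated])
      then show ?thesis using True by (simp add: continuous_within)
    qed
  qed
  have c\<Phi>: "continuous_on (sphere 0 1) \<Phi>"
    unfolding \<Phi>_def
    by (intro continuous_on_vector_4 continuous_on_component clat continuous_on_Re continuous_on_Im cspin)
  have "inj_on \<Phi> (sphere 0 1)"
  proof (rule inj_onI)
    fix s s' :: "real^3" assume s: "s \<in> sphere 0 1" "s' \<in> sphere 0 1" and eq: "\<Phi> s = \<Phi> s'"
    have e12: "g (lat s) $ 1 = g (lat s') $ 1" "g (lat s) $ 2 = g (lat s') $ 2"
      and e34: "of_real (g (lat s) $ 3) * sgn (hor s) = of_real (g (lat s') $ 3) * sgn (hor s')"
      using eq by (simp_all add: \<Phi>_def vector_4_eq_iff complex_eq_iff)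
    have n: "norm (of_real (g (lat s) $ 3) * sgn (hor s)) = g (lat s) $ 3" if "s \<in> sphere 0 1" for s
      using g4(1)[of "lat s"] g3[of "lat s"] pole[OF that] lat[OF that] by (auto simp: norm_mult norm_sgn)
    have e3: "g (lat s) $ 3 = g (lat s') $ 3" using n s e34 by metis
    then have l: "lat s = lat s'" using g_eq lat s e12 by blast
    then have s3: "s $ 3 = s' $ 3" by (simp add: lat_def)
    have "(norm (hor s))\<^sup>2 = (norm (hor s'))\<^sup>2" using sph[OF s(1)] sph[OF s(2)] unfolding s3 by linarith
    then have nh: "norm (hor s) = norm (hor s')" by simp
    have "hor s = hor s'"
    proof (cases "hor s = 0")
      case True
      then show ?thesis using nh by simp
    next
      case False
      then have "g (lat s) $ 3 \<noteq> 0" using pole[OF s(1)] g3 lat[OF s(1)] by blast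
      then have "sgn (hor s) = sgn (hor s')" using e34 e3 by simp
      then show ?thesis using nh False
        by (metis norm_eq_zero of_real_eq_0_iff sgn_eq divide_cancel_right)
    qed
    then show "s = s'" using s3 by (simp add: hor_def vec_eq_iff forall_3)
  qed
  moreover have "\<Phi> ` sphere 0 1 = spin (path_image g)"
  proof (intro equalityI subsetI)
    fix z assume "z \<in> \<Phi> ` sphere 0 1"
    then obtain s where s: "s \<in> sphere 0 1" "z = \<Phi> s" by blast
    have gi: "g (lat s) \<in> path_image g" using lat[OF s(1)] by (auto simp: path_image_def)
    define \<theta> where "\<theta> = Arg2pi (hor s) / (2 * pi)"
    have \<theta>: "0 \<le> \<theta>" "\<theta> \<le> 1" using Arg2pi_ge_0[of "hor s"] Arg2pi_lt_2pi[of "hor s"] by (auto simp: \<theta>_def)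
    have polar: "complex_of_real (g (lat s) $ 3) * sgn (hor s) = of_real (g (lat s) $ 3) * cis (2 * pi * \<theta>)"
    proof (cases "hor s = 0")
      case True
      then show ?thesis using pole[OF s(1)] g3[of "lat s"] lat[OF s(1)] by auto
    next
      case False
      have "hor s = of_real (norm (hor s)) * cis (Arg2pi (hor s))"
        using Arg2pi_eq[of "hor s"] by (simp add: cis_conv_exp)
      then have "sgn (hor s) = cis (Arg2pi (hor s))" using False
        by (metis nonzero_mult_div_cancel_left norm_eq_zero of_real_eq_0_iff sgn_eq)
      then show ?thesis by (simp add: \<theta>_def)
    qed
    have "z = vector [g (lat s) $ 1, g (lat s) $ 2, g (lat s) $ 3 * cos (2 * pi * \<theta>), g (lat s) $ 3 * sin (2 * pi * \<theta>)]"
      unfolding s(2) \<Phi>_def polar by simp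
    then show "z \<in> spin (path_image g)" using gi \<theta> unfolding spin_def by blast
  next
    fix z assume "z \<in> spin (path_image g)"
    then obtain t \<theta> where t: "0 \<le> t" "t \<le> 1"
      and z: "z = vector [g t $ 1, g t $ 2, g t $ 3 * cos (2 * pi * \<theta>), g t $ 3 * sin (2 * pi * \<theta>)]"
      by (auto simp: spin_def path_image_def)
    \<comment> \<open>The radius of the circle of latitude at height \<open>2 * t - 1\<close> on the
      unit sphere.\<close>
    define r where "r = sqrt (1 - (2 * t - 1)\<^sup>2)"
    have "\<bar>2 * t - 1\<bar> \<le> 1" using t by auto
    then have r: "r \<ge> 0" "r\<^sup>2 = 1 - (2 * t - 1)\<^sup>2" by (auto simp: r_def abs_square_le_1)
    define s :: "real^3" where "s = vector [r * cos (2 * pi * \<theta>), r * sin (2 * pi * \<theta>), 2 * t - 1]"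
    have hs: "hor s = of_real r * cis (2 * pi * \<theta>)" "lat s = t"
      by (simp_all add: hor_def lat_def s_def complex_eq_iff)
    have "s \<bullet> s = (r * cos (2 * pi * \<theta>))\<^sup>2 + (r * sin (2 * pi * \<theta>))\<^sup>2 + (2 * t - 1)\<^sup>2"
      by (simp add: inner_vec_def sum_3 s_def power2_eq_square)
    also have "\<dots> = r\<^sup>2 * ((cos (2 * pi * \<theta>))\<^sup>2 + (sin (2 * pi * \<theta>))\<^sup>2) + (2 * t - 1)\<^sup>2"
      by (simp only: power_mult_distrib distrib_left)
    also have "\<dots> = 1" unfolding sin_cos_squared_add2 r(2) by simp
    finally have "s \<bullet> s = 1" .
    then have s: "s \<in> sphere 0 1" by (simp add: norm_eq_1)
    have polar: "complex_of_real (g t $ 3) * sgn (hor s) = of_real (g t $ 3) * cis (2 * pi * \<theta>)"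
    proof (cases "r = 0")
      case True
      then show ?thesis using pole[OF s] hs g3[OF t] by auto
    next
      case False
      then show ?thesis using r(1) by (simp add: hs sgn_mult sgn_of_real sgn_eq[of "cis _"])
    qed
    have "\<Phi> s = z" unfolding \<Phi>_def hs(2) polar z by simp
    then show "z \<in> \<Phi> ` sphere 0 1" using s by blast
  qed
  ultimately have "sphere (0 :: real^3) 1 homeomorphic spin (path_image g)"
    using homeomorphic_compact[OF compact_sphere c\<Phi>] by blast
  then show ?thesis using homeomorphic_sym by blast
qed

section \<open>Rounding squares to circles\<close>

definition max_norm :: "complex \<Rightarrow> real" where
  "max_norm w = max \<bar>Re w\<bar> \<bar>Im w\<bar>"

definition round_square :: "complex \<Rightarrow> complex" where
  "round_square w = of_real (max_norm w) * sgn w"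

lemma max_norm_pos: "w \<noteq> 0 \<Longrightarrow> max_norm w > 0"
  by (auto simp: max_norm_def complex_eq_iff less_max_iff_disj)

lemma max_norm_nonneg: "max_norm w \<ge> 0"
  by (simp add: max_norm_def)

lemma max_norm_scale: "r \<ge> 0 \<Longrightarrow> max_norm (of_real r * w) = r * max_norm w"
  by (simp add: max_norm_def abs_mult max_mult_distrib_left)

lemma norm_round_square: "norm (round_square w) = max_norm w"
  using max_norm_nonneg[of w] by (cases "w = 0") (simp_all add: round_square_def norm_mult norm_sgn max_norm_def)

text \<open>Each ray is stretched by the factor \<open>max_norm w / norm w\<close>, which is
  constant along the ray; the reciprocal factor gives the inverse.\<close>

lemma bij_round_square: "bij round_square"
proof (rule o_bij)
  let ?g = "\<lambda>v. of_real (norm v / max_norm v) * v"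
  have "?g (round_square w) = w \<and> round_square (?g w) = w" for w
  proof (cases "w = 0")
    case False
    define N where "N = max_norm w"
    have N: "N > 0" using max_norm_pos[OF False] by (simp add: N_def)
    have nw: "norm w > 0" using False by simp
    have r: "round_square w = of_real (N / norm w) * w" by (simp add: round_square_def N_def sgn_eq)
    have "max_norm (round_square w) = N / norm w * N"
      unfolding r using N nw by (subst max_norm_scale) (simp_all add: N_def)
    then have "norm (round_square w) / max_norm (round_square w) = norm w / N"
      using N nw by (simp add: norm_round_square N_def[symmetric])
    then have "?g (round_square w) = of_real (norm w / N * (N / norm w)) * w"
      unfolding r by (simp only: of_real_mult mult.assoc)
    then have 1: "?g (round_square w) = w" using N nw by simp
    have "max_norm (?g w) = norm w"
      using N nw by (subst max_norm_scale) (simp_all add: N_def[symmetric])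
    moreover have "sgn (?g w) = sgn w"
      using N nw unfolding N_def[symmetric] by (simp only: sgn_mult sgn_of_real) simp
    ultimately have "round_square (?g w) = of_real (norm w) * sgn w" by (simp add: round_square_def)
    then show ?thesis using 1 False by (simp add: sgn_eq)
  qed (simp add: round_square_def max_norm_def)
  then show "?g \<circ> round_square = id" "round_square \<circ> ?g = id" by (simp_all add: fun_eq_iff)
qed

lemma continuous_on_round_square: "continuous_on UNIV round_square"
proof -
  have cN: "continuous_on UNIV max_norm" unfolding max_norm_def by (intro continuous_intros)
  have "isCont round_square w" for w
  proof (cases "w = 0")
    case False
    then show ?thesis
      using cN unfolding round_square_def
      by (intro continuous_intros) (auto simp: continuous_on_eq_continuous_at)
  next
    case True
    have "(max_norm \<longlongrightarrow> max_norm w) (at w)" using cN by (simp add: continuous_on_eq_continuous_at isCont_def)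
    then have "(max_norm \<longlongrightarrow> 0) (at w)" using True by (simp add: max_norm_def)
    moreover have "\<forall>\<^sub>F v in at w. norm (round_square v) \<le> max_norm v"
      by (intro always_eventually) (simp add: norm_round_square)
    ultimately have "(round_square \<longlongrightarrow> 0) (at w)" by (rule Lim_null_comparison[rotated])
    then show ?thesis using True by (simp add: isCont_def round_square_def)
  qed
  then show ?thesis by (simp add: continuous_at_imp_continuous_on)
qed

definition square_axis :: "real^4 \<Rightarrow> complex" where
  "square_axis x = Complex (x $ 3 - 1 / 2) (x $ 4 - 1 / 2)"

text \<open>Rounding takes place about the centre (1/2, 1/2) of the last two coordinates, and the
  result is centred at the origin, as the spin requires.\<close>

definition round_knot :: "real^4 \<Rightarrow> real^4" where
  "round_knot x = vector [x $ 1, x $ 2, Re (round_square (square_axis x)), Im (round_square (square_axis x))]"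

lemma homeomorphism_round_knot: "homeomorphism UNIV UNIV round_knot (inv round_knot)"
proof (rule homeomorphism_bij)
  have "continuous_on UNIV (\<lambda>x. round_square (square_axis x))"
    unfolding square_axis_def
    by (rule continuous_on_compose2[OF continuous_on_round_square]) (auto intro!: continuous_intros)
  then show "continuous_on UNIV round_knot"
    unfolding round_knot_def by (intro continuous_intros)
  show "bij round_knot"
  proof (rule o_bij)
    let ?w = "\<lambda>y :: real^4. inv round_square (Complex (y $ 3) (y $ 4))"
    let ?g = "\<lambda>y :: real^4. vector [y $ 1, y $ 2, Re (?w y) + 1 / 2, Im (?w y) + 1 / 2] :: real^4"
    have i: "inv round_square (round_square w) = w" "round_square (inv round_square w) = w" for w
      using bij_round_square by (simp_all add: bij_is_inj bij_is_surj surj_f_inv_f)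
    show "?g \<circ> round_knot = id"
      by (simp add: fun_eq_iff round_knot_def i vec_eq_iff forall_4 square_axis_def)
    show "round_knot \<circ> ?g = id"
      by (simp add: fun_eq_iff round_knot_def i vec_eq_iff forall_4 square_axis_def)
  qed
qed

text \<open>Rounding turns \<open>square_norm\<close> into the distance from the plane about which
  the arc is spun, so both sets are described by the same condition \<open>strand\<close>; the angle
  is read off with \<open>Arg2pi\<close>.\<close>

lemma round_knot_image: "round_knot ` knot = spin strand_set"
proof (intro equalityI subsetI)
  fix z assume "z \<in> round_knot ` knot"
  then obtain x where x: "x \<in> knot" "z = round_knot x" by blast
  define v where "v = round_square (square_axis x)"
  define \<theta> where "\<theta> = Arg2pi v / (2 * pi)"
  have nv: "norm v = square_norm x"
    by (simp add: v_def norm_round_square max_norm_def square_norm_def square_axis_def)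
  have \<theta>: "0 \<le> \<theta>" "\<theta> \<le> 1" using Arg2pi_ge_0[of v] Arg2pi_lt_2pi[of v] by (auto simp: \<theta>_def)
  have v: "v = of_real (square_norm x) * cis (2 * pi * \<theta>)"
    using Arg2pi_eq[of v] nv by (simp add: cis_conv_exp \<theta>_def)
  have "vector [x $ 1, x $ 2, square_norm x, 0] \<in> strand_set"
    using x(1) by (simp add: in_strand_set knot_def)
  moreover have "z = vector [x $ 1, x $ 2, square_norm x * cos (2 * pi * \<theta>), square_norm x * sin (2 * pi * \<theta>)]"
    unfolding x(2) round_knot_def v_def[symmetric] by (subst (1 2) v) simp
  ultimately show "z \<in> spin strand_set"
    unfolding spin_def using \<theta>
    by (intro CollectI exI[of _ "vector [x $ 1, x $ 2, square_norm x, 0]"] exI[of _ \<theta>]) simp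
next
  fix z assume "z \<in> spin strand_set"
  then obtain x y r \<theta> where s: "strand x y r" and z: "z = vector [x, y, r * cos (2 * pi * \<theta>), r * sin (2 * pi * \<theta>)]"
    by (auto simp: spin_def strand_set_def)
  have r: "r \<ge> 0" using strand_bounds[OF s] by blast
  obtain p where p: "round_knot p = z" by (metis homeomorphism_round_knot homeomorphism_def UNIV_I)
  have "round_square (square_axis p) = of_real r * cis (2 * pi * \<theta>)"
    using p by (simp add: z round_knot_def vector_4_eq_iff complex_eq_iff)
  then have "norm (round_square (square_axis p)) = r" using r by (simp add: norm_mult)
  then have "square_norm p = r"
    by (simp add: norm_round_square max_norm_def square_norm_def square_axis_def)
  then have "p \<in> knot" using p s by (simp add: z round_knot_def vector_4_eq_iff knot_def)
  then show "z \<in> round_knot ` knot" using p by blast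
qed

lemma isotopic_knot: "isotopic knot (spin strand_set)"
  unfolding isotopic_def using homeomorphism_round_knot round_knot_image by blast

lemma two_knot_knot: "two_knot knot"
proof -
  have "homeomorphism knot (spin strand_set) round_knot (inv round_knot)"
    using homeomorphism_of_subsets[OF homeomorphism_round_knot, of knot] round_knot_image by auto
  then have "knot homeomorphic spin strand_set" unfolding homeomorphic_def by blast
  moreover have "spin strand_set homeomorphic sphere (0 :: real^3) 1"
    using spin_arc_homeomorphic_sphere[OF spinnable_strand_path] by (simp add: path_image_strand_path)
  ultimately show ?thesis unfolding two_knot_def by (rule homeomorphic_trans)
qed

theorem theorem1:
  shows "\<exists>K S. weakly_minimal K \<and> area K = 130 \<and> spun_trefoil S \<and> isotopic K S"
  using weakly_minimal_knot[OF two_knot_knot] area_knot spun_trefoil_strand isotopic_knot by blast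

end
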